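(* For every integer $q>2$, the variety $\underline{VSP}(T_{cw,q})$ is a single point, where $T_{cw,q}\in\mathbb{C}^{q+1}\otimes\mathbb{C}^{q+1}\otimes\mathbb{C}^{q+1}$ is the small Coppersmith-Winograd tensor.
   Context: All vector spaces are over $\mathbb{C}$. The border rank $\underline{\mathbf{R}}(T)$ of $T\in A\otimes B\otimes C$ is the smallest $r$ such that $T$ is a limit of sums of $r$ rank one tensors $a\otimes b\otimes c$. With bases $a_0,\dots,a_q$; $b_0,\dots,b_q$; $c_0,\dots,c_q$ of three copies $A,B,C$ of $\mathbb{C}^{q+1}$, $$T_{cw,q}=\sum_{j=1}^q \left(a_0\otimes b_j\otimes c_j+a_j\otimes b_0\otimes c_j+a_j\otimes b_j\otimes c_0\right).$$ Definition of $\underline{VSP}(T)$. Let $T\in A\otimes B\otimes C$ and $r=\underline{\mathbf{R}}(T)$. Consider $\mathbb{Z}^{\oplus 3}$-graded ideals $I\subset Sym(A^* )\otimes Sym(B^* )\otimes Sym(C^* )$, with graded components $I_{stu}\subset S^sA^*\otimes S^tB^*\otimes S^uC^*$. Then $\underline{VSP}(T)$ is the set of such ideals $I$ arising from a border rank $r$ decomposition of $T$, that is: $I_{111}\subset T^\perp$, and $I$ is in the closure (in the multigraded Hilbert scheme, equivalently each $I_{stu}$ is a limit in the corresponding Grassmannian, simultaneously for all $(s,t,u)$) of the set of ideals of $r$ distinct points of $\mathbb{P}A\times\mathbb{P}B\times\mathbb{P}C$ whose component in each degree $(s,t,u)$ has codimension $\min\{r,\dim(S^sA^*\otimes S^tB^*\otimes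 S^uC^* )\}$. It is a projective variety embedded in a product of Grassmannians. *)

theory Defs
  imports "HOL-Analysis.Analysis" "HOL-Library.Poly_Mapping"
begin

text \<open>
  The spaces \<open>A\<close>, \<open>B\<close>, \<open>C\<close> are \<open>complex ^ 'a\<close>, \<open>complex ^ 'b\<close>, \<open>complex ^ 'c\<close>
  for finite index types, and \<open>A \<otimes> B \<otimes> C\<close> is the space of coordinate arrays \<open>T $ i $ j $ k\<close>.
\<close>

section \<open>Tensors and border rank\<close>

type_synonym ('a, 'b, 'c) tensor = "complex ^ 'c ^ 'b ^ 'a"

definition tensor_prod ::
    "complex ^ 'a \<Rightarrow> complex ^ 'b \<Rightarrow> complex ^ 'c \<Rightarrow> ('a, 'b, 'c) tensor" where
  "tensor_prod a b c = (\<chi> i j k. a $ i * b $ j * c $ k)"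

definition rank_one :: "('a::finite, 'b::finite, 'c::finite) tensor \<Rightarrow> bool" where
  "rank_one T \<longleftrightarrow> T \<noteq> 0 \<and> (\<exists>a b c. T = tensor_prod a b c)"

definition sums_of_rank_one :: "nat \<Rightarrow> ('a::finite, 'b::finite, 'c::finite) tensor set" where
  "sums_of_rank_one r = {(\<Sum>l<r. X l) | X. \<forall>l<r. rank_one (X l)}"

definition border_rank :: "('a::finite, 'b::finite, 'c::finite) tensor \<Rightarrow> nat" where
  "border_rank T = (LEAST r. T \<in> closure (sums_of_rank_one r))"

text \<open>
  The index type \<open>'q option\<close> has \<open>q + 1\<close> elements when \<open>'q\<close> has \<open>q\<close>: \<open>None\<close> plays the role of
  the index \<open>0\<close> and \<open>Some j\<close> that of the indices \<open>1, \<dots>, q\<close>.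
\<close>

definition T_cw :: "('q::finite option, 'q option, 'q option) tensor" where
  "T_cw =
    (let e\<^sub>0 = axis None 1; e = (\<lambda>j. axis (Some j) 1) in
      \<Sum>j\<in>UNIV. tensor_prod e\<^sub>0 (e j) (e j) + tensor_prod (e j) e\<^sub>0 (e j)
        + tensor_prod (e j) (e j) e\<^sub>0)"

section \<open>The multigraded polynomial ring\<close>

text \<open>
  A monomial of \<open>Sym A\<^sup>* \<otimes> Sym B\<^sup>* \<otimes> Sym C\<^sup>*\<close> is a triple of exponent vectors, one for each set of
  dual coordinates.
\<close>

type_synonym ('a, 'b, 'c) mono = "('a \<Rightarrow>\<^sub>0 nat) \<times> ('b \<Rightarrow>\<^sub>0 nat) \<times> ('c \<Rightarrow>\<^sub>0 nat)"
type_synonym ('a, 'b, 'c) mpoly3 = "('a, 'b, 'c) mono \<Rightarrow>\<^sub>0 complex"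

definition pscale :: "complex \<Rightarrow> ('a, 'b, 'c) mpoly3 \<Rightarrow> ('a, 'b, 'c) mpoly3" where
  "pscale c f = Poly_Mapping.single 0 c * f"

interpretation poly: vector_space pscale
  by unfold_locales
    (simp_all add: pscale_def algebra_simps single_add mult_single flip: mult.assoc)

definition deg :: "('a::finite \<Rightarrow>\<^sub>0 nat) \<Rightarrow> nat" where
  "deg m = (\<Sum>i\<in>UNIV. Poly_Mapping.lookup m i)"

definition homog :: "nat \<Rightarrow> nat \<Rightarrow> nat \<Rightarrow> ('a::finite, 'b::finite, 'c::finite) mpoly3 set" where
  "homog s t u =
    {f. \<forall>(m\<^sub>1, m\<^sub>2, m\<^sub>3) \<in> Poly_Mapping.keys f. deg m\<^sub>1 = s \<and> deg m\<^sub>2 = t \<and> deg m\<^sub>3 = u}"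

definition peval ::
    "('a::finite, 'b::finite, 'c::finite) mpoly3 \<Rightarrow>
      complex ^ 'a \<Rightarrow> complex ^ 'b \<Rightarrow> complex ^ 'c \<Rightarrow> complex" where
  "peval f a b c =
    (\<Sum>(m\<^sub>1, m\<^sub>2, m\<^sub>3) \<in> Poly_Mapping.keys f. Poly_Mapping.lookup f (m\<^sub>1, m\<^sub>2, m\<^sub>3)
      * (\<Prod>i\<in>UNIV. a $ i ^ Poly_Mapping.lookup m\<^sub>1 i)
      * (\<Prod>j\<in>UNIV. b $ j ^ Poly_Mapping.lookup m\<^sub>2 j)
      * (\<Prod>k\<in>UNIV. c $ k ^ Poly_Mapping.lookup m\<^sub>3 k))"

text \<open>
  Ideals are the submodules of the ring over itself; an ideal is multigraded if it is spanned by
  its homogeneous components.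
\<close>

definition multigraded_ideal :: "('a::finite, 'b::finite, 'c::finite) mpoly3 set \<Rightarrow> bool" where
  "multigraded_ideal I \<longleftrightarrow>
    module.subspace (*) I \<and> I = poly.span (\<Union>s t u. I \<inter> homog s t u)"

text \<open>The annihilator of \<open>T\<close> in \<open>A\<^sup>* \<otimes> B\<^sup>* \<otimes> C\<^sup>*\<close>, the part of degree \<open>(1, 1, 1)\<close>.\<close>

definition perp ::
    "('a::finite, 'b::finite, 'c::finite) tensor \<Rightarrow> ('a, 'b, 'c) mpoly3 set" where
  "perp T = {f \<in> homog 1 1 1.
    (\<Sum>i\<in>UNIV. \<Sum>j\<in>UNIV. \<Sum>k\<in>UNIV.
      Poly_Mapping.lookup f (Poly_Mapping.single i 1, Poly_Mapping.single j 1, Poly_Mapping.single k 1)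
        * T $ i $ j $ k) = 0}"

section \<open>Ideals of points\<close>

definition proj_space :: "(complex ^ 'a::finite) set set" where
  "proj_space = {L. vec.subspace L \<and> vec.dim L = 1}"

text \<open>
  A polynomial is in the multigraded ideal of \<open>Z\<close> if it vanishes at all choices of homogeneous
  coordinates of the points of \<open>Z\<close>. As the factors can be rescaled independently, this says that
  each of its homogeneous components vanishes on \<open>Z\<close>.
\<close>

definition vanishing_ideal ::
    "((complex ^ 'a) set \<times> (complex ^ 'b) set \<times> (complex ^ 'c) set) set
      \<Rightarrow> ('a::finite, 'b::finite, 'c::finite) mpoly3 set" where
  "vanishing_ideal Z = {f. \<forall>(L, M, N) \<in> Z.
    \<forall>a \<in> L - {0}. \<forall>b \<in> M - {0}. \<forall>c \<in> N - {0}. peval f a b c = 0}"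

definition generic_point_ideals ::
    "nat \<Rightarrow> ('a::finite, 'b::finite, 'c::finite) mpoly3 set set" where
  "generic_point_ideals r = {vanishing_ideal Z | Z.
    Z \<subseteq> proj_space \<times> proj_space \<times> proj_space \<and> finite Z \<and> card Z = r \<and>
    (\<forall>s t u. let V = homog s t u :: ('a, 'b, 'c) mpoly3 set in
      poly.dim V - poly.dim (vanishing_ideal Z \<inter> V) = min r (poly.dim V))}"

section \<open>Grassmannians\<close>

text \<open>
  The topology of coefficientwise convergence; on each finite-dimensional \<open>homog s t u\<close> it is the
  usual one.
\<close>

definition poly_topology :: "('a, 'b, 'c) mpoly3 topology" where
  "poly_topology = pullback_topology UNIV Poly_Mapping.lookup euclidean"

definition frames :: "nat \<Rightarrow> ('a, 'b, 'c) mpoly3 set \<Rightarrow> (nat \<Rightarrow> ('a, 'b, 'c) mpoly3) set" where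
  "frames k V = {F \<in> {..<k} \<rightarrow>\<^sub>E V. inj_on F {..<k} \<and> poly.independent (F ` {..<k})}"

definition grassmannian :: "nat \<Rightarrow> ('a, 'b, 'c) mpoly3 set \<Rightarrow> ('a, 'b, 'c) mpoly3 set set" where
  "grassmannian k V = {W. poly.subspace W \<and> W \<subseteq> V \<and> poly.dim W = k}"

text \<open>
  The Grassmannian of a finite-dimensional space \<open>V\<close> carries the quotient topology for the map
  sending a linearly independent \<open>k\<close>-tuple in \<open>V\<close> to its span.
\<close>

definition grassmannian_topology ::
    "nat \<Rightarrow> ('a, 'b, 'c) mpoly3 set \<Rightarrow> ('a, 'b, 'c) mpoly3 set topology" where
  "grassmannian_topology k V = topology (\<lambda>U. U \<subseteq> grassmannian k V \<and>
    openin (subtopology (product_topology (\<lambda>_. poly_topology) {..<k}) (frames k V))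
      {F \<in> frames k V. poly.span (F ` {..<k}) \<in> U})"

lemma openin_grassmannian_topology:
  "openin (grassmannian_topology k V) U \<longleftrightarrow> U \<subseteq> grassmannian k V \<and>
    openin (subtopology (product_topology (\<lambda>_. poly_topology) {..<k}) (frames k V))
      {F \<in> frames k V. poly.span (F ` {..<k}) \<in> U}"
proof -
  let ?X = "subtopology (product_topology (\<lambda>_. poly_topology) {..<k}) (frames k V)"
  let ?P = "\<lambda>U. {F \<in> frames k V. poly.span (F ` {..<k}) \<in> U}"
  have int: "?P (S \<inter> T) = ?P S \<inter> ?P T" for S T by blast
  have un: "?P (\<Union>K) = (\<Union>S\<in>K. ?P S)" for K by blast
  have "istopology (\<lambda>U. U \<subseteq> grassmannian k V \<and> openin ?X (?P U))"
    unfolding istopology_def int un by (auto intro!: openin_Int openin_Union simp del: openin_subtopology)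
  then show ?thesis
    unfolding grassmannian_topology_def by (simp add: topology_inverse')
qed

section \<open>The border variety of sums of powers\<close>

text \<open>
  The closure of the ideals of points is taken in the product of the Grassmannians over the
  countably many multidegrees. This product is metrizable, so limits of sequences suffice.
\<close>

definition limit_of_point_ideals ::
    "nat \<Rightarrow> ('a::finite, 'b::finite, 'c::finite) mpoly3 set \<Rightarrow> bool" where
  "limit_of_point_ideals r I \<longleftrightarrow>
    (\<exists>J. (\<forall>n. J n \<in> generic_point_ideals r) \<and>
      (\<forall>s t u. let V = homog s t u :: ('a, 'b, 'c) mpoly3 set in
        limitin (grassmannian_topology (poly.dim V - min r (poly.dim V)) V)
          (\<lambda>n. J n \<inter> V) (I \<inter> V) sequentially))"

definition border_VSP ::
    "('a::finite, 'b::finite, 'c::finite) tensor \<Rightarrow> ('a, 'b, 'c) mpoly3 set set" where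
  "border_VSP T = {I. multigraded_ideal I \<and> I \<inter> homog 1 1 1 \<subseteq> perp T \<and>
    limit_of_point_ideals (border_rank T) I}"

end

theory Submission
  imports Defs
begin

text \<open>
  Write \<open>x\<^sub>i, y\<^sub>i, z\<^sub>i\<close> for the coordinates on the three factors. The only point of the variety is
  the ideal of a fat point: the scheme \<open>Spec R\<close> with
  \<open>R = \<complex>[t\<^sub>1, \<dots>, t\<^sub>q] / (t\<^sub>i t\<^sub>j, t\<^sub>i\<^sup>2 - t\<^sub>j\<^sup>2 | i \<noteq> j)\<close>, a local algebra of length \<open>q + 2\<close>,
  embedded diagonally at \<open>a\<^sub>0 \<otimes> b\<^sub>0 \<otimes> c\<^sub>0\<close> by \<open>x = y = z = (1, t)\<close>. A form belongs to this ideal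
  (\<open>jet_ideal\<close>) iff its dehomogenisation \<open>f(1, t; 1, t; 1, t)\<close> is killed by the \<open>q + 2\<close> functionals
  spanning the dual of \<open>R\<close>, the \<^emph>\<open>jets\<close>: the constant coefficient, the coefficients of the
  \<open>t\<^sub>j\<close>, and the sum of the coefficients of the \<open>t\<^sub>j\<^sup>2\<close>. In degree \<open>(1, 1, 1)\<close> the last functional
  is pairing with the tensor itself (\<open>T_cw_nth\<close>), so the ideal is apolar to it.

  \<^emph>\<open>Existence.\<close> The \<open>q + 2\<close> points \<open>t = 0\<close>, \<open>t = \<epsilon> e\<^sub>j\<close> and \<open>t = \<epsilon>\<^sup>2 (1, \<dots>, 1)\<close> converge to
  \<open>Spec R\<close>: certain divided differences of the evaluations at these points have the same common
  kernel as the evaluations and tend to the jets (\<open>tendsto_divdiff_point_eval\<close>). They can be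
  normalised to be dual to fixed monomials, so that a frame of the limit kernel is moved to frames
  of the approximating kernels by subtracting these monomials (\<open>limitin_dual_kernels\<close>). The divided
  difference that tends to the sum of the coefficients of the \<open>t\<^sub>j\<^sup>2\<close> is at the same time a border
  rank decomposition of the tensor (\<open>T_cw_in_closure\<close>). Border rank \<open>q + 1\<close> is excluded by Strassen's
  commutation condition (\<open>strassen_commutation\<close>, \<open>T_cw_not_in_closure\<close>).

  \<^emph>\<open>Uniqueness.\<close> Let \<open>I\<close> be an ideal in the variety; it has codimension
  \<open>min (q + 2) (dim V)\<close> in each graded piece \<open>V\<close>. As \<open>I\<close> is an ideal and is apolar to the tensor in
  degree \<open>(1, 1, 1)\<close>, its forms of degree \<open>(1, 1, 0)\<close> are annihilated by all jets except possibly the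
  constant one. These conditions cut out a space in which \<open>I\<close> has codimension one, so that the space
  is spanned modulo \<open>I\<close> by a single form \<open>g\<close>. Now degree \<open>(2, 1, 0)\<close> is spanned modulo \<open>I\<close> by the
  \<open>q + 2\<close> forms \<open>x\<^sub>0 x\<^sub>j y\<^sub>j\<close> (one fixed \<open>j\<close>) and \<open>x\<^sub>i g\<close>, which are therefore independent modulo \<open>I\<close>.
  Comparing the two ways of reducing
  \<open>x\<^sub>i x\<^sub>k y\<^sub>l\<close> then kills every coefficient but one (this needs three distinct indices), and leaves
  the relations \<open>x\<^sub>k y\<^sub>0 = x\<^sub>0 y\<^sub>k\<close>, \<open>x\<^sub>k y\<^sub>l = 0\<close> and \<open>x\<^sub>k y\<^sub>k = x\<^sub>l y\<^sub>l\<close> of \<open>R\<close>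
  (\<open>relations_if_quotients_small\<close>). The same holds for the other two pairs of factors, and these
  relations generate the jet ideal in all degrees \<open>(a, b + 1, c + 1)\<close>
  (\<open>jet_ideal_subset_if_relations\<close>). The remaining degrees follow by multiplying with \<open>y\<^sub>0 z\<^sub>0\<close>, which
  does not change jets (\<open>eq_jet_ideal\<close>).
\<close>


section \<open>Dimension counting\<close>

context vector_space
begin

lemma finite_basis_of_subset:
  assumes "finite S" "V \<subseteq> span S"
  obtains B where "finite B" "B \<subseteq> V" "independent B" "V \<subseteq> span B" "card B = dim V"
proof -
  obtain B where B: "B \<subseteq> V" "independent B" "V \<subseteq> span B" "card B = dim V"
    using basis_exists by blast
  with independent_span_bound[OF assms(1) B(2)] assms(2) that show ?thesis by blast
qed

lemma dim_kernel_step: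
  assumes fin: "finite S" "V \<subseteq> span S" and V: "subspace V"
    and add: "\<And>f g. \<phi> (f + g) = \<phi> f + \<phi> g" and scale: "\<And>a f. \<phi> (scale a f) = a * \<phi> f"
    and d: "d \<in> V" "\<phi> d = 1"
  shows "dim V = Suc (dim {f \<in> V. \<phi> f = 0})"
proof -
  let ?K = "{f \<in> V. \<phi> f = 0}"
  have zero: "\<phi> 0 = 0" using scale[of 0 0] by simp
  have K: "subspace ?K"
    using V by (auto simp: subspace_def add scale zero)
  obtain B where B: "finite B" "B \<subseteq> ?K" "independent B" "?K \<subseteq> span B" "card B = dim ?K"
    using finite_basis_of_subset[of S ?K] fin by blast
  have BK: "span B = ?K" using B span_minimal[OF B(2) K] by blast
  then have dB: "d \<notin> span B" using d by auto
  have "independent (insert d B)" using dB B independent_insertI by blast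
  moreover have "V \<subseteq> span (insert d B)"
  proof
    fix f assume f: "f \<in> V"
    have "f - scale (\<phi> f) d \<in> ?K"
      using f d V add[of "f - scale (\<phi> f) d" "scale (\<phi> f) d"]
      by (simp add: subspace_diff subspace_scale scale)
    then show "f \<in> span (insert d B)" using BK by (auto simp: span_insert)
  qed
  moreover have "insert d B \<subseteq> V" using B d by auto
  ultimately have "card (insert d B) = dim V" using basis_card_eq_dim by blast
  moreover have "d \<notin> B" using dB span_base by blast
  ultimately show ?thesis using B by simp
qed

text \<open>The \<open>d i\<close> are dual to the functionals, which are therefore linearly independent on \<open>V\<close>.\<close>

lemma dim_common_kernel:
  assumes fin: "finite S" "V \<subseteq> span S" and V: "subspace V" and N: "finite N"
    and add: "\<And>i f g. i \<in> N \<Longrightarrow> \<phi> i (f + g) = \<phi> i f + \<phi> i g"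
    and scale: "\<And>i a f. i \<in> N \<Longrightarrow> \<phi> i (scale a f) = a * \<phi> i f"
    and d: "\<And>i. i \<in> N \<Longrightarrow> d i \<in> V"
    and dual: "\<And>i j. i \<in> N \<Longrightarrow> j \<in> N \<Longrightarrow> \<phi> i (d j) = of_bool (i = j)"
  shows "dim V = dim {f \<in> V. \<forall>i\<in>N. \<phi> i f = 0} + card N"
  using N add scale d dual
proof (induction N rule: finite_induct)
  case (insert k N)
  let ?K = "{f \<in> V. \<forall>i\<in>N. \<phi> i f = 0}"
  have zero: "\<phi> i 0 = 0" if "i \<in> insert k N" for i using insert.prems(2)[OF that, of 0 0] by simp
  have K: "subspace ?K"
    using V insert.prems(1,2) zero by (auto simp: subspace_def)
  have "dim ?K = Suc (dim {f \<in> ?K. \<phi> k f = 0})"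
  proof (rule dim_kernel_step[where S = S and d = "d k"])
    show "d k \<in> ?K" using insert by auto
  qed (use fin insert K in auto)
  also have "{f \<in> ?K. \<phi> k f = 0} = {f \<in> V. \<forall>i\<in>insert k N. \<phi> i f = 0}" by auto
  finally show ?case using insert by simp
qed simp

lemma subspace_eq_if_dim_ge:
  assumes fin: "finite S" "U \<subseteq> span S" and W: "subspace W" "W \<subseteq> U" and le: "dim U \<le> dim W"
  shows "W = U"
proof (rule ccontr)
  assume "W \<noteq> U"
  then obtain g where g: "g \<in> U" "g \<notin> W" using W by auto
  obtain B where B: "finite B" "B \<subseteq> W" "independent B" "W \<subseteq> span B" "card B = dim W"
    using finite_basis_of_subset[of S W] fin W by blast
  obtain C where C: "finite C" "C \<subseteq> U" "independent C" "U \<subseteq> span C" "card C = dim U"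
    using finite_basis_of_subset[of S U] fin by blast
  have BW: "span B = W" using B span_minimal[OF B(2) W(1)] by blast
  have "independent (insert g B)" using g BW B independent_insertI by blast
  moreover have "insert g B \<subseteq> span C" using g B W C by blast
  ultimately have "card (insert g B) \<le> card C" using independent_span_bound C by blast
  moreover have "g \<notin> B" using g B by blast
  ultimately show False using B C le by simp
qed

lemma exists_generator_mod:
  assumes fin: "finite S" "U \<subseteq> span S" and U: "subspace U" and W: "subspace W" "W \<subseteq> U"
    and le: "dim U \<le> Suc (dim W)"
  obtains g where "g \<in> U" "\<And>f. f \<in> U \<Longrightarrow> \<exists>c. f - scale c g \<in> W"
proof (cases "W = U")
  case True
  then show ?thesis using that[of 0] U by (auto simp: subspace_0)
next
  case False
  then obtain g where g: "g \<in> U" "g \<notin> W" using W by auto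
  obtain B where B: "finite B" "B \<subseteq> W" "independent B" "W \<subseteq> span B" "card B = dim W"
    using finite_basis_of_subset[of S W] fin W by blast
  have BW: "span B = W" using B span_minimal[OF B(2) W(1)] by blast
  have ind: "independent (insert g B)" using g BW B independent_insertI by blast
  have "g \<notin> B" using g B by blast
  then have "dim (span (insert g B)) = Suc (dim W)"
    using dim_span_eq_card_independent[OF ind] B by simp
  moreover have "span (insert g B) \<subseteq> U" using span_minimal[of "insert g B" U] g B W U by blast
  ultimately have "span (insert g B) = U"
    using subspace_eq_if_dim_ge[OF fin subspace_span] le by simp
  then show ?thesis using that[of g] g BW by (auto simp: span_insert)
qed

text \<open>
  As many elements as the codimension of \<open>W\<close>, if they span \<open>V\<close> modulo \<open>W\<close>, are independent
  modulo \<open>W\<close>: otherwise one of them could be omitted.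
\<close>

lemma independent_mod_if_spanning:
  assumes fin: "finite S" "W \<subseteq> span S" and W: "subspace W" and N: "finite N"
    and dim: "dim V = dim W + card N"
    and span: "\<And>f. f \<in> V \<Longrightarrow> \<exists>c. f - (\<Sum>i\<in>N. scale (c i) (h i)) \<in> W"
    and rel: "(\<Sum>i\<in>N. scale (c i) (h i)) \<in> W" and k: "k \<in> N"
  shows "c k = 0"
proof (rule ccontr)
  assume ck: "c k \<noteq> 0"
  obtain B where B: "finite B" "B \<subseteq> W" "independent B" "W \<subseteq> span B" "card B = dim W"
    using finite_basis_of_subset[of S W] fin by blast
  let ?C = "B \<union> h ` (N - {k})"
  have BC: "W \<subseteq> span ?C" using B span_mono[of B ?C] by blast
  have hi: "h i \<in> span ?C" if "i \<in> N - {k}" for i using that by (auto intro: span_base)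
  have "scale (c k) (h k) = (\<Sum>i\<in>N. scale (c i) (h i)) - (\<Sum>i\<in>N-{k}. scale (c i) (h i))"
    using N k by (simp add: sum.remove)
  also have "\<dots> \<in> span ?C"
    using rel BC hi by (auto intro!: span_diff[of "\<Sum>i\<in>N. scale (c i) (h i)"] span_scale span_sum[of "N - {k}"])
  finally have "scale (inverse (c k)) (scale (c k) (h k)) \<in> span ?C" by (rule span_scale)
  then have hk: "h k \<in> span ?C" using ck by simp
  have "V \<subseteq> span ?C"
  proof
    fix f assume "f \<in> V"
    then obtain a where a: "f - (\<Sum>i\<in>N. scale (a i) (h i)) \<in> W" using span by blast
    have "(\<Sum>i\<in>N. scale (a i) (h i)) \<in> span ?C"
      using hk hi by (intro span_sum span_scale) blast
    with a BC show "f \<in> span ?C"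
      using span_add[of "f - (\<Sum>i\<in>N. scale (a i) (h i))" ?C "\<Sum>i\<in>N. scale (a i) (h i)"] by auto
  qed
  then have "dim V \<le> card ?C" using B N by (intro dim_le_card) auto
  also have "\<dots> \<le> card B + card (N - {k})"
    by (rule order_trans[OF card_Un_le]) (simp add: card_image_le N)
  finally have "card N \<le> card (N - {k})" using dim B by simp
  then show False using N k by (meson card_Diff1_less not_le)
qed

end


section \<open>Linear functionals on polynomials\<close>

definition lin :: "('m \<Rightarrow> complex) \<Rightarrow> ('m \<Rightarrow>\<^sub>0 complex) \<Rightarrow> complex" where
  "lin c f = (\<Sum>m\<in>Poly_Mapping.keys f. Poly_Mapping.lookup f m * c m)"

lemma lin_superset:
  assumes "finite S" "Poly_Mapping.keys f \<subseteq> S"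
  shows "lin c f = (\<Sum>m\<in>S. Poly_Mapping.lookup f m * c m)"
  unfolding lin_def using assms by (intro sum.mono_neutral_left) (auto simp: in_keys_iff)

lemma lin_zero [simp]: "lin c 0 = 0"
  by (simp add: lin_def)

lemma lin_add: "lin c (f + g) = lin c f + lin c g"
proof -
  let ?S = "Poly_Mapping.keys f \<union> Poly_Mapping.keys g"
  have "finite ?S" "Poly_Mapping.keys f \<subseteq> ?S" "Poly_Mapping.keys g \<subseteq> ?S" "Poly_Mapping.keys (f + g) \<subseteq> ?S"
    using keys_add[of f g] by auto
  then show ?thesis
    by (simp add: lin_superset[of ?S] lookup_add algebra_simps sum.distrib)
qed

lemma lin_sum: "lin c (sum f A) = (\<Sum>i\<in>A. lin c (f i))"
  by (induction A rule: infinite_finite_induct) (auto simp: lin_add)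

lemma lin_single [simp]: "lin c (Poly_Mapping.single m a) = a * c m"
  by (cases "a = 0") (auto simp: lin_def)

lemma poly_mapping_eq_sum_single:
  "f = (\<Sum>m\<in>Poly_Mapping.keys f. Poly_Mapping.single m (Poly_Mapping.lookup f m))"
proof (rule poly_mapping_eqI)
  fix k
  have "(\<Sum>m\<in>Poly_Mapping.keys f. Poly_Mapping.lookup (Poly_Mapping.single m (Poly_Mapping.lookup f m)) k)
    = (\<Sum>m\<in>Poly_Mapping.keys f. if m = k then Poly_Mapping.lookup f k else 0)"
    by (intro sum.cong) (auto simp: lookup_single)
  then show "Poly_Mapping.lookup f k = Poly_Mapping.lookup
      (\<Sum>m\<in>Poly_Mapping.keys f. Poly_Mapping.single m (Poly_Mapping.lookup f m)) k"
    by (auto simp: lookup_sum in_keys_iff)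
qed

lemma lin_single_mult:
  fixes f :: "'m::monoid_add \<Rightarrow>\<^sub>0 complex"
  shows "lin c (Poly_Mapping.single m a * f) = a * lin (\<lambda>n. c (m + n)) f"
proof -
  have "Poly_Mapping.single m a * f =
      (\<Sum>n\<in>Poly_Mapping.keys f. Poly_Mapping.single (m + n) (a * Poly_Mapping.lookup f n))"
    by (subst poly_mapping_eq_sum_single[of f]) (simp add: sum_distrib_left mult_single)
  then show ?thesis
    by (simp add: lin_sum) (simp add: lin_def sum_distrib_left mult.assoc)
qed

lemma lin_cong: "(\<And>m. m \<in> Poly_Mapping.keys f \<Longrightarrow> c m = d m) \<Longrightarrow> lin c f = lin d f"
  by (simp add: lin_def)

lemma lin_zero_fun [simp]: "lin (\<lambda>m. 0) f = 0"
  by (simp add: lin_def)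

lemma lin_diff_fun: "lin (\<lambda>m. c m - d m) f = lin c f - lin d f"
  by (simp add: lin_def sum_subtractf algebra_simps)

lemma lin_scale_fun: "lin (\<lambda>m. a * c m) f = a * lin c f"
  by (simp add: lin_def sum_distrib_left algebra_simps)

lemma lin_sum_fun: "lin (\<lambda>m. \<Sum>i\<in>A. c i m) f = (\<Sum>i\<in>A. lin (c i) f)"
  by (simp add: lin_def sum_distrib_left) (rule sum.swap)

lemma tendsto_lin:
  "(\<And>m. ((\<lambda>n. c n m) \<longlongrightarrow> d m) F) \<Longrightarrow> ((\<lambda>n. lin (c n) f) \<longlongrightarrow> lin d f) F"
  unfolding lin_def by (intro tendsto_sum tendsto_mult tendsto_const)

lemma lin_pscale: "lin c (pscale a f) = a * lin c f"
  by (simp add: pscale_def lin_single_mult)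

lemma lin_minus: "lin c (- f) = - lin c f"
  using lin_add[of c f "- f"] by (simp add: eq_neg_iff_add_eq_0 add.commute)

lemma lin_diff: "lin c (f - g) = lin c f - lin c g"
  using lin_add[of c f "- g"] by (simp add: lin_minus)

lemma lookup_eq_lin: "Poly_Mapping.lookup f m = lin (\<lambda>n. of_bool (n = m)) f"
proof -
  have "lin (\<lambda>n. of_bool (n = m)) f = lin (\<lambda>n. of_bool (n = m)) (\<Sum>m\<in>Poly_Mapping.keys f. Poly_Mapping.single m (Poly_Mapping.lookup f m))"
    by (subst poly_mapping_eq_sum_single[of f]) rule
  also have "\<dots> = (\<Sum>n\<in>Poly_Mapping.keys f. if n = m then Poly_Mapping.lookup f m else 0)"
    by (auto simp: lin_sum intro!: sum.cong)
  finally show ?thesis by (simp add: in_keys_iff)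
qed

lemma lookup_pscale: "Poly_Mapping.lookup (pscale a f) m = a * Poly_Mapping.lookup f m"
  by (simp add: lookup_eq_lin lin_pscale)

section \<open>Multidegrees\<close>

definition mdeg :: "('a::finite, 'b::finite, 'c::finite) mono \<Rightarrow> nat \<times> nat \<times> nat" where
  "mdeg m = (deg (fst m), deg (fst (snd m)), deg (snd (snd m)))"

lemma mdeg_Pair: "mdeg (m1, m2, m3) = (deg m1, deg m2, deg m3)"
  by (simp add: mdeg_def)

lemma deg_zero [simp]: "deg 0 = 0"
  by (simp add: deg_def)

lemma deg_single [simp]: "deg (Poly_Mapping.single i k) = k"
  by (simp add: deg_def lookup_single when_def)

lemma deg_add: "deg (m + n) = deg m + deg n"
  by (simp add: deg_def lookup_add sum.distrib)

lemma deg_eq_0_iff [simp]: "deg m = 0 \<longleftrightarrow> m = 0"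
  by (auto simp: deg_def intro!: poly_mapping_eqI)

lemma deg_eq_SucE:
  assumes "deg m = Suc n"
  obtains i m' where "m = Poly_Mapping.single i 1 + m'" "deg m' = n"
proof -
  have "m \<noteq> 0" using assms by auto
  then obtain i where i: "Poly_Mapping.lookup m i \<noteq> 0" by (metis lookup_zero poly_mapping_eqI)
  define m' where "m' = m - Poly_Mapping.single i 1"
  have "m = Poly_Mapping.single i 1 + m'"
    using i unfolding m'_def
    by (intro poly_mapping_eqI) (auto simp: lookup_add lookup_minus lookup_single when_def)
  with assms that show ?thesis by (simp add: deg_add)
qed

lemma deg_eq_1E:
  assumes "deg m = Suc 0" obtains i where "m = Poly_Mapping.single i 1"
  using deg_eq_SucE[OF assms] by (metis add.right_neutral deg_eq_0_iff)

lemma mdeg_add: "mdeg (m + n) = mdeg m + mdeg n"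
  by (simp add: mdeg_def deg_add plus_prod_def)

lemma homog_iff: "f \<in> homog s t u \<longleftrightarrow> (\<forall>m\<in>Poly_Mapping.keys f. mdeg m = (s, t, u))"
  by (auto simp: homog_def mdeg_def)

lemma homogD: "f \<in> homog s t u \<Longrightarrow> m \<in> Poly_Mapping.keys f \<Longrightarrow> mdeg m = (s, t, u)"
  by (simp add: homog_iff)

lemma homog_zero [simp]: "0 \<in> homog s t u"
  by (simp add: homog_iff)

lemma homog_single: "mdeg m = (s, t, u) \<Longrightarrow> Poly_Mapping.single m a \<in> homog s t u"
  by (simp add: homog_iff)

lemma homog_add: "f \<in> homog s t u \<Longrightarrow> g \<in> homog s t u \<Longrightarrow> f + g \<in> homog s t u"
  using keys_add[of f g] by (auto simp: homog_iff)

lemma homog_mult: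
  assumes "f \<in> homog s t u" "g \<in> homog s' t' u'"
  shows "f * g \<in> homog (s + s') (t + t') (u + u')"
  unfolding homog_iff
proof
  fix m assume "m \<in> Poly_Mapping.keys (f * g)"
  then obtain a b where "m = a + b" "a \<in> Poly_Mapping.keys f" "b \<in> Poly_Mapping.keys g"
    using keys_mult[of f g] by blast
  then show "mdeg m = (s + s', t + t', u + u')"
    using assms by (simp add: mdeg_add homog_iff)
qed

lemma homog_pscale: "f \<in> homog s t u \<Longrightarrow> pscale a f \<in> homog s t u"
  unfolding pscale_def using homog_mult[of "Poly_Mapping.single 0 a" 0 0 0 f s t u]
  by (simp add: homog_single mdeg_def)

lemma subspace_homog: "poly.subspace (homog s t u)"
  by (simp add: poly.subspace_def homog_add homog_pscale)

lemma finite_deg: "finite {m :: 'a::finite \<Rightarrow>\<^sub>0 nat. deg m = k}"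
proof (rule finite_imageD[of Poly_Mapping.lookup])
  have "Poly_Mapping.lookup m i \<le> deg m" for m :: "'a \<Rightarrow>\<^sub>0 nat" and i
    unfolding deg_def by (rule member_le_sum) auto
  then have "Poly_Mapping.lookup ` {m :: 'a \<Rightarrow>\<^sub>0 nat. deg m = k} \<subseteq> (UNIV \<rightarrow>\<^sub>E {..k})" by auto
  then show "finite (Poly_Mapping.lookup ` {m :: 'a \<Rightarrow>\<^sub>0 nat. deg m = k})"
    by (rule finite_subset) (intro finite_PiE; simp)
  show "inj_on Poly_Mapping.lookup {m :: 'a \<Rightarrow>\<^sub>0 nat. deg m = k}"
    by (auto simp: inj_on_def intro!: poly_mapping_eqI)
qed

lemma finite_mdeg: "finite {m :: ('a::finite, 'b::finite, 'c::finite) mono. mdeg m = (s, t, u)}"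
proof -
  have "{m :: ('a, 'b, 'c) mono. mdeg m = (s, t, u)} = {m. deg m = s} \<times> {m. deg m = t} \<times> {m. deg m = u}"
    by (auto simp: mdeg_def)
  then show ?thesis by (simp add: finite_deg)
qed

lemma homog_subset_span:
  "homog s t u \<subseteq> poly.span ((\<lambda>m :: ('a::finite, 'b::finite, 'c::finite) mono.
    Poly_Mapping.single m 1) ` {m. mdeg m = (s, t, u)})"
proof
  fix f :: "('a, 'b, 'c) mpoly3" assume f: "f \<in> homog s t u"
  have "f = (\<Sum>m\<in>Poly_Mapping.keys f. pscale (Poly_Mapping.lookup f m) (Poly_Mapping.single m 1))"
    by (subst poly_mapping_eq_sum_single[of f]) (simp add: pscale_def mult_single)
  also have "\<dots> \<in> poly.span ((\<lambda>m. Poly_Mapping.single m 1) ` {m. mdeg m = (s, t, u)})"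
    using f by (intro poly.span_sum poly.span_scale poly.span_base) (auto dest: homogD)
  finally show "f \<in> poly.span ((\<lambda>m. Poly_Mapping.single m 1) ` {m. mdeg m = (s, t, u)})" .
qed

lemma homog_finitely_spanned:
  obtains S where "finite S" "homog s t u \<subseteq> poly.span S"
  using homog_subset_span finite_mdeg by (metis finite_imageI)

lemma homog_induct [consumes 1, case_names zero add single]:
  assumes f: "f \<in> homog s t u"
    and zero: "P 0" and add: "\<And>f g. P f \<Longrightarrow> P g \<Longrightarrow> P (f + g)"
    and single: "\<And>m a. mdeg m = (s, t, u) \<Longrightarrow> P (Poly_Mapping.single m a)"
  shows "P f"
proof -
  have "P (\<Sum>m\<in>A. Poly_Mapping.single m (Poly_Mapping.lookup f m))"
    if "finite A" "A \<subseteq> Poly_Mapping.keys f" for A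
    using that by (induction rule: finite_induct) (auto intro!: zero add single homogD[OF f])
  from this[OF _ order_refl] show ?thesis
    using poly_mapping_eq_sum_single[of f] by simp
qed

definition X :: "'a \<Rightarrow> ('a, 'b, 'c) mpoly3" where
  "X i = Poly_Mapping.single (Poly_Mapping.single i 1, 0, 0) 1"
definition Y :: "'b \<Rightarrow> ('a, 'b, 'c) mpoly3" where
  "Y i = Poly_Mapping.single (0, Poly_Mapping.single i 1, 0) 1"
definition Z :: "'c \<Rightarrow> ('a, 'b, 'c) mpoly3" where
  "Z i = Poly_Mapping.single (0, 0, Poly_Mapping.single i 1) 1"

lemma homog_X: "X i \<in> homog (Suc 0) 0 0" and homog_Y: "Y i \<in> homog 0 (Suc 0) 0" and homog_Z: "Z i \<in> homog 0 0 (Suc 0)"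
  by (auto simp: X_def Y_def Z_def mdeg_def intro!: homog_single)

lemma homog_X_mult: "h \<in> homog s t u \<Longrightarrow> X i * h \<in> homog (Suc s) t u"
  and homog_Y_mult: "h \<in> homog s t u \<Longrightarrow> Y i * h \<in> homog s (Suc t) u"
  and homog_Z_mult: "h \<in> homog s t u \<Longrightarrow> Z i * h \<in> homog s t (Suc u)"
  using homog_mult[OF homog_X] homog_mult[OF homog_Y] homog_mult[OF homog_Z] by fastforce+

lemma homog_X_induct [consumes 1, case_names zero add X]:
  fixes P :: "('a::finite, 'b::finite, 'c::finite) mpoly3 \<Rightarrow> bool"
  assumes f: "f \<in> homog (Suc s) t u"
    and zero: "P 0" and add: "\<And>f g. P f \<Longrightarrow> P g \<Longrightarrow> P (f + g)"
    and X: "\<And>i h. h \<in> homog s t u \<Longrightarrow> P (X i * h)"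
  shows "P f"
  using f
proof (induction rule: homog_induct)
  case (single m a)
  obtain m1 m2 m3 where m: "m = (m1, m2, m3)" by (cases m)
  with single obtain i m' where m': "m1 = Poly_Mapping.single i 1 + m'" "deg m' = s"
    by (auto simp: mdeg_Pair elim: deg_eq_SucE)
  have "Poly_Mapping.single m a = X i * Poly_Mapping.single (m', m2, m3) a"
    by (simp add: X_def mult_single m m')
  then show ?case using single m m' by (auto intro!: X homog_single simp: mdeg_Pair)
qed (use zero add in auto)

lemma homog_Y_induct [consumes 1, case_names zero add Y]:
  fixes P :: "('a::finite, 'b::finite, 'c::finite) mpoly3 \<Rightarrow> bool"
  assumes f: "f \<in> homog s (Suc t) u"
    and zero: "P 0" and add: "\<And>f g. P f \<Longrightarrow> P g \<Longrightarrow> P (f + g)"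
    and Y: "\<And>i h. h \<in> homog s t u \<Longrightarrow> P (Y i * h)"
  shows "P f"
  using f
proof (induction rule: homog_induct)
  case (single m a)
  obtain m1 m2 m3 where m: "m = (m1, m2, m3)" by (cases m)
  with single obtain i m' where m': "m2 = Poly_Mapping.single i 1 + m'" "deg m' = t"
    by (auto simp: mdeg_Pair elim: deg_eq_SucE)
  have "Poly_Mapping.single m a = Y i * Poly_Mapping.single (m1, m', m3) a"
    by (simp add: Y_def mult_single m m')
  then show ?case using single m m' by (auto intro!: Y homog_single simp: mdeg_Pair)
qed (use zero add in auto)

lemma homog_Z_induct [consumes 1, case_names zero add Z]:
  fixes P :: "('a::finite, 'b::finite, 'c::finite) mpoly3 \<Rightarrow> bool"
  assumes f: "f \<in> homog s t (Suc u)"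
    and zero: "P 0" and add: "\<And>f g. P f \<Longrightarrow> P g \<Longrightarrow> P (f + g)"
    and Z: "\<And>i h. h \<in> homog s t u \<Longrightarrow> P (Z i * h)"
  shows "P f"
  using f
proof (induction rule: homog_induct)
  case (single m a)
  obtain m1 m2 m3 where m: "m = (m1, m2, m3)" by (cases m)
  with single obtain i m' where m': "m3 = Poly_Mapping.single i 1 + m'" "deg m' = u"
    by (auto simp: mdeg_Pair elim: deg_eq_SucE)
  have "Poly_Mapping.single m a = Z i * Poly_Mapping.single (m1, m2, m') a"
    by (simp add: Z_def mult_single m m')
  then show ?case using single m m' by (auto intro!: Z homog_single simp: mdeg_Pair)
qed (use zero add in auto)

section \<open>Ideals\<close>

locale poly_ideal =
  fixes I :: "('a, 'b, 'c) mpoly3 set"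
  assumes zero [simp, intro]: "0 \<in> I"
    and add: "f \<in> I \<Longrightarrow> g \<in> I \<Longrightarrow> f + g \<in> I"
    and mult: "f \<in> I \<Longrightarrow> h * f \<in> I"
begin

lemma minus: "f \<in> I \<Longrightarrow> - f \<in> I"
  using mult[of f "- 1"] by simp

lemma diff: "f \<in> I \<Longrightarrow> g \<in> I \<Longrightarrow> f - g \<in> I"
  using add[of f "- g"] minus by simp

lemma pscale: "f \<in> I \<Longrightarrow> pscale a f \<in> I"
  by (simp add: pscale_def mult)

lemma subspace: "poly.subspace I"
  by (simp add: poly.subspace_def add pscale)

end

lemma poly_ideal_iff: "module.subspace (*) I \<longleftrightarrow> poly_ideal I"
proof -
  interpret module "(*) :: ('a, 'b, 'c) mpoly3 \<Rightarrow> _" by unfold_locales (auto simp: algebra_simps)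
  show ?thesis by (auto simp: subspace_def poly_ideal_def)
qed


section \<open>Jets and the jet ideal\<close>

type_synonym 'q cwmono = "('q option, 'q option, 'q option) mono"
type_synonym 'q cwpoly = "('q option, 'q option, 'q option) mpoly3"

text \<open>
  The exponent of \<open>t\<close> in the restriction of a monomial to the diagonal chart
  \<open>x = y = z = (1, t)\<close>: the variables of index \<open>None\<close> become \<open>1\<close> and the three variables of index
  \<open>Some j\<close> all become \<open>t\<^sub>j\<close>.
\<close>

definition texp :: "'q cwmono \<Rightarrow> 'q \<Rightarrow>\<^sub>0 nat" where
  "texp m = Poly_Mapping.map_key Some (fst m + fst (snd m) + snd (snd m))"

lemma inj_Some': "inj Some"
  by (simp add: inj_def)

lemma texp_add: "texp (m + n) = texp m + texp n"
  by (simp add: texp_def map_key_plus[OF inj_Some'] algebra_simps)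

lemma map_key_Some_None [simp]: "Poly_Mapping.map_key Some (Poly_Mapping.single None k) = 0"
  by (rule poly_mapping_eqI) (simp add: map_key.rep_eq[OF inj_Some'] lookup_single)

lemma texp_single:
  "texp (Poly_Mapping.single (Some j) k, 0, 0) = Poly_Mapping.single j k"
  "texp (0, Poly_Mapping.single (Some j) k, 0) = Poly_Mapping.single j k"
  "texp (0, 0, Poly_Mapping.single (Some j) k) = Poly_Mapping.single j k"
  "texp (Poly_Mapping.single None k, 0, 0) = 0"
  "texp (0, Poly_Mapping.single None k, 0) = 0"
  "texp (0, 0, Poly_Mapping.single None k) = 0"
  by (simp_all add: texp_def map_key_single[OF inj_Some'] map_key_zero[OF inj_Some'])

lemma texp_zero [simp]: "texp 0 = 0" "texp (0, 0, 0) = 0"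
  by (simp_all add: texp_def map_key_zero[OF inj_Some'])

lemma lookup_texp: "Poly_Mapping.lookup (texp (m1, m2, m3)) j
   = Poly_Mapping.lookup m1 (Some j) + Poly_Mapping.lookup m2 (Some j) + Poly_Mapping.lookup m3 (Some j)"
  by (simp add: texp_def map_key.rep_eq[OF inj_Some'] lookup_add)

lemma sum_UNIV_option: "(\<Sum>i\<in>UNIV. f i) = f None + (\<Sum>j\<in>UNIV. f (Some j))"
  for f :: "'q::finite option \<Rightarrow> 'b::comm_monoid_add"
  by (simp add: UNIV_option_conv sum.reindex)

lemma prod_UNIV_option: "(\<Prod>i\<in>UNIV. f i) = f None * (\<Prod>j\<in>UNIV. f (Some j))"
  for f :: "'q::finite option \<Rightarrow> 'b::comm_monoid_mult"
  by (simp add: UNIV_option_conv prod.reindex)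

lemma deg_texp_le: "mdeg m = (s, t, u) \<Longrightarrow> deg (texp m) \<le> s + t + u" for m :: "'q::finite cwmono"
  by (cases m) (auto simp: mdeg_def deg_def sum_UNIV_option lookup_texp sum.distrib)

text \<open>
  Labels of the functionals on polynomials in \<open>t\<close> that span the dual of \<open>R\<close>. They also label the
  \<open>q + 2\<close> points that converge to \<open>Spec R\<close>.
\<close>

datatype 'q jet = Value | Slope 'q | Trace

lemma UNIV_jet: "UNIV = insert Value (insert Trace (range Slope))"
proof (rule UNIV_eq_I)
  fix x :: "'a jet" show "x \<in> insert Value (insert Trace (range Slope))" by (cases x) auto
qed

instance jet :: (finite) finite
proof
  show "finite (UNIV :: 'a jet set)"
    by (subst UNIV_jet) simp
qed

lemma sum_UNIV_jet: "(\<Sum>i\<in>UNIV. f i) = f Value + f Trace + (\<Sum>j\<in>UNIV. f (Slope j))"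
  for f :: "'q::finite jet \<Rightarrow> 'b::comm_monoid_add"
proof -
  have "sum f (insert Value (insert Trace (range Slope))) = f Value + (f Trace + sum f (range Slope))"
    by (simp add: image_iff)
  also have "sum f (range Slope) = (\<Sum>j\<in>UNIV. f (Slope j))"
    by (subst sum.reindex) (auto simp: inj_def)
  finally show ?thesis unfolding UNIV_jet[symmetric] by (simp add: add.assoc)
qed

lemma card_jet: "CARD('q::finite jet) = CARD('q) + 2"
  using sum_UNIV_jet[of "\<lambda>_::'q jet. 1::nat"] by simp

text \<open>
  The value of a jet on the monomial \<open>t\<^sup>\<mu>\<close>.
\<close>

fun chi :: "'q jet \<Rightarrow> ('q \<Rightarrow>\<^sub>0 nat) \<Rightarrow> complex" where
  "chi Value \<mu> = of_bool (\<mu> = 0)"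
| "chi (Slope j) \<mu> = of_bool (\<mu> = Poly_Mapping.single j 1)"
| "chi Trace \<mu> = of_bool (\<exists>j. \<mu> = Poly_Mapping.single j 2)"

abbreviation jet :: "'q jet \<Rightarrow> 'q cwpoly \<Rightarrow> complex" where
  "jet i \<equiv> lin (\<lambda>m. chi i (texp m))"

lemma single_two: "Poly_Mapping.single j 2 = Poly_Mapping.single j 1 + (Poly_Mapping.single j 1 :: 'q \<Rightarrow>\<^sub>0 nat)"
  by (metis single_add one_add_one)

lemma add_eq_single_iff:
  fixes \<mu> \<nu> :: "'q \<Rightarrow>\<^sub>0 nat"
  assumes "\<mu> + \<nu> = Poly_Mapping.single j k"
  shows "\<mu> = Poly_Mapping.single j (Poly_Mapping.lookup \<mu> j) \<and> \<nu> = Poly_Mapping.single j (Poly_Mapping.lookup \<nu> j)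
    \<and> Poly_Mapping.lookup \<mu> j + Poly_Mapping.lookup \<nu> j = k"
proof (intro conjI poly_mapping_eqI)
  have l: "Poly_Mapping.lookup \<mu> l + Poly_Mapping.lookup \<nu> l = (if l = j then k else 0)" for l
    using assms by (metis lookup_add lookup_single_eq lookup_single_not_eq)
  show "Poly_Mapping.lookup \<mu> l = Poly_Mapping.lookup (Poly_Mapping.single j (Poly_Mapping.lookup \<mu> j)) l" for l
    using l[of l] by (auto simp: lookup_single when_def split: if_splits)
  show "Poly_Mapping.lookup \<nu> l = Poly_Mapping.lookup (Poly_Mapping.single j (Poly_Mapping.lookup \<nu> j)) l" for l
    using l[of l] by (auto simp: lookup_single when_def split: if_splits)
  show "Poly_Mapping.lookup \<mu> j + Poly_Mapping.lookup \<nu> j = k" using l[of j] by simp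
qed

text \<open>
  The span of the jets is a module over the polynomial ring, being the dual of the quotient \<open>R\<close>:
  composing a jet with multiplication by \<open>t\<^sup>\<mu>\<close> gives a jet or zero. This makes the common kernel of the
  jets an ideal.
\<close>

lemma chi_shift:
  "(\<exists>k. \<forall>\<nu>. chi i (\<mu> + \<nu>) = chi k \<nu>) \<or> (\<forall>\<nu>. chi i (\<mu> + \<nu>) = 0)"
proof (cases "\<mu> = 0")
  case False
  have one: "\<mu> + \<nu> = Poly_Mapping.single j 1 \<longleftrightarrow> \<mu> = Poly_Mapping.single j 1 \<and> \<nu> = 0" for \<nu> j
  proof
    assume a: "\<mu> + \<nu> = Poly_Mapping.single j 1"
    from add_eq_single_iff[OF this] False
    have "Poly_Mapping.lookup \<mu> j = 1" "Poly_Mapping.lookup \<nu> j = 0"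
      by (metis add_is_1 single_zero One_nat_def)+
    with add_eq_single_iff[OF a] show "\<mu> = Poly_Mapping.single j 1 \<and> \<nu> = 0" by (metis single_zero)
  qed simp
  have two: "\<mu> + \<nu> = Poly_Mapping.single j 2 \<longleftrightarrow> \<mu> = Poly_Mapping.single j 1 \<and> \<nu> = Poly_Mapping.single j 1
      \<or> \<mu> = Poly_Mapping.single j 2 \<and> \<nu> = 0" for \<nu> j
  proof
    assume a: "\<mu> + \<nu> = Poly_Mapping.single j 2"
    from add_eq_single_iff[OF this] have b: "\<mu> = Poly_Mapping.single j (Poly_Mapping.lookup \<mu> j)"
      "\<nu> = Poly_Mapping.single j (Poly_Mapping.lookup \<nu> j)"
      "Poly_Mapping.lookup \<mu> j + Poly_Mapping.lookup \<nu> j = 2" by auto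
    have "Poly_Mapping.lookup \<mu> j \<noteq> 0" using False b(1) by (metis single_zero)
    then consider "Poly_Mapping.lookup \<mu> j = 1" "Poly_Mapping.lookup \<nu> j = 1"
      | "Poly_Mapping.lookup \<mu> j = 2" "Poly_Mapping.lookup \<nu> j = 0"
      using b(3) by linarith
    then show "\<mu> = Poly_Mapping.single j 1 \<and> \<nu> = Poly_Mapping.single j 1
      \<or> \<mu> = Poly_Mapping.single j 2 \<and> \<nu> = 0"
      using b(1,2) by cases (metis, metis single_zero)
  qed (auto simp: single_two)
  show ?thesis
  proof (cases i)
    case Value
    have "\<mu> + \<nu> \<noteq> 0" for \<nu>
      using False by (metis add_is_0 lookup_add lookup_zero poly_mapping_eqI)
    then show ?thesis using Value by simp
  next
    case (Slope j)
    then show ?thesis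
      by (cases "\<mu> = Poly_Mapping.single j 1") (auto simp: one[unfolded One_nat_def] intro!: exI[of _ Value])
  next
    case Trace
    have inj: "Poly_Mapping.single a (n::nat) = Poly_Mapping.single b n \<Longrightarrow> n \<noteq> 0 \<Longrightarrow> a = b" for a b :: 'a and n
      by (metis lookup_single_eq lookup_single_not_eq)
    have ne: "Poly_Mapping.single a (2::nat) \<noteq> Poly_Mapping.single b 1" for a b :: 'a
    proof
      assume "Poly_Mapping.single a (2::nat) = Poly_Mapping.single b 1"
      then have "Poly_Mapping.lookup (Poly_Mapping.single b (1::nat)) a = 2" by (metis lookup_single_eq)
      then show False by (simp add: lookup_single when_def split: if_splits)
    qed
    consider j where "\<mu> = Poly_Mapping.single j 1" | j where "\<mu> = Poly_Mapping.single j 2"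
      | "\<forall>j. \<mu> \<noteq> Poly_Mapping.single j 1 \<and> \<mu> \<noteq> Poly_Mapping.single j 2" by blast
    then show ?thesis
    proof cases
      case (1 j)
      have "chi i (\<mu> + \<nu>) = chi (Slope j) \<nu>" for \<nu>
        unfolding Trace chi.simps two unfolding 1 using ne[of _ j, symmetric] by (auto dest: inj simp del: One_nat_def)
      then show ?thesis by blast
    next
      case (2 j)
      have "chi i (\<mu> + \<nu>) = chi Value \<nu>" for \<nu>
        unfolding Trace chi.simps two unfolding 2 using ne[of j] by (auto simp del: One_nat_def)
      then show ?thesis by blast
    next
      case 3
      then show ?thesis unfolding Trace chi.simps two by simp
    qed
  qed
qed auto

text \<open>
  The jets are imposed on each homogeneous component separately, because components of different
  degrees can have equal restrictions to the chart. In total degree at most one the restriction is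
  injective on monomials and the jets see every coefficient, so that there the ideal is zero, as the
  Hilbert function \<open>min (q + 2) (dim V)\<close> requires.
\<close>

definition jet_ideal :: "'q::finite cwpoly set" where
  "jet_ideal = {f. \<forall>s t u i. lin (\<lambda>m. of_bool (mdeg m = (s, t, u)) * chi i (texp m)) f = 0}"

lemma poly_ideal_jet_ideal: "poly_ideal (jet_ideal :: 'q::finite cwpoly set)"
proof
  fix f h :: "'q cwpoly" assume f: "f \<in> jet_ideal"
  have "lin (\<lambda>n. of_bool (mdeg (m + n) = (s, t, u)) * chi i (texp (m + n))) f = 0" for m s t u i
  proof (cases "\<exists>s' t' u'. (s, t, u) = mdeg m + (s', t', u')")
    case True
    then obtain s' t' u' where D: "(s, t, u) = mdeg m + (s', t', u')" by blast
    have D': "mdeg (m + n) = (s, t, u) \<longleftrightarrow> mdeg n = (s', t', u')" for n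
      by (simp add: D mdeg_add)
    from chi_shift[of i "texp m"] show ?thesis
    proof
      assume "\<exists>k. \<forall>\<nu>. chi i (texp m + \<nu>) = chi k \<nu>"
      then obtain k where "\<And>\<nu>. chi i (texp m + \<nu>) = chi k \<nu>" by blast
      then show ?thesis using f by (simp add: D' texp_add jet_ideal_def)
    qed (simp add: texp_add)
  next
    case False
    then have "mdeg (m + n) \<noteq> (s, t, u)" for n
      by (metis mdeg_add surj_pair)
    then show ?thesis by simp
  qed
  then have "lin (\<lambda>n. of_bool (mdeg n = (s, t, u)) * chi i (texp n))
      ((\<Sum>m\<in>Poly_Mapping.keys h. Poly_Mapping.single m (Poly_Mapping.lookup h m)) * f) = 0" for s t u i
    by (simp add: sum_distrib_right lin_sum lin_single_mult)
  then show "h * f \<in> jet_ideal"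
    unfolding poly_mapping_eq_sum_single[of h, symmetric] by (simp add: jet_ideal_def)
qed (auto simp: jet_ideal_def lin_add)

lemma jet_ideal_homog_iff:
  assumes "f \<in> homog s t u"
  shows "f \<in> jet_ideal \<longleftrightarrow> (\<forall>i. jet i f = 0)"
proof -
  have "lin (\<lambda>m. of_bool (mdeg m = (s', t', u')) * chi i (texp m)) f =
      (if (s', t', u') = (s, t, u) then jet i f else 0)" for s' t' u' i
    using assms by (auto simp: homogD intro!: lin_cong trans[OF lin_cong lin_zero_fun])
  then show ?thesis by (auto simp: jet_ideal_def)
qed

lemma multigraded_ideal_eqI:
  assumes "multigraded_ideal I" "multigraded_ideal J"
    and "\<And>s t u. I \<inter> homog s t u = J \<inter> homog s t u"
  shows "I = J"
  using assms by (simp add: multigraded_ideal_def)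

lemma multigraded_jet_ideal: "multigraded_ideal (jet_ideal :: 'q::finite cwpoly set)"
proof -
  interpret J: poly_ideal "jet_ideal :: 'q cwpoly set" by (rule poly_ideal_jet_ideal)
  let ?U = "\<Union>s t u. (jet_ideal :: 'q cwpoly set) \<inter> homog s t u"
  have "f \<in> poly.span ?U" if f: "f \<in> jet_ideal" for f :: "'q cwpoly"
  proof -
    define g where "g D = (\<Sum>m\<in>{m \<in> Poly_Mapping.keys f. mdeg m = D}. Poly_Mapping.single m (Poly_Mapping.lookup f m))" for D
    have hom: "g (s, t, u) \<in> homog s t u" for s t u
      unfolding g_def by (intro poly.subspace_sum[OF subspace_homog] homog_single) auto
    have "g (s, t, u) \<in> jet_ideal" for s t u
    proof -
      have "jet i (g (s, t, u)) = lin (\<lambda>m. of_bool (mdeg m = (s, t, u)) * chi i (texp m)) f" for i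
        unfolding g_def lin_sum by (auto simp: lin_def intro!: sum.mono_neutral_cong_left)
      with f show ?thesis using jet_ideal_homog_iff[OF hom]
        by (simp add: jet_ideal_def)
    qed
    then have "g (s, t, u) \<in> ?U" for s t u
      unfolding UN_iff using hom by (intro bexI[of _ s] bexI[of _ t] bexI[of _ u] UNIV_I) simp
    then have gU: "g D \<in> ?U" for D by (cases D) simp
    have "(\<Sum>D\<in>mdeg ` Poly_Mapping.keys f. g D)
        = (\<Sum>m\<in>Poly_Mapping.keys f. Poly_Mapping.single m (Poly_Mapping.lookup f m))"
      unfolding g_def by (rule sum.group) auto
    then have "f = (\<Sum>D\<in>mdeg ` Poly_Mapping.keys f. g D)"
      by (rule trans[OF poly_mapping_eq_sum_single sym])
    moreover have "sum g (mdeg ` Poly_Mapping.keys f) \<in> poly.span ?U"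
      by (intro poly.span_sum poly.span_base gU)
    ultimately show ?thesis by (rule ssubst)
  qed
  moreover have "poly.span ?U \<subseteq> jet_ideal"
    by (rule poly.span_minimal[OF _ J.subspace]) blast
  ultimately show ?thesis
    unfolding multigraded_ideal_def poly_ideal_iff using poly_ideal_jet_ideal by blast
qed

section \<open>Functionals dual to jets\<close>

text \<open>
  The exponents of the monomials \<open>1\<close>, \<open>t\<^sub>j\<close>, \<open>t\<^sub>j\<^sub>0\<^sup>2\<close>, which form a basis of \<open>R\<close> dual to the jets. The choice
  of \<open>j0\<close> is arbitrary, as all \<open>t\<^sub>j\<^sup>2\<close> agree in \<open>R\<close>.
\<close>

fun jexp :: "'q \<Rightarrow> 'q jet \<Rightarrow> 'q \<Rightarrow>\<^sub>0 nat" where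
  "jexp j0 Value = 0"
| "jexp j0 (Slope j) = Poly_Mapping.single j 1"
| "jexp j0 Trace = Poly_Mapping.single j0 2"

lemma chi_jexp: "chi i (jexp j0 k) = of_bool (i = k)"
proof -
  have inj: "Poly_Mapping.single a (n::nat) = Poly_Mapping.single b m \<Longrightarrow> n \<noteq> 0 \<Longrightarrow> a = b \<and> n = m" for a b :: 'a and n m
    by (metis lookup_single_eq lookup_single_not_eq)
  have ne: "Poly_Mapping.single a (n::nat) = 0 \<Longrightarrow> n = 0" for a :: 'a and n
    by (metis lookup_single_eq lookup_zero)
  show ?thesis
    by (cases i; cases k) (auto dest: inj ne dest!: sym[of 0])
qed

text \<open>
  A monomial in \<open>t\<close> of degree at most \<open>s + t + u\<close> is homogenised by distributing its factors over
  the three groups of variables and filling up with variables of index \<open>None\<close>.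
\<close>

lemma exists_monomial:
  fixes \<mu> :: "'q::finite \<Rightarrow>\<^sub>0 nat"
  assumes "deg \<mu> \<le> s + t + u"
  shows "\<exists>m. mdeg m = (s, t, u) \<and> texp m = \<mu>"
proof -
  define P where "P s t u \<longleftrightarrow> (\<forall>\<mu> :: 'q \<Rightarrow>\<^sub>0 nat. deg \<mu> \<le> s + t + u \<longrightarrow> (\<exists>m. mdeg m = (s, t, u) \<and> texp m = \<mu>))" for s t u
  have step: "P s' t' u'" if P: "P s t u" and D: "(s', t', u') = mdeg (v None) + (s, t, u)"
      "s' + t' + u' = Suc (s + t + u)" "\<And>i. mdeg (v i) = mdeg (v None)"
      "texp (v None) = 0" "\<And>j. texp (v (Some j)) = Poly_Mapping.single j 1"
    for s t u s' t' u' and v :: "'q option \<Rightarrow> 'q cwmono"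
    unfolding P_def
  proof (intro allI impI)
    fix \<mu> :: "'q \<Rightarrow>\<^sub>0 nat" assume le: "deg \<mu> \<le> s' + t' + u'"
    show "\<exists>m. mdeg m = (s', t', u') \<and> texp m = \<mu>"
    proof (cases "deg \<mu> \<le> s + t + u")
      case True
      with P obtain m where "mdeg m = (s, t, u)" "texp m = \<mu>" unfolding P_def by blast
      then have "mdeg (v None + m) = (s', t', u')" "texp (v None + m) = \<mu>"
        by (simp_all only: mdeg_add texp_add D(1,4) add_0)
      then show ?thesis by blast
    next
      case False
      with le D(2) have "deg \<mu> = Suc (s + t + u)" by simp
      then obtain j \<nu> where \<nu>: "\<mu> = Poly_Mapping.single j 1 + \<nu>" "deg \<nu> = s + t + u" by (rule deg_eq_SucE)
      from P[unfolded P_def, rule_format, of \<nu>] \<nu>(2)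
      obtain m where m: "mdeg m = (s, t, u)" "texp m = \<nu>" by auto
      have "mdeg (v (Some j) + m) = (s', t', u')" by (simp only: mdeg_add m D(1) D(3)[of "Some j"])
      moreover have "texp (v (Some j) + m) = \<mu>" by (simp only: texp_add m D(5) \<nu>(1))
      ultimately show ?thesis by blast
    qed
  qed
  have "P s t u"
  proof (induction s)
    case 0
    show ?case
    proof (induction t)
      case 0
      show ?case
      proof (induction u)
        case 0
        show ?case by (auto simp: P_def mdeg_def intro!: exI[of _ 0] texp_zero)
      next
        case (Suc u)
        then show ?case
          by (rule step[where v = "\<lambda>i. (0, 0, Poly_Mapping.single i 1)"]) (auto simp: mdeg_Pair texp_single)
      qed
    next
      case (Suc t)
      then show ?case
        by (rule step[where v = "\<lambda>i. (0, Poly_Mapping.single i 1, 0)"]) (auto simp: mdeg_Pair texp_single)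
    qed
  next
    case (Suc s)
    then show ?case
      by (rule step[where v = "\<lambda>i. (Poly_Mapping.single i 1, 0, 0)"]) (auto simp: mdeg_Pair texp_single)
  qed
  with assms show ?thesis unfolding P_def by blast
qed

text \<open>
  The property of the jets that controls dimensions. It is shared by the divided differences at the
  approximating points, and with it both families can be treated alike.
\<close>

definition dual_to_jets :: "'q \<Rightarrow> ('q jet \<Rightarrow> 'q cwmono \<Rightarrow> complex) \<Rightarrow> bool" where
  "dual_to_jets j0 c \<longleftrightarrow> (\<forall>i k m. texp m = jexp j0 k \<longrightarrow> c i m = of_bool (i = k))"

lemma dual_to_jetsD: "dual_to_jets j0 c \<Longrightarrow> texp m = jexp j0 k \<Longrightarrow> c i m = of_bool (i = k)"
  unfolding dual_to_jets_def by blast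

lemma dual_to_jets_chi: "dual_to_jets j0 (\<lambda>i m. chi i (texp m))"
  by (simp add: dual_to_jets_def chi_jexp)

text \<open>
  The jets whose dual monomial has degree at most \<open>d\<close>, hence occurs in total degree \<open>d\<close>.
\<close>

definition jets_upto :: "nat \<Rightarrow> 'q jet set" where
  "jets_upto d = {i. case i of Value \<Rightarrow> True | Slope j \<Rightarrow> 1 \<le> d | Trace \<Rightarrow> 2 \<le> d}"

lemma jets_upto_iff: "i \<in> jets_upto d \<longleftrightarrow> deg (jexp j0 i) \<le> d"
  by (cases i) (auto simp: jets_upto_def)

lemma dim_homog_dual_to_jets:
  fixes c :: "'q::finite jet \<Rightarrow> 'q cwmono \<Rightarrow> complex"
  assumes c: "dual_to_jets j0 c"
  shows "poly.dim (homog s t u :: 'q cwpoly set)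
    = poly.dim {f \<in> homog s t u. \<forall>i\<in>jets_upto (s + t + u). lin (c i) f = 0} + card (jets_upto (s + t + u) :: 'q jet set)"
proof -
  obtain S :: "'q cwpoly set" where S: "finite S" "homog s t u \<subseteq> poly.span S" by (rule homog_finitely_spanned)
  have "\<forall>i\<in>jets_upto (s + t + u). \<exists>m. mdeg m = (s, t, u) \<and> texp m = jexp j0 i"
    using exists_monomial jets_upto_iff by blast
  then obtain v where v: "\<And>i. i \<in> jets_upto (s + t + u) \<Longrightarrow> mdeg (v i) = (s, t, u) \<and> texp (v i) = jexp j0 i"
    by metis
  show ?thesis
    by (rule poly.dim_common_kernel[OF S subspace_homog, where d = "\<lambda>i. Poly_Mapping.single (v i) 1"])
      (use v dual_to_jetsD[OF c] in \<open>auto simp: lin_add lin_pscale intro!: homog_single\<close>)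
qed

lemma mono_eq_if_texp_eq:
  fixes m n :: "'q::finite cwmono"
  assumes "mdeg m = (s, t, u)" "mdeg n = (s, t, u)" "s + t + u \<le> 1" "texp m = texp n"
  shows "m = n"
proof -
  have eq: "p = q" if "deg p = Suc 0" "deg q = Suc 0"
    "Poly_Mapping.map_key Some p = Poly_Mapping.map_key Some q" for p q :: "'q option \<Rightarrow>\<^sub>0 nat"
  proof -
    obtain i j where ij: "p = Poly_Mapping.single i 1" "q = Poly_Mapping.single j 1"
      using deg_eq_1E \<open>deg p = Suc 0\<close> \<open>deg q = Suc 0\<close> by metis
    have ne: "Poly_Mapping.single a (1::nat) \<noteq> 0" for a :: 'q by (metis deg_single deg_zero zero_neq_one)
    have inj: "Poly_Mapping.single a (1::nat) = Poly_Mapping.single b 1 \<Longrightarrow> a = b" for a b :: 'q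
      by (metis lookup_single_eq lookup_single_not_eq one_neq_zero)
    from \<open>Poly_Mapping.map_key Some p = Poly_Mapping.map_key Some q\<close> ij ne inj show ?thesis
      by (cases i; cases j) (auto simp: map_key_single[OF inj_Some'] simp del: One_nat_def dest: sym)
  qed
  obtain m1 m2 m3 n1 n2 n3 where mn: "m = (m1, m2, m3)" "n = (n1, n2, n3)" by (cases m; cases n)
  consider "s = 0" "t = 0" "u = 0" | "s = 1" "t = 0" "u = 0" | "s = 0" "t = 1" "u = 0" | "s = 0" "t = 0" "u = 1"
    using assms(3) by linarith
  then show ?thesis
    using assms(1,2,4) unfolding mn by cases (auto simp: mdeg_Pair texp_def intro: eq)
qed

text \<open>
  In total degree at most one every monomial is dual to a jet, and a functional of the family reads
  off its coefficient.
\<close>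

lemma dual_kernel_low_degree:
  fixes c :: "'q::finite jet \<Rightarrow> 'q cwmono \<Rightarrow> complex"
  assumes c: "dual_to_jets j0 c" and d: "s + t + u \<le> 1"
  shows "{f \<in> homog s t u. \<forall>i\<in>jets_upto (s + t + u). lin (c i) f = 0} = {0}"
proof -
  have "f = 0" if f: "f \<in> homog s t u" "\<forall>i\<in>jets_upto (s + t + u). lin (c i) f = 0" for f
  proof (rule poly_mapping_eqI)
    fix m
    show "Poly_Mapping.lookup f m = Poly_Mapping.lookup 0 m"
    proof (cases "m \<in> Poly_Mapping.keys f")
      case True
      then have m: "mdeg m = (s, t, u)" using f homogD by blast
      have jexp: "\<exists>i\<in>jets_upto (s + t + u). texp n = jexp j0 i" if n: "mdeg n = (s, t, u)" for n
      proof (cases "deg (texp n)")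
        case 0
        then show ?thesis by (intro bexI[of _ Value]) (auto simp: jets_upto_def)
      next
        case (Suc k)
        then have "deg (texp n) = Suc 0" "s + t + u = 1" using deg_texp_le[OF n] d by auto
        then obtain j where "texp n = Poly_Mapping.single j 1" using deg_eq_1E by blast
        then show ?thesis using \<open>s + t + u = 1\<close>
          by (intro bexI[of _ "Slope j"]) (auto simp: jets_upto_def)
      qed
      obtain i where i: "i \<in> jets_upto (s + t + u)" "texp m = jexp j0 i" using jexp[OF m] by blast
      have "Poly_Mapping.lookup f m = lin (\<lambda>n. of_bool (n = m)) f" by (rule lookup_eq_lin)
      also have "\<dots> = lin (c i) f"
      proof (rule lin_cong)
        fix n assume "n \<in> Poly_Mapping.keys f"
        then have n: "mdeg n = (s, t, u)" using f homogD by blast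
        obtain k where k: "texp n = jexp j0 k" using jexp[OF n] by blast
        have "n = m \<longleftrightarrow> k = i"
          using mono_eq_if_texp_eq[OF n m d] k i chi_jexp[of i j0 k] chi_jexp[of i j0 i]
          by (metis of_bool_eq_iff)
        then show "of_bool (n = m) = c i n" using dual_to_jetsD[OF c k, of i] by auto
      qed
      finally show ?thesis using f i by simp
    qed (simp add: in_keys_iff)
  qed
  then show ?thesis by auto
qed

text \<open>
  In total degree at least two the functionals are independent. Below that, the functionals of the jets
  in \<open>jets_upto\<close> form a basis of the whole dual space, which has dimension at most \<open>q + 2\<close>.
\<close>

lemma dim_dual_kernel:
  fixes c :: "'q::finite jet \<Rightarrow> 'q cwmono \<Rightarrow> complex"
  assumes c: "dual_to_jets j0 c"
    and V_def: "V = homog s t u"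
  shows "poly.dim V = poly.dim {f \<in> V. \<forall>i. lin (c i) f = 0} + min CARD('q jet) (poly.dim V)"
proof (cases "s + t + u \<le> 1")
  case True
  let ?K = "{f \<in> V. \<forall>i\<in>jets_upto (s + t + u). lin (c i) f = 0}"
  have K: "?K = {0}" unfolding V_def by (rule dual_kernel_low_degree[OF c True])
  then have "{f \<in> V. \<forall>i. lin (c i) f = 0} = {0}" by (auto simp: V_def)
  moreover have "poly.dim {0 :: 'q cwpoly} = 0"
    using poly.dim_le_card[of "{0}" "{}"] by simp
  moreover have "poly.dim V \<le> CARD('q jet)"
    using dim_homog_dual_to_jets[OF c, of s t u] K \<open>poly.dim {0 :: 'q cwpoly} = 0\<close>
      card_mono[of UNIV "jets_upto (s + t + u) :: 'q jet set"] unfolding V_def by simp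
  ultimately show ?thesis by simp
next
  case False
  then have "jets_upto (s + t + u) = (UNIV :: 'q jet set)"
    by (auto simp: jets_upto_def split: jet.splits)
  with dim_homog_dual_to_jets[OF c, of s t u] show ?thesis by (simp add: V_def)
qed


section \<open>Jets of monomials\<close>

text \<open>
  The restriction of a variable to the chart: \<open>1\<close> for the index \<open>None\<close> and \<open>t\<^sub>j\<close> for \<open>Some j\<close>.
\<close>

primrec vexp :: "'q option \<Rightarrow> 'q \<Rightarrow>\<^sub>0 nat" where
  "vexp None = 0"
| "vexp (Some j) = Poly_Mapping.single j 1"

definition xm :: "'q option \<Rightarrow> 'q cwmono" where "xm i = (Poly_Mapping.single i 1, 0, 0)"
definition ym :: "'q option \<Rightarrow> 'q cwmono" where "ym i = (0, Poly_Mapping.single i 1, 0)"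
definition zm :: "'q option \<Rightarrow> 'q cwmono" where "zm i = (0, 0, Poly_Mapping.single i 1)"

lemma X_eq_single: "X i = Poly_Mapping.single (xm i) 1"
  and Y_eq_single: "Y i = Poly_Mapping.single (ym i) 1"
  and Z_eq_single: "Z i = Poly_Mapping.single (zm i) 1"
  by (simp_all add: X_def Y_def Z_def xm_def ym_def zm_def)

lemma texp_var [simp]: "texp (xm i) = vexp i" "texp (ym i) = vexp i" "texp (zm i) = vexp i"
  by (cases i; simp add: xm_def ym_def zm_def texp_single del: One_nat_def)+

lemma mdeg_var [simp]: "mdeg (xm i) = (1, 0, 0)" "mdeg (ym i) = (0, 1, 0)" "mdeg (zm i) = (0, 0, 1)"
  by (simp_all add: xm_def ym_def zm_def mdeg_def)

lemma jet_var_mult: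
  "jet i (X a * f) = lin (\<lambda>m. chi i (vexp a + texp m)) f"
  "jet i (Y a * f) = lin (\<lambda>m. chi i (vexp a + texp m)) f"
  "jet i (Z a * f) = lin (\<lambda>m. chi i (vexp a + texp m)) f"
  by (simp_all add: X_eq_single Y_eq_single Z_eq_single lin_single_mult texp_add)

lemma jet_None_mult [simp]:
  "jet i (X None * f) = jet i f" "jet i (Y None * f) = jet i f" "jet i (Z None * f) = jet i f"
  by (simp_all add: jet_var_mult)

lemma jet_None_power_mult [simp]:
  "jet i (X None ^ n * f) = jet i f" "jet i (Y None ^ n * f) = jet i f" "jet i (Z None ^ n * f) = jet i f"
  by (induction n; simp add: mult.assoc)+

lemma jet_var_var [simp]:
  "jet i (X a * Y b) = chi i (vexp a + vexp b)"
  "jet i (X a * Z b) = chi i (vexp a + vexp b)"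
  "jet i (Y a * Z b) = chi i (vexp a + vexp b)"
  by (simp_all only: jet_var_mult) (simp_all add: Y_eq_single Z_eq_single)

lemma deg_chi_Trace: "chi Trace \<mu> \<noteq> 0 \<Longrightarrow> deg \<mu> = 2" for \<mu> :: "'q::finite \<Rightarrow>\<^sub>0 nat"
  by (auto split: if_splits)

lemma chi_Trace_single_add: "chi Trace (Poly_Mapping.single j 1 + \<nu>) = chi (Slope j) \<nu>"
proof -
  have "Poly_Mapping.single j 1 + \<nu> = Poly_Mapping.single l 2 \<longleftrightarrow> l = j \<and> \<nu> = Poly_Mapping.single j 1" for l
  proof
    assume a: "Poly_Mapping.single j 1 + \<nu> = Poly_Mapping.single l 2"
    have b: "Poly_Mapping.single j 1 = Poly_Mapping.single l (Poly_Mapping.lookup (Poly_Mapping.single j (1::nat)) l)"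
      using add_eq_single_iff[OF a] by blast
    have "l = j"
    proof (rule ccontr)
      assume "l \<noteq> j"
      then have "Poly_Mapping.lookup (Poly_Mapping.single j (1::nat)) l = 0" by (simp add: lookup_single)
      then have "Poly_Mapping.single j (1::nat) = 0" using b by simp
      then have "Poly_Mapping.lookup (Poly_Mapping.single j (1::nat)) j = 0" by simp
      then show False by simp
    qed
    with a show "l = j \<and> \<nu> = Poly_Mapping.single j 1" by (simp add: single_two del: One_nat_def)
  qed (simp add: single_two del: One_nat_def)
  then show ?thesis by simp
qed

lemma chi_pair:
  fixes i :: "'a jet"
  assumes "i \<noteq> Value"
  shows "chi i (vexp None + vexp None) = 0"
    and "k \<noteq> l \<Longrightarrow> chi i (vexp (Some k) + vexp (Some l)) = 0"
    and "chi i (vexp (Some k) + vexp (Some k)) = of_bool (i = Trace)"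
proof -
  have ne: "Poly_Mapping.single a (n::nat) = Poly_Mapping.single b m \<Longrightarrow> n \<noteq> 0 \<Longrightarrow> a = b \<and> n = m" for a b :: 'a and n m
    by (metis lookup_single_eq lookup_single_not_eq)
  have z: "Poly_Mapping.single a (n::nat) = 0 \<Longrightarrow> n = 0" for a :: 'a and n
    by (metis lookup_single_eq lookup_zero)
  show "chi i (vexp None + vexp None) = 0"
    using assms by (cases i) (auto dest!: sym[of 0] z)
  have s: "chi (Slope j) (vexp (Some k) + vexp (Some l)) = 0" for j k l :: 'a
  proof -
    have "Poly_Mapping.single k 1 + Poly_Mapping.single l 1 \<noteq> Poly_Mapping.single j (1::nat)"
    proof
      assume a: "Poly_Mapping.single k 1 + Poly_Mapping.single l 1 = Poly_Mapping.single j (1::nat)"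
      let ?L = "\<lambda>k. Poly_Mapping.lookup (Poly_Mapping.single k (1::nat)) j"
      from add_eq_single_iff[OF a] have "?L k = 0 \<or> ?L l = 0"
        "Poly_Mapping.single k 1 = Poly_Mapping.single j (?L k)"
        "Poly_Mapping.single l 1 = Poly_Mapping.single j (?L l)" by auto
      then show False using z[of k 1] z[of l 1] by (metis single_zero zero_neq_one)
    qed
    then show ?thesis by simp
  qed
  show "chi i (vexp (Some k) + vexp (Some l)) = 0" if "k \<noteq> l"
  proof (cases i)
    case Trace
    have "Poly_Mapping.single l 1 \<noteq> Poly_Mapping.single k (1::nat)" using ne[of l 1 k 1] that by auto
    then show ?thesis unfolding Trace vexp.simps chi_Trace_single_add by simp
  qed (use s assms in auto)
  show "chi i (vexp (Some k) + vexp (Some k)) = of_bool (i = Trace)"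
  proof (cases i)
    case Trace
    then show ?thesis unfolding Trace vexp.simps chi_Trace_single_add by simp
  qed (use s assms in auto)
qed

section \<open>Quadratic relations from the dimension count\<close>

text \<open>
  The relations of \<open>R\<close> in bilinear form, for two of the three groups of variables.
\<close>

definition contains_relations ::
  "'q cwpoly set \<Rightarrow> ('q option \<Rightarrow> 'q cwpoly) \<Rightarrow> ('q option \<Rightarrow> 'q cwpoly) \<Rightarrow> bool" where
  "contains_relations I x y \<longleftrightarrow>
    (\<forall>k. x (Some k) * y None - x None * y (Some k) \<in> I) \<and>
    (\<forall>k l. k \<noteq> l \<longrightarrow> x (Some k) * y (Some l) \<in> I) \<and>
    (\<forall>k l. x (Some k) * y (Some k) - x (Some l) * y (Some l) \<in> I)"

lemma contains_relations_Int:
  "contains_relations I x y \<Longrightarrow> contains_relations J x y \<Longrightarrow> contains_relations (I \<inter> J) x y"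
  by (auto simp: contains_relations_def)

lemma contains_relations_jet_ideal:
  assumes prod: "\<And>i a b. jet i (x a * y b) = chi i (vexp a + vexp b)"
    and hom: "\<And>a b. x a * y b \<in> homog s t u"
  shows "contains_relations jet_ideal x y"
proof -
  have val: "chi Value (vexp (Some k) + vexp (Some l)) = 0" for k l :: 'a
    by (auto simp: poly_mapping_eq_iff fun_eq_iff lookup_add lookup_single when_def)
  have hdiff: "x a * y b - x a' * y b' \<in> homog s t u" for a b a' b'
    by (rule poly.subspace_diff[OF subspace_homog hom hom])
  have c: "i = Value \<or> i \<noteq> Value" for i :: "'a jet" by simp
  show ?thesis
    unfolding contains_relations_def
  proof (intro conjI allI impI)
    fix k show "x (Some k) * y None - x None * y (Some k) \<in> jet_ideal"
      unfolding jet_ideal_homog_iff[OF hdiff] by (simp add: lin_diff prod add.commute)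
  next
    fix k l :: 'a assume "k \<noteq> l"
    then show "x (Some k) * y (Some l) \<in> jet_ideal"
      unfolding jet_ideal_homog_iff[OF hom] prod using c chi_pair(2) val by metis
  next
    fix k l show "x (Some k) * y (Some k) - x (Some l) * y (Some l) \<in> jet_ideal"
      unfolding jet_ideal_homog_iff[OF hdiff] lin_diff prod using c chi_pair(3) val by (metis diff_self)
  qed
qed

lemma pscale_mult_right: "f * pscale a g = pscale a (f * g)"
  by (simp add: pscale_def algebra_simps)

text \<open>
  The heart of the uniqueness proof. Modulo \<open>I\<close>, all products \<open>x\<^sub>a y\<^sub>b\<close> are combinations of the
  \<open>x\<^sub>0 y\<^sub>l\<close>, of \<open>d\<close> and of \<open>g\<close>, with the coefficients of \<open>g\<close> unknown; this is the content of the
  hypotheses on \<open>g\<close>. Multiplied by a further \<open>x\<^sub>i\<close>, everything reduces to the \<open>q + 2\<close> forms \<open>h\<close>, namely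
  \<open>x\<^sub>0 d\<close> and the \<open>x\<^sub>i g\<close>, and the last hypothesis says that these are independent modulo \<open>I\<close> as soon as
  they span. Since \<open>x\<^sub>i (x\<^sub>k y\<^sub>l) = x\<^sub>k (x\<^sub>i y\<^sub>l)\<close> can be reduced in two ways, the unknown coefficients
  satisfy linear equations, which force all of them to vanish except that of \<open>x\<^sub>0 y\<^sub>0\<close>.
\<close>

lemma relations_if_quotients_small:
  fixes x y :: "'q::finite option \<Rightarrow> 'q cwpoly" and j0 :: 'q
  assumes I: "poly_ideal I" and q: "CARD('q) > 2"
    and g00: "\<exists>c. x None * y None - pscale c g \<in> I"
    and gk0: "\<And>k. \<exists>c. x (Some k) * y None - x None * y (Some k) - pscale c g \<in> I"
    and gkl: "\<And>k l. k \<noteq> l \<Longrightarrow> \<exists>c. x (Some k) * y (Some l) - pscale c g \<in> I"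
    and gkk: "\<And>k. \<exists>c. x (Some k) * y (Some k) - x (Some j0) * y (Some j0) - pscale c g \<in> I"
  defines "d \<equiv> x (Some j0) * y (Some j0)"
  defines "h \<equiv> case_option (x None * d) (\<lambda>i. x i * g)"
  defines "reducible \<equiv> \<lambda>f. \<exists>c. f - (\<Sum>s\<in>UNIV. pscale (c s) (h s)) \<in> I"
  assumes ind: "\<And>c s. \<lbrakk>\<And>i l. reducible (x i * (x None * y (Some l))); \<And>i. reducible (x i * d); \<And>i. reducible (x i * g);
      (\<Sum>s\<in>UNIV. pscale (c s) (h s)) \<in> I\<rbrakk> \<Longrightarrow> c s = 0"
  shows "contains_relations I x y"
proof -
  interpret poly_ideal I by (rule I)
  obtain a00 where a00: "x None * y None - pscale a00 g \<in> I" using g00 by blast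
  obtain a where a: "\<And>k. x (Some k) * y None - x None * y (Some k) - pscale (a k) g \<in> I" using gk0 by metis
  have "\<exists>c. x (Some k) * y (Some l) - of_bool (k = l) * d - pscale c g \<in> I \<and> (k = j0 \<and> l = j0 \<longrightarrow> c = 0)" for k l
  proof (cases "k = j0 \<and> l = j0")
    case True
    then show ?thesis by (intro exI[of _ 0]) (simp add: d_def)
  next
    case False
    then show ?thesis using gkl gkk by (cases "k = l") (auto simp: d_def)
  qed
  then obtain b where b: "\<And>k l. x (Some k) * y (Some l) - of_bool (k = l) * d - pscale (b k l) g \<in> I"
    and b0: "b j0 j0 = 0" by metis
  let ?K = "\<lambda>c. Poly_Mapping.single 0 c :: 'q cwpoly"
  have third: "\<exists>k. k \<noteq> i \<and> k \<noteq> l" for i l :: 'q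
  proof (rule ccontr)
    assume "\<not> ?thesis"
    then have "UNIV \<subseteq> {i, l}" by auto
    then have "CARD('q) \<le> card {i, l}" by (intro card_mono) auto
    also have "\<dots> \<le> 2" by (simp add: card_insert_if)
    finally show False using q by simp
  qed
  have K_diff: "?K (c - c') = ?K c - ?K c'" for c c' by (simp add: single_diff)

  \<comment> \<open>Reductions of the cubic products to the forms \<open>h\<close>.\<close>
  have r1: "x (Some i) * d - (?K (b i k) * (x (Some k) * g) - ?K (b k k) * (x (Some i) * g)) \<in> I" if "k \<noteq> i" for i k
  proof -
    have "x (Some k) * (x (Some i) * y (Some k) - of_bool (i = k) * d - pscale (b i k) g)
      - x (Some i) * (x (Some k) * y (Some k) - of_bool (k = k) * d - pscale (b k k) g) \<in> I"
      by (intro diff mult b)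
    moreover have "x (Some k) * (x (Some i) * y (Some k) - of_bool (i = k) * d - pscale (b i k) g)
      - x (Some i) * (x (Some k) * y (Some k) - of_bool (k = k) * d - pscale (b k k) g)
      = x (Some i) * d - (?K (b i k) * (x (Some k) * g) - ?K (b k k) * (x (Some i) * g))"
      using that by (simp add: pscale_def algebra_simps)
    ultimately show ?thesis by simp
  qed
  have r2: "x (Some i) * (x None * y (Some l)) - (of_bool (i = l) * (x None * d) + ?K (b i l) * (x None * g)) \<in> I" for i l
    using mult[OF b[of i l], of "x None"] by (simp add: pscale_def algebra_simps)
  have r3: "x None * (x None * y (Some l)) - (?K a00 * (x (Some l) * g) - ?K (a l) * (x None * g)) \<in> I" for l
    using diff[OF mult[OF a00, of "x (Some l)"] mult[OF a[of l], of "x None"]] by (simp add: pscale_def algebra_simps)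

  have red_cong: "reducible f" if red: "reducible f'" "f - f' \<in> I" for f f'
  proof -
    obtain c where "f' - (\<Sum>s\<in>UNIV. pscale (c s) (h s)) \<in> I" using red(1) unfolding reducible_def by blast
    from add[OF red(2) this] show ?thesis unfolding reducible_def by auto
  qed
  have red_diff: "reducible (f - f')" if red: "reducible f" "reducible f'" for f f'
  proof -
    obtain c c' where "f - (\<Sum>s\<in>UNIV. pscale (c s) (h s)) \<in> I" "f' - (\<Sum>s\<in>UNIV. pscale (c' s) (h s)) \<in> I"
      using red unfolding reducible_def by blast
    from diff[OF this] show ?thesis
      unfolding reducible_def
      by (intro exI[of _ "\<lambda>s. c s - c' s"]) (simp add: poly.scale_left_diff_distrib sum_subtractf algebra_simps)
  qed
  have red_h: "reducible (?K c * h s)" for c s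
  proof -
    have "(\<Sum>s'\<in>UNIV. pscale (if s' = s then c else 0) (h s')) = (\<Sum>s'\<in>UNIV. if s' = s then pscale c (h s) else 0)"
      by (intro sum.cong) auto
    also have "\<dots> = pscale c (h s)" by simp
    finally show ?thesis unfolding reducible_def
      by (intro exI[of _ "\<lambda>s'. if s' = s then c else 0"]) (simp add: pscale_def)
  qed
  have red_g: "reducible (?K c * (x i * g))" for c i using red_h[of c "Some i"] by (simp add: h_def)
  have red_d: "reducible (?K c * (x None * d))" for c using red_h[of c None] by (simp add: h_def)
  have red_d1: "reducible (x i * d)" for i
  proof (cases i)
    case None
    then show ?thesis using red_d[of 1] by simp
  next
    case (Some i')
    then show ?thesis using third[of i' i'] red_cong[OF red_diff[OF red_g red_g] r1] by blast
  qed
  have red_g1: "reducible (x i * g)" for i using red_g[of 1] by simp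
  have red_y: "reducible (x i * (x None * y (Some l)))" for i l
  proof (cases i)
    case None
    then show ?thesis using red_cong[OF red_diff[OF red_g red_g] r3] by blast
  next
    case (Some i')
    have "?K (of_bool (i' = l)) = of_bool (i' = l)" by (cases "i' = l") auto
    then have "reducible (of_bool (i' = l) * (x None * d) - ?K (- b i' l) * (x None * g))"
      using red_diff[OF red_d red_g] by metis
    then show ?thesis using red_cong[OF _ r2[of i' l]] Some by (simp add: single_uminus)
  qed
  have ind': "c s = 0" if "(\<Sum>s\<in>UNIV. pscale (c s) (h s)) \<in> I" for c s
    using ind red_y red_d1 red_g1 that by blast
  have indep: "c = 0 \<and> c' = 0" if "i \<noteq> k" "?K c * (x i * g) - ?K c' * (x k * g) \<in> I" for c c' i k
  proof -
    let ?c = "\<lambda>s. if s = Some i then c else if s = Some k then - c' else 0"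
    have "(\<Sum>s\<in>UNIV. pscale (?c s) (h s))
      = (\<Sum>s\<in>UNIV. (if s = Some i then pscale c (h s) else 0) - (if s = Some k then pscale c' (h s) else 0))"
      using that(1) by (intro sum.cong) auto
    also have "\<dots> = ?K c * (x i * g) - ?K c' * (x k * g)"
      unfolding sum_subtractf by (simp add: pscale_def h_def)
    finally have "(\<Sum>s\<in>UNIV. pscale (?c s) (h s)) \<in> I" using that(2) by simp
    from ind'[OF this] have "?c (Some i) = 0" "?c (Some k) = 0" by blast+
    then show ?thesis using that(1) by auto
  qed
  \<comment> \<open>Compare the two reductions of \<open>x\<^sub>i x\<^sub>k y\<^sub>l\<close> for three distinct indices.\<close>
  have b_offdiag: "b k l = 0" if "k \<noteq> l" for k l
  proof -
    obtain i where i: "i \<noteq> k" "i \<noteq> l" using third by blast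
    have "x (Some k) * (x (Some i) * y (Some l) - of_bool (i = l) * d - pscale (b i l) g)
      - x (Some i) * (x (Some k) * y (Some l) - of_bool (k = l) * d - pscale (b k l) g) \<in> I"
      by (intro diff mult b)
    then have "?K (b k l) * (x (Some i) * g) - ?K (b i l) * (x (Some k) * g) \<in> I"
      using i that by (simp add: pscale_def algebra_simps)
    from indep[OF _ this] i show ?thesis by simp
  qed
  \<comment> \<open>By \<open>r1\<close>, the form \<open>x\<^sub>i d\<close> reduces to \<open>- b k k\<close> times \<open>x\<^sub>i g\<close> for every \<open>k\<close> other than \<open>i\<close>.\<close>
  have b_diag_eq: "b k k = b l l" if i: "i \<noteq> k" "i \<noteq> l" for i k l
  proof -
    from diff[OF r1[of k i] r1[of l i]] i
    have "?K (b k k - b l l) * (x (Some i) * g) - ?K 0 * (x None * g) \<in> I"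
      by (simp add: b_offdiag K_diff algebra_simps)
    from indep[OF _ this] show ?thesis by simp
  qed
  \<comment> \<open>The common diagonal value is zero because it was normalised to zero at \<open>j0\<close>.\<close>
  have b_zero: "b k l = 0" for k l
    using b_offdiag b_diag_eq b0 third by metis
  \<comment> \<open>Compare the two reductions of \<open>x\<^sub>i x\<^sub>k y\<^sub>0\<close>, using \<open>x\<^sub>i y\<^sub>k = 0\<close> modulo \<open>I\<close>.\<close>
  have a_zero: "a k = 0" for k
  proof -
    obtain i where i: "i \<noteq> k" using third by blast
    have "x (Some k) * (x (Some i) * y None - x None * y (Some i) - pscale (a i) g)
      - x (Some i) * (x (Some k) * y None - x None * y (Some k) - pscale (a k) g)
      - x None * (x (Some i) * y (Some k) - of_bool (i = k) * d - pscale (b i k) g)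
      + x None * (x (Some k) * y (Some i) - of_bool (k = i) * d - pscale (b k i) g) \<in> I"
      by (intro diff mult a b add)
    then have "?K (a k) * (x (Some i) * g) - ?K (a i) * (x (Some k) * g) \<in> I"
      using i by (simp add: b_zero pscale_def algebra_simps)
    from indep[OF _ this] i show ?thesis by simp
  qed
  show ?thesis
    unfolding contains_relations_def
  proof (intro conjI allI impI)
    fix k show "x (Some k) * y None - x None * y (Some k) \<in> I" using a[of k] by (simp add: a_zero)
  next
    fix k l :: 'q assume "k \<noteq> l"
    then show "x (Some k) * y (Some l) \<in> I" using b[of k l] by (simp add: b_zero)
  next
    fix k l
    show "x (Some k) * y (Some k) - x (Some l) * y (Some l) \<in> I"
      using diff[OF b[of k k] b[of l l]] by (simp add: b_zero)
  qed
qed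


lemma card_jet_le_dim_homog:
  assumes "2 \<le> s + t + u"
  shows "CARD('q::finite jet) \<le> poly.dim (homog s t u :: 'q cwpoly set)"
proof -
  have "jets_upto (s + t + u) = (UNIV :: 'q jet set)"
    using assms by (auto simp: jets_upto_def split: jet.splits)
  moreover have "poly.dim (homog s t u :: 'q cwpoly set) = poly.dim {f \<in> homog s t u. \<forall>i\<in>(jets_upto (s + t + u) :: 'q jet set). jet i f = 0}
      + card (jets_upto (s + t + u) :: 'q jet set)"
    by (rule dim_homog_dual_to_jets[OF dual_to_jets_chi])
  ultimately show ?thesis by simp
qed

text \<open>
  The Hilbert function of \<open>q + 2\<close> points in general position.
\<close>

definition has_point_dims :: "'q::finite cwpoly set \<Rightarrow> bool" where
  "has_point_dims I \<longleftrightarrow> (\<forall>s t u. poly.dim (homog s t u :: 'q cwpoly set)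
     = poly.dim (I \<inter> homog s t u) + min CARD('q jet) (poly.dim (homog s t u :: 'q cwpoly set)))"

lemma has_point_dims_2:
  fixes I :: "'q::finite cwpoly set"
  shows "has_point_dims I \<Longrightarrow> 2 \<le> s + t + u \<Longrightarrow>
    poly.dim (homog s t u :: 'q cwpoly set) = poly.dim (I \<inter> homog s t u) + CARD('q jet)"
  unfolding has_point_dims_def using card_jet_le_dim_homog[where 'q = 'q, of s t u] by (metis min.absorb1)

lemma jet_ideal_Int_homog: "jet_ideal \<inter> homog s t u = {f \<in> homog s t u. \<forall>i. jet i f = 0}"
  using jet_ideal_homog_iff by blast

lemma has_point_dims_jet_ideal: "has_point_dims (jet_ideal :: 'q::finite cwpoly set)"
  unfolding has_point_dims_def jet_ideal_Int_homog using dim_dual_kernel[OF dual_to_jets_chi] by blast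

text \<open>
  The forms annihilated by all jets but \<open>Value\<close> have codimension \<open>q + 1\<close>, whereas \<open>I\<close> has codimension
  \<open>q + 2\<close>, and \<open>I\<close> lies among them by \<open>van\<close>.
\<close>

lemma exists_generator_mod_ideal:
  fixes I :: "'q::finite cwpoly set"
  assumes I: "poly_ideal I" and dims: "has_point_dims I" and d: "s + t + u = 2"
    and van: "\<And>f i. f \<in> I \<inter> homog s t u \<Longrightarrow> i \<noteq> Value \<Longrightarrow> jet i f = 0"
  obtains g where "g \<in> homog s t u" "\<And>f. f \<in> homog s t u \<Longrightarrow> (\<And>i. i \<noteq> Value \<Longrightarrow> jet i f = 0) \<Longrightarrow> \<exists>c. f - pscale c g \<in> I"
proof -
  interpret poly_ideal I by (rule I)
  obtain S :: "'q cwpoly set" where S: "finite S" "homog s t u \<subseteq> poly.span S" by (rule homog_finitely_spanned)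
  let ?V = "homog s t u :: 'q cwpoly set"
  let ?U = "{f \<in> ?V. \<forall>i\<in>-{Value}. jet i f = 0}"
  have "\<exists>m. mdeg m = (s, t, u) \<and> texp m = jexp j0 i" for i and j0 :: 'q
    using jets_upto_iff[of i 2 j0] d by (intro exists_monomial) (auto simp: jets_upto_def split: jet.splits)
  then obtain v where v: "\<And>i. mdeg (v i) = (s, t, u)" "\<And>i. texp (v i) = jexp (undefined :: 'q) i"
    by metis
  have "poly.dim ?V = poly.dim ?U + card (- {Value :: 'q jet})"
    by (rule poly.dim_common_kernel[OF S subspace_homog, where d = "\<lambda>i. Poly_Mapping.single (v i) 1"])
      (auto simp: lin_add lin_pscale v chi_jexp intro!: homog_single)
  moreover have "poly.dim ?V = poly.dim (I \<inter> ?V) + CARD('q jet)" by (rule has_point_dims_2[OF dims]) (simp add: d)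
  moreover have "card (- {Value :: 'q jet}) = CARD('q jet) - 1"
    by (simp add: Compl_eq_Diff_UNIV card_Diff_singleton)
  moreover have "CARD('q jet) \<ge> 1" by (simp add: card_jet)
  ultimately have le: "poly.dim ?U \<le> Suc (poly.dim (I \<inter> ?V))" by linarith
  have U: "poly.subspace ?U"
    by (auto simp: poly.subspace_def homog_add homog_pscale lin_add lin_pscale)
  have W: "poly.subspace (I \<inter> ?V)" by (rule poly.subspace_inter[OF subspace subspace_homog])
  have US: "?U \<subseteq> poly.span S" using S by blast
  have WU: "I \<inter> ?V \<subseteq> ?U" using van by auto
  show ?thesis
  proof (rule poly.exists_generator_mod[OF S(1) US U W WU le])
    fix g assume g: "g \<in> ?U" and gen: "\<And>f. f \<in> ?U \<Longrightarrow> \<exists>c. f - pscale c g \<in> I \<inter> ?V"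
    show thesis
    proof (rule that)
      show "g \<in> ?V" using g by simp
      show "\<exists>c. f - pscale c g \<in> I" if "f \<in> ?V" "\<And>i. i \<noteq> Value \<Longrightarrow> jet i f = 0" for f
      proof -
        have "f \<in> ?U" using that by simp
        from gen[OF this] show ?thesis by blast
      qed
    qed
  qed
qed

text \<open>
  Formulated for any two groups of variables \<open>x, y\<close>: \<open>(s, t, u)\<close> is the degree of \<open>x\<^sub>a y\<^sub>b\<close> and
  \<open>(s', t', u')\<close> that of \<open>x\<^sub>a x\<^sub>b y\<^sub>c\<close>. Since \<open>I\<close> has codimension \<open>q + 2\<close> in the latter degree, the
  \<open>q + 2\<close> forms \<open>h\<close> are independent modulo \<open>I\<close> if they span.
\<close>

lemma contains_relations_if_point_dims:
  fixes I :: "'q::finite cwpoly set"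
  assumes I: "poly_ideal I" and q: "CARD('q) > 2" and dims: "has_point_dims I"
    and d: "s + t + u = 2" and d': "2 \<le> s' + t' + u'"
    and van: "\<And>f i. f \<in> I \<inter> homog s t u \<Longrightarrow> i \<noteq> Value \<Longrightarrow> jet i f = 0"
    and prod: "\<And>i a b. jet i (x a * y b) = chi i (vexp a + vexp b)"
    and hom: "\<And>a b. x a * y b \<in> homog s t u"
    and hom': "\<And>a h. h \<in> homog s t u \<Longrightarrow> x a * h \<in> homog s' t' u'"
    and induct: "\<And>P f. f \<in> homog s' t' u' \<Longrightarrow> P 0 \<Longrightarrow> (\<And>f g. P f \<Longrightarrow> P g \<Longrightarrow> P (f + g))
        \<Longrightarrow> (\<And>a h. h \<in> homog s t u \<Longrightarrow> P (x a * h)) \<Longrightarrow> P f"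
  shows "contains_relations I x y"
proof -
  interpret poly_ideal I by (rule I)
  obtain g where g: "g \<in> homog s t u"
    and gen: "\<And>f. f \<in> homog s t u \<Longrightarrow> (\<And>i. i \<noteq> Value \<Longrightarrow> jet i f = 0) \<Longrightarrow> \<exists>c. f - pscale c g \<in> I"
    using exists_generator_mod_ideal[OF I dims d van] by blast
  define j0 :: 'q where "j0 = undefined"
  define d where "d = x (Some j0) * y (Some j0)"
  define h where "h = case_option (x None * d) (\<lambda>i. x i * g)"
  define reducible where "reducible f \<longleftrightarrow> (\<exists>c. f - (\<Sum>s\<in>UNIV. pscale (c s) (h s)) \<in> I)" for f
  have hdiff: "x a * y b - x a' * y b' \<in> homog s t u" for a b a' b'
    by (rule poly.subspace_diff[OF subspace_homog hom hom])
  have hd: "d \<in> homog s t u" by (simp add: d_def hom)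
  have hV: "h i \<in> homog s' t' u'" for i
    by (cases i) (auto simp: h_def hd g intro!: hom')
  obtain S :: "'q cwpoly set" where S: "finite S" "homog s' t' u' \<subseteq> poly.span S" by (rule homog_finitely_spanned)
  have red0: "reducible f" if "f \<in> I" for f
    unfolding reducible_def using that by (intro exI[of _ "\<lambda>_. 0"]) simp
  have red_add: "reducible (f + f')" if red: "reducible f" "reducible f'" for f f'
  proof -
    obtain c c' where "f - (\<Sum>s\<in>UNIV. pscale (c s) (h s)) \<in> I" "f' - (\<Sum>s\<in>UNIV. pscale (c' s) (h s)) \<in> I"
      using red unfolding reducible_def by blast
    from add[OF this] show ?thesis
      unfolding reducible_def
      by (intro exI[of _ "\<lambda>s. c s + c' s"]) (simp add: poly.scale_left_distrib sum.distrib algebra_simps)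
  qed
  have red_scale: "reducible (pscale a f)" if red: "reducible f" for a f
  proof -
    obtain c where "f - (\<Sum>s\<in>UNIV. pscale (c s) (h s)) \<in> I"
      using red unfolding reducible_def by blast
    from pscale[OF this, of a] show ?thesis
      unfolding reducible_def
      by (intro exI[of _ "\<lambda>s. a * c s"]) (simp add: poly.scale_right_diff_distrib poly.scale_sum_right)
  qed
  have card: "card (UNIV :: 'q option option set) = CARD('q jet)" by (simp add: card_jet)
  have W: "poly.subspace (I \<inter> homog s' t' u')" by (rule poly.subspace_inter[OF subspace subspace_homog])
  show ?thesis
  proof (rule relations_if_quotients_small[OF I q, where ?j0.0 = j0 and g = g])
    show "\<exists>c. x None * y None - pscale c g \<in> I"
      by (rule gen[OF hom]) (subst prod, rule chi_pair(1))
    show "\<exists>c. x (Some k) * y None - x None * y (Some k) - pscale c g \<in> I" for k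
      by (rule gen[OF hdiff]) (simp add: lin_diff prod add.commute)
    show "\<exists>c. x (Some k) * y (Some l) - pscale c g \<in> I" if "k \<noteq> l" for k l
      by (rule gen[OF hom]) (subst prod, rule chi_pair(2)[OF _ that])
    show "\<exists>c. x (Some k) * y (Some k) - x (Some j0) * y (Some j0) - pscale c g \<in> I" for k
    proof (rule gen[OF hdiff])
      fix i :: "'q jet" assume "i \<noteq> Value"
      then show "jet i (x (Some k) * y (Some k) - x (Some j0) * y (Some j0)) = 0"
        unfolding lin_diff prod by (subst (1 2) chi_pair(3)) auto
    qed
  next
    fix c s0
    assume "\<And>i l. \<exists>c. x i * (x None * y (Some l)) - (\<Sum>s\<in>UNIV. pscale (c s)
          (case s of None \<Rightarrow> x None * (x (Some j0) * y (Some j0)) | Some i \<Rightarrow> x i * g)) \<in> I"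
      and "\<And>i. \<exists>c. x i * (x (Some j0) * y (Some j0)) - (\<Sum>s\<in>UNIV. pscale (c s)
          (case s of None \<Rightarrow> x None * (x (Some j0) * y (Some j0)) | Some i \<Rightarrow> x i * g)) \<in> I"
      and "\<And>i. \<exists>c. x i * g - (\<Sum>s\<in>UNIV. pscale (c s)
          (case s of None \<Rightarrow> x None * (x (Some j0) * y (Some j0)) | Some i \<Rightarrow> x i * g)) \<in> I"
      and "(\<Sum>s\<in>UNIV. pscale (c s)
          (case s of None \<Rightarrow> x None * (x (Some j0) * y (Some j0)) | Some i \<Rightarrow> x i * g)) \<in> I"
    then have red_y: "\<And>i l. reducible (x i * (x None * y (Some l)))" and red_d: "\<And>i. reducible (x i * d)"
      and red_g: "\<And>i. reducible (x i * g)" and rel: "(\<Sum>s\<in>UNIV. pscale (c s) (h s)) \<in> I"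
      unfolding reducible_def h_def d_def by blast+
    have red_x: "reducible (x i * f)" if f: "f \<in> homog s t u" for i f
    proof -
      \<comment> \<open>The part of \<open>f\<close> seen by the jets; the rest is a multiple of \<open>g\<close> modulo \<open>I\<close>.\<close>
      define f' where "f' = (\<Sum>l\<in>UNIV. pscale (jet (Slope l) f) (x None * y (Some l))) + pscale (jet Trace f) d"
      have "f - f' \<in> homog s t u" unfolding f'_def
        by (intro poly.subspace_diff[OF subspace_homog] poly.subspace_add[OF subspace_homog]
            poly.subspace_sum[OF subspace_homog] homog_pscale f) (use hom hd in auto)
      moreover have "jet k (f - f') = 0" if "k \<noteq> Value" for k
      proof -
        have "chi k (vexp None + vexp (Some l)) = of_bool (k = Slope l)" for l
          using that chi_jexp[of k j0 "Slope l"] by simp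
        then have "jet k f' = (\<Sum>l\<in>UNIV. jet (Slope l) f * of_bool (k = Slope l)) + jet Trace f * of_bool (k = Trace)"
          unfolding f'_def d_def lin_add lin_sum lin_pscale prod chi_pair(3)[OF that] by simp
        also have "\<dots> = jet k f" using that by (cases k) (auto simp: of_bool_def if_distrib cong: if_cong)
        finally show ?thesis by (simp add: lin_diff)
      qed
      ultimately obtain a where a: "f - f' - pscale a g \<in> I" using gen by blast
      have eq: "x i * f = x i * (f - f' - pscale a g) + pscale a (x i * g)
          + ((\<Sum>l\<in>UNIV. pscale (jet (Slope l) f) (x i * (x None * y (Some l)))) + pscale (jet Trace f) (x i * d))"
        unfolding f'_def by (simp add: algebra_simps pscale_mult_right sum_distrib_left)
      have red_sum: "reducible (\<Sum>l\<in>A. pscale (jet (Slope l) f) (x i * (x None * y (Some l))))" for A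
        by (induction A rule: infinite_finite_induct) (auto intro: red_add red_scale red_y red0)
      show ?thesis
        by (subst eq) (rule red_add[OF red_add[OF red0[OF mult[OF a]] red_scale[OF red_g]]
          red_add[OF red_sum red_scale[OF red_d]]])
    qed
    show "c s0 = 0"
    proof (rule poly.independent_mod_if_spanning[OF S(1) _ W finite])
      show "I \<inter> homog s' t' u' \<subseteq> poly.span S" using S by blast
      show "poly.dim (homog s' t' u' :: 'q cwpoly set) = poly.dim (I \<inter> homog s' t' u') + card (UNIV :: 'q option option set)"
        unfolding card by (rule has_point_dims_2[OF dims d'])
      have hsum: "(\<Sum>s\<in>UNIV. pscale (c s) (h s)) \<in> homog s' t' u'" for c
        by (intro poly.subspace_sum[OF subspace_homog] homog_pscale hV)
      show "(\<Sum>s\<in>UNIV. pscale (c s) (h s)) \<in> I \<inter> homog s' t' u'" using rel hsum by blast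
      show "\<exists>c. f - (\<Sum>s\<in>UNIV. pscale (c s) (h s)) \<in> I \<inter> homog s' t' u'" if f: "f \<in> homog s' t' u'" for f
      proof -
        have "reducible f" using f by (rule induct) (auto intro: red0 red_add red_x)
        then show ?thesis unfolding reducible_def
          using poly.subspace_diff[OF subspace_homog f hsum] by blast
      qed
    qed simp
  qed
qed

lemma homog_power_mult:
  "f \<in> homog s t u \<Longrightarrow> X i ^ n * f \<in> homog (n + s) t u"
  "f \<in> homog s t u \<Longrightarrow> Y i ^ n * f \<in> homog s (n + t) u"
  "f \<in> homog s t u \<Longrightarrow> Z i ^ n * f \<in> homog s t (n + u)"
  by (induction n) (auto simp: mult.assoc intro: homog_X_mult homog_Y_mult homog_Z_mult)

section \<open>The relations generate in all high degrees\<close>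

text \<open>
  Modulo the relations, every form of degree \<open>(a, b + 1, c + 1)\<close> is \<open>x\<^sub>0\<^sup>a y\<^sub>0\<^sup>b z\<^sub>0\<^sup>c\<close> times a combination of
  the \<open>q + 2\<close> forms \<open>w\<close>. This is applied to the intersection of \<open>I\<close> with the jet ideal, which contains the
  relations too: the combination is then itself in the jet ideal, and its coefficients are its jets,
  so it vanishes.
\<close>

lemma jet_ideal_subset_if_relations:
  fixes I :: "'q::finite cwpoly set"
  assumes I: "poly_ideal I" and q: "CARD('q) > 2"
    and XY: "contains_relations I X Y" and XZ: "contains_relations I X Z" and YZ: "contains_relations I Y Z"
  shows "jet_ideal \<inter> homog a (Suc b) (Suc c) \<subseteq> I"
proof -
  define j0 :: 'q where "j0 = undefined"
  define w :: "'q jet \<Rightarrow> 'q cwpoly" where "w i = (case i of Value \<Rightarrow> Y None * Z None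
    | Slope j \<Rightarrow> Y None * Z (Some j) | Trace \<Rightarrow> Y (Some j0) * Z (Some j0))" for i
  have other: "\<exists>k. k \<noteq> i" for i :: 'q
  proof (rule ccontr)
    assume "\<not> ?thesis"
    then have "UNIV \<subseteq> {i}" by auto
    then have "CARD('q) \<le> card {i}" by (intro card_mono) auto
    then show False using q by simp
  qed
  have main: "\<exists>k. f - X None ^ a * (Y None ^ b * (Z None ^ c)) * (\<Sum>i\<in>UNIV. pscale (k i) (w i)) \<in> I"
    if I: "poly_ideal I" and XY: "contains_relations I X Y" and XZ: "contains_relations I X Z"
      and YZ: "contains_relations I Y Z" and f: "f \<in> homog a (Suc b) (Suc c)"
    for I :: "'q cwpoly set" and f a b c
  proof -
    interpret poly_ideal I by (rule I)
    define red where "red M f \<longleftrightarrow> (\<exists>k. f - M * (\<Sum>i\<in>UNIV. pscale (k i) (w i)) \<in> I)" for M f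
    have red0: "red M f" if "f \<in> I" for M f
      unfolding red_def using that by (intro exI[of _ "\<lambda>_. 0"]) simp
    have red_add: "red M (f + f')" if red: "red M f" "red M f'" for M f f'
    proof -
      obtain c c' where "f - M * (\<Sum>s\<in>UNIV. pscale (c s) (w s)) \<in> I" "f' - M * (\<Sum>s\<in>UNIV. pscale (c' s) (w s)) \<in> I"
        using red unfolding red_def by blast
      from add[OF this] show ?thesis
        unfolding red_def
        by (intro exI[of _ "\<lambda>s. c s + c' s"]) (simp add: poly.scale_left_distrib sum.distrib algebra_simps)
    qed
    have red_scale: "red M (pscale a f)" if red: "red M f" for M a f
    proof -
      obtain c where "f - M * (\<Sum>s\<in>UNIV. pscale (c s) (w s)) \<in> I"
        using red unfolding red_def by blast
      from pscale[OF this, of a] show ?thesis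
        unfolding red_def
        by (intro exI[of _ "\<lambda>s. a * c s"]) (simp add: poly.scale_right_diff_distrib poly.scale_sum_right flip: pscale_mult_right poly.scale_scale)
    qed
    have red_sum: "red M (\<Sum>i\<in>A. pscale (k i) (v i))" if "\<And>i. red M (v i)" for M k A and v :: "'q jet \<Rightarrow> _"
      using that by (induction A rule: infinite_finite_induct) (auto intro: red_add red_scale red0)
    have red_cong: "red M f" if red: "f - f' \<in> I" "red M f'" for M f f'
      using red_add[OF red(2) red0[OF red(1)]] by simp
    have red_w: "red M (M * w i)" for M i
    proof -
      have "(\<Sum>i'\<in>UNIV. pscale (of_bool (i' = i)) (w i')) = (\<Sum>i'\<in>UNIV. if i' = i then w i else 0)"
        by (intro sum.cong) auto
      then show ?thesis unfolding red_def by (intro exI[of _ "\<lambda>i'. of_bool (i' = i)"]) simp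
    qed
    \<comment> \<open>Induction step for the degree: multiplication by \<open>x\<close> adds a factor \<open>x0\<close> to the normal form.\<close>
    have red_step: "red (x0 * M) (x * f)" if x: "\<And>i. red x0 (x * w i)" and f: "red M f" for x0 x M f
    proof -
      obtain k where k: "f - M * (\<Sum>i\<in>UNIV. pscale (k i) (w i)) \<in> I" using f unfolding red_def by blast
      have "red x0 (\<Sum>i\<in>UNIV. pscale (k i) (x * w i))" by (rule red_sum[OF x])
      then obtain k' where "(\<Sum>i\<in>UNIV. pscale (k i) (x * w i)) - x0 * (\<Sum>i\<in>UNIV. pscale (k' i) (w i)) \<in> I"
        unfolding red_def by blast
      from add[OF mult[OF k, of x] mult[OF this, of M]]
      have "x * f - (x0 * M) * (\<Sum>i\<in>UNIV. pscale (k' i) (w i)) \<in> I"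
        by (simp add: algebra_simps sum_distrib_left pscale_mult_right)
      then show ?thesis unfolding red_def by blast
    qed
    have red_mult: "red x (x * f)" if "red 1 f" for x f
    proof -
      have "red (x * 1) (x * f)" by (rule red_step[OF red_w that])
      then show ?thesis by simp
    qed
    note rel = contains_relations_def
    have yz: "red 1 (Y i * Z j)" for i j
    proof (cases i)
      case None
      then have "Y i * Z j = 1 * w (case j of None \<Rightarrow> Value | Some j \<Rightarrow> Slope j)"
        by (simp add: w_def split: option.split)
      then show ?thesis using red_w by metis
    next
      case (Some i')
      show ?thesis
      proof (cases j)
        case None
        show ?thesis unfolding Some None
          by (rule red_cong[of _ "w (Slope i')"]) (use YZ red_w[of 1 "Slope i'"] in \<open>auto simp: rel w_def\<close>)
      next
        case j: (Some j')
        show ?thesis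
        proof (cases "i' = j'")
          case True
          show ?thesis unfolding Some j True
            by (rule red_cong[of _ "w Trace"]) (use YZ red_w[of 1 Trace] in \<open>auto simp: rel w_def\<close>)
        next
          case False
          then show ?thesis unfolding Some j using YZ by (intro red0) (auto simp: rel)
        qed
      qed
    qed
    have Xw: "red (X None) (X i * w s)" for i s
    proof (cases i)
      case None
      then show ?thesis using red_w by simp
    next
      case (Some i')
      show ?thesis
      proof (cases s)
        case Value
        have "X i * w s - X None * (Y None * Z (Some i')) = Y None * (X (Some i') * Z None - X None * Z (Some i'))"
          unfolding w_def Value Some by (simp add: algebra_simps)
        also have "\<dots> \<in> I" using XZ by (intro mult) (auto simp: rel)
        finally show ?thesis by (rule red_cong[OF _ red_mult[OF yz]])
      next
        case (Slope j)
        have "X i * w s - X None * (Y (Some i') * Z (Some j)) = Z (Some j) * (X (Some i') * Y None - X None * Y (Some i'))"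
          unfolding w_def Slope Some by (simp add: algebra_simps)
        also have "\<dots> \<in> I" using XY by (intro mult) (auto simp: rel)
        finally show ?thesis by (rule red_cong[OF _ red_mult[OF yz]])
      next
        case Trace
        obtain k where k: "k \<noteq> i'" using other by blast
        have "X i * w s = X i * (Y (Some j0) * Z (Some j0) - Y (Some k) * Z (Some k)) + Z (Some k) * (X (Some i') * Y (Some k))"
          unfolding w_def Trace Some by (simp add: algebra_simps)
        also have "\<dots> \<in> I" using XY YZ k by (intro add[OF mult mult]) (auto simp: rel)
        finally show ?thesis by (rule red0)
      qed
    qed
    have Yw: "red (Y None) (Y i * w s)" for i s
    proof (cases i)
      case None
      then show ?thesis using red_w by simp
    next
      case (Some i')
      have *: "red (Y None) (Y i * (Y None * Z j))" for j
        using red_mult[OF yz[of i j], of "Y None"] by (simp add: mult.left_commute)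
      show ?thesis
      proof (cases s)
        case Trace
        obtain k where k: "k \<noteq> i'" using other by blast
        have "Y i * w s = Y i * (Y (Some j0) * Z (Some j0) - Y (Some k) * Z (Some k)) + Y (Some k) * (Y (Some i') * Z (Some k))"
          unfolding w_def Trace Some by (simp add: algebra_simps)
        also have "\<dots> \<in> I" using YZ k by (intro add[OF mult mult]) (auto simp: rel)
        finally show ?thesis by (rule red0)
      qed (use * in \<open>auto simp: w_def\<close>)
    qed
    have Zw: "red (Z None) (Z i * w s)" for i s
    proof (cases i)
      case None
      then show ?thesis using red_w by simp
    next
      case (Some i')
      show ?thesis
      proof (cases s)
        case Value
        have "Z i * w s = Z None * (Y None * Z i)"
          unfolding w_def Value Some by (simp add: algebra_simps)
        then show ?thesis using red_mult[OF yz] by metis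
      next
        case (Slope j)
        have "Z i * w s - Z None * (Y (Some i') * Z (Some j)) = - (Z (Some j) * (Y (Some i') * Z None - Y None * Z (Some i')))"
          unfolding w_def Slope Some by (simp add: algebra_simps)
        also have "\<dots> \<in> I" using YZ by (intro minus[OF mult]) (auto simp: rel)
        finally show ?thesis by (rule red_cong[OF _ red_mult[OF yz]])
      next
        case Trace
        obtain k where k: "k \<noteq> i'" using other by blast
        have "Z i * w s = Z i * (Y (Some j0) * Z (Some j0) - Y (Some k) * Z (Some k)) + Z (Some k) * (Y (Some k) * Z (Some i'))"
          unfolding w_def Trace Some by (simp add: algebra_simps)
        also have "\<dots> \<in> I" using YZ k by (intro add[OF mult mult]) (auto simp: rel)
        finally show ?thesis by (rule red0)
      qed
    qed
    have const: "\<exists>a. f = pscale a 1" if "f \<in> homog 0 0 0" for f :: "'q cwpoly"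
      using that
    proof (induction rule: homog_induct)
      case zero
      then show ?case by (intro exI[of _ 0]) simp
    next
      case (add f g)
      then obtain a b where "f = pscale a 1" "g = pscale b 1" by blast
      then show ?case by (intro exI[of _ "a + b"]) (simp add: poly.scale_left_distrib)
    next
      case (single m a)
      then have "m = 0" by (cases m) (simp add: mdeg_def zero_prod_def)
      then show ?case by (intro exI[of _ a]) (simp add: pscale_def)
    qed
    have "red (X None ^ a * (Y None ^ b * Z None ^ c)) f" if "f \<in> homog a (Suc b) (Suc c)" for a b c f
      using that
    proof (induction a arbitrary: f)
      case 0
      then show ?case
      proof (induction b arbitrary: f)
        case 0
        then show ?case
        proof (induction c arbitrary: f)
          case 0
          then have "f \<in> homog 0 (Suc 0) (Suc 0)" by simp
          then show ?case
          proof (induction f rule: homog_Y_induct)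
            case (Y i h)
            from Y show ?case
            proof (induction h rule: homog_Z_induct)
              case (Z j h)
              then obtain a where "h = pscale a 1" using const by blast
              then have "Y i * (Z j * h) = pscale a (Y i * Z j)" by (simp add: pscale_mult_right)
              then show ?case using red_scale[OF yz] by simp
            qed (auto intro: red0 red_add simp: distrib_left)
          qed (auto intro: red0 red_add)
        next
          case (Suc c)
          from Suc.prems show ?case
          proof (induction f rule: homog_Z_induct)
            case (Z i h)
            from red_step[OF Zw Suc.IH[OF Z]] show ?case by (simp add: algebra_simps)
          qed (auto intro: red0 red_add)
        qed
      next
        case (Suc b)
        from Suc.prems show ?case
        proof (induction f rule: homog_Y_induct)
          case (Y i h)
          from red_step[OF Yw Suc.IH[OF Y]] show ?case by (simp add: algebra_simps)
        qed (auto intro: red0 red_add)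
      qed
    next
      case (Suc a)
      from Suc.prems show ?case
      proof (induction f rule: homog_X_induct)
        case (X i h)
        from red_step[OF Xw Suc.IH[OF X]] show ?case by (simp add: algebra_simps)
      qed (auto intro: red0 red_add)
    qed
    from this[OF f] show ?thesis unfolding red_def .
  qed
  show ?thesis
  proof
    fix f :: "'q cwpoly" assume f: "f \<in> jet_ideal \<inter> homog a (Suc b) (Suc c)"
    interpret I: poly_ideal I by (rule I)
    interpret J: poly_ideal "jet_ideal :: 'q cwpoly set" by (rule poly_ideal_jet_ideal)
    have IJ: "poly_ideal (I \<inter> jet_ideal)"
      by unfold_locales (auto intro: I.add J.add I.mult J.mult)
    have rels: "contains_relations (I \<inter> jet_ideal) X Y" "contains_relations (I \<inter> jet_ideal) X Z"
      "contains_relations (I \<inter> jet_ideal) Y Z"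
      using XY XZ YZ
      by (auto intro!: contains_relations_Int contains_relations_jet_ideal homog_X_mult homog_Y_mult homog_Y homog_Z)
    define M :: "'q cwpoly" where "M = X None ^ a * (Y None ^ b * Z None ^ c)"
    obtain k where k: "f - M * (\<Sum>i\<in>UNIV. pscale (k i) (w i)) \<in> I \<inter> jet_ideal"
      using main[OF IJ rels, of f a b c] f unfolding M_def by blast
    then have mem: "M * (\<Sum>i\<in>UNIV. pscale (k i) (w i)) \<in> jet_ideal"
      using f J.diff[of f "f - M * (\<Sum>i\<in>UNIV. pscale (k i) (w i))"] by simp
    have homM: "M * (\<Sum>i\<in>UNIV. pscale (k i) (w i)) \<in> homog a (Suc b) (Suc c)"
    proof -
      have "w i \<in> homog 0 (Suc 0) (Suc 0)" for i
        by (cases i) (auto simp: w_def intro!: homog_Y_mult homog_Z)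
      then have "(\<Sum>i\<in>UNIV. pscale (k i) (w i)) \<in> homog 0 (Suc 0) (Suc 0)"
        by (intro poly.subspace_sum[OF subspace_homog] homog_pscale)
      then show ?thesis unfolding M_def mult.assoc
      by (metis (no_types, lifting) add_Suc_right add_0_right homog_power_mult)
    qed
    have jets: "jet i (M * (\<Sum>s\<in>UNIV. pscale (k s) (w s))) = k i" for i
    proof -
      have "jet i (w s) = of_bool (i = s)" for s
      proof -
        have "jet i (w s) = chi i (jexp j0 s)"
          by (cases s) (simp_all add: w_def single_two del: One_nat_def chi.simps)
        then show ?thesis by (simp add: chi_jexp)
      qed
      then show ?thesis
        by (simp add: M_def mult.assoc lin_sum lin_pscale)
    qed
    have "k i = 0" for i using mem jets[of i] unfolding jet_ideal_homog_iff[OF homM] by simp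
    then show "f \<in> I" using k by simp
  qed
qed


section \<open>The annihilator of the Coppersmith-Winograd tensor\<close>

lemma T_cw_nth: "T_cw $ i $ j $ k = chi Trace (vexp i + vexp j + vexp k)" for i j k :: "'q::finite option"
proof -
  have T: "T_cw $ i $ j $ k = (\<Sum>l\<in>UNIV. of_bool (i = None \<and> j = Some l \<and> k = Some l)
     + of_bool (i = Some l \<and> j = None \<and> k = Some l) + of_bool (i = Some l \<and> j = Some l \<and> k = None))"
    unfolding T_cw_def Let_def sum_component
    by (intro sum.cong) (auto simp: tensor_prod_def axis_def)
  have s: "(\<Sum>l\<in>UNIV. of_bool (a = l \<and> b = l) :: complex) = of_bool (a = b)" for a b :: 'q
  proof -
    have "(\<Sum>l\<in>UNIV. of_bool (a = l \<and> b = l) :: complex) = (\<Sum>l\<in>UNIV. if l = a then of_bool (a = b) else 0)"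
      by (intro sum.cong) auto
    then show ?thesis by simp
  qed
  have p: "chi Trace (Poly_Mapping.single a 1 + Poly_Mapping.single b 1) = of_bool (a = b)" for a b :: 'q
    using chi_pair(2)[of Trace a b] chi_pair(3)[of Trace a] by (cases "a = b") auto
  have d: "chi Trace \<mu> = 0" if "deg \<mu> \<noteq> 2" for \<mu> :: "'q \<Rightarrow>\<^sub>0 nat"
    using deg_chi_Trace that by blast
  show ?thesis
    unfolding T
    by (cases i; cases j; cases k)
      (simp_all add: s p[unfolded One_nat_def] d deg_add del: chi.simps sum_of_bool_eq)
qed

lemma perp_T_cw_iff:
  fixes f :: "'q::finite cwpoly"
  assumes f: "f \<in> homog 1 1 1"
  shows "f \<in> perp T_cw \<longleftrightarrow> jet Trace f = 0"
proof -
  define m where "m = (\<lambda>(i :: 'q option, j :: 'q option, k :: 'q option).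
    (Poly_Mapping.single i (1::nat), Poly_Mapping.single j (1::nat), Poly_Mapping.single k (1::nat)))"
  have sinj: "i = j" if "Poly_Mapping.single i (1::nat) = Poly_Mapping.single j 1" for i j :: "'q option"
    using that by (metis lookup_single_eq lookup_single_not_eq one_neq_zero)
  then have inj: "inj m" by (auto simp: inj_def m_def)
  have keys: "Poly_Mapping.keys f \<subseteq> range m"
  proof
    fix n assume n: "n \<in> Poly_Mapping.keys f"
    obtain a b c where abc: "n = (a, b, c)" by (cases n)
    have "deg a = Suc 0" "deg b = Suc 0" "deg c = Suc 0" using homogD[OF f n] by (auto simp: abc mdeg_Pair)
    then obtain i j k where "a = Poly_Mapping.single i 1" "b = Poly_Mapping.single j 1" "c = Poly_Mapping.single k 1"
      by (meson deg_eq_1E)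
    then have "n = m (i, j, k)" by (simp add: abc m_def)
    then show "n \<in> range m" by blast
  qed
  have texp_m: "texp (m (i, j, k)) = vexp i + vexp j + vexp k" for i j k
  proof -
    have "m (i, j, k) = xm i + ym j + zm k" by (simp add: m_def xm_def ym_def zm_def)
    then show ?thesis by (simp add: texp_add)
  qed
  have "jet Trace f = (\<Sum>p\<in>UNIV. Poly_Mapping.lookup f (m p) * chi Trace (texp (m p)))"
    by (subst lin_superset[OF _ keys]) (auto simp: sum.reindex[OF inj])
  also have "\<dots> = (\<Sum>(i, j, k)\<in>UNIV \<times> UNIV \<times> UNIV. Poly_Mapping.lookup f (m (i, j, k)) * T_cw $ i $ j $ k)"
    unfolding T_cw_nth by (intro sum.cong) (auto simp: texp_m)
  also have "\<dots> = (\<Sum>i\<in>UNIV. \<Sum>j\<in>UNIV. \<Sum>k\<in>UNIV. Poly_Mapping.lookup f (m (i, j, k)) * T_cw $ i $ j $ k)"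
    by (simp only: sum.cartesian_product)
  finally show ?thesis using f by (simp add: perp_def m_def)
qed

section \<open>Uniqueness\<close>

text \<open>
  Multiplying \<open>f\<close> by the variable of index \<open>None\<close> or \<open>Some j\<close> of the missing group leads to degree
  \<open>(1, 1, 1)\<close>, where apolarity is the vanishing of \<open>Trace\<close>; and \<open>Trace\<close> of such a product is the jet
  \<open>Trace\<close> or \<open>Slope j\<close> of \<open>f\<close>.
\<close>

lemma jets_vanish_in_degree_two:
  fixes I :: "'q::finite cwpoly set"
  assumes I: "poly_ideal I" and T: "I \<inter> homog 1 1 1 \<subseteq> perp T_cw"
    and f: "f \<in> I" and v: "\<And>a. v a * f \<in> homog 1 1 1"
      "\<And>i a. jet i (v a * f) = lin (\<lambda>m. chi i (vexp a + texp m)) f"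
    and i: "i \<noteq> Value"
  shows "jet i f = 0"
proof -
  interpret poly_ideal I by (rule I)
  have *: "jet Trace (v a * f) = 0" for a
    using T v(1) mult[OF f] perp_T_cw_iff[OF v(1)] by blast
  show ?thesis
  proof (cases i)
    case Trace
    then show ?thesis using *[of None] unfolding v(2) by simp
  next
    case (Slope j)
    have "jet Trace (v (Some j) * f) = jet (Slope j) f"
      unfolding v(2) vexp.simps chi_Trace_single_add ..
    then show ?thesis using * Slope by simp
  qed (use i in simp)
qed

lemma eq_jet_ideal:
  fixes I :: "'q::finite cwpoly set"
  assumes q: "CARD('q) > 2" and gr: "multigraded_ideal I" and dims: "has_point_dims I"
    and T: "I \<inter> homog 1 1 1 \<subseteq> perp T_cw"
  shows "I = jet_ideal"
proof (rule multigraded_ideal_eqI[OF gr multigraded_jet_ideal])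
  have I: "poly_ideal I" using gr by (simp add: multigraded_ideal_def poly_ideal_iff)
  interpret poly_ideal I by (rule I)
  have XY: "contains_relations I X Y"
  proof (rule contains_relations_if_point_dims[OF I q dims])
    show "jet i f = 0" if "f \<in> I \<inter> homog 1 1 0" "i \<noteq> Value" for f i
      using homog_Z_mult[of f 1 1 0] that
      by (intro jets_vanish_in_degree_two[OF I T, where v = Z]) (auto simp: jet_var_mult)
    show "P f" if "f \<in> homog 2 1 0" "P 0" "(\<And>f g. P f \<Longrightarrow> P g \<Longrightarrow> P (f + g))"
      "(\<And>a h. h \<in> homog 1 1 0 \<Longrightarrow> P (X a * h))" for P and f :: "'q cwpoly"
      by (rule homog_X_induct[of f 1 1 0 P]) (use that in \<open>auto simp: numeral_2_eq_2\<close>)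
    show "X a * h \<in> homog 2 1 0" if "h \<in> homog 1 1 0" for a and h :: "'q cwpoly"
      using homog_X_mult[OF that] by (simp add: numeral_2_eq_2)
    show "X a * Y b \<in> (homog 1 1 0 :: 'q cwpoly set)" for a b :: "'q option"
      using homog_X_mult[OF homog_Y] by simp
  qed auto
  have XZ: "contains_relations I X Z"
  proof (rule contains_relations_if_point_dims[OF I q dims])
    show "jet i f = 0" if "f \<in> I \<inter> homog 1 0 1" "i \<noteq> Value" for f i
      using homog_Y_mult[of f 1 0 1] that
      by (intro jets_vanish_in_degree_two[OF I T, where v = Y]) (auto simp: jet_var_mult)
    show "P f" if "f \<in> homog 2 0 1" "P 0" "(\<And>f g. P f \<Longrightarrow> P g \<Longrightarrow> P (f + g))"
      "(\<And>a h. h \<in> homog 1 0 1 \<Longrightarrow> P (X a * h))" for P and f :: "'q cwpoly"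
      by (rule homog_X_induct[of f 1 0 1 P]) (use that in \<open>auto simp: numeral_2_eq_2\<close>)
    show "X a * h \<in> homog 2 0 1" if "h \<in> homog 1 0 1" for a and h :: "'q cwpoly"
      using homog_X_mult[OF that] by (simp add: numeral_2_eq_2)
    show "X a * Z b \<in> (homog 1 0 1 :: 'q cwpoly set)" for a b :: "'q option"
      using homog_X_mult[OF homog_Z] by simp
  qed auto
  have YZ: "contains_relations I Y Z"
  proof (rule contains_relations_if_point_dims[OF I q dims])
    show "jet i f = 0" if "f \<in> I \<inter> homog 0 1 1" "i \<noteq> Value" for f i
      using homog_X_mult[of f 0 1 1] that
      by (intro jets_vanish_in_degree_two[OF I T, where v = X]) (auto simp: jet_var_mult)
    show "P f" if "f \<in> homog 0 2 1" "P 0" "(\<And>f g. P f \<Longrightarrow> P g \<Longrightarrow> P (f + g))"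
      "(\<And>a h. h \<in> homog 0 1 1 \<Longrightarrow> P (Y a * h))" for P and f :: "'q cwpoly"
      by (rule homog_Y_induct[of f 0 1 1 P]) (use that in \<open>auto simp: numeral_2_eq_2\<close>)
    show "Y a * h \<in> homog 0 2 1" if "h \<in> homog 0 1 1" for a and h :: "'q cwpoly"
      using homog_Y_mult[OF that] by (simp add: numeral_2_eq_2)
    show "Y a * Z b \<in> (homog 0 1 1 :: 'q cwpoly set)" for a b :: "'q option"
      using homog_Y_mult[OF homog_Z] by simp
  qed auto
  have dim_eq: "poly.dim (I \<inter> homog s t u) = poly.dim (jet_ideal \<inter> (homog s t u :: 'q cwpoly set))" for s t u
    using dims has_point_dims_jet_ideal[where 'q = 'q] unfolding has_point_dims_def by (metis add_right_cancel)
  interpret J: poly_ideal "jet_ideal :: 'q cwpoly set" by (rule poly_ideal_jet_ideal)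
  have sub: "I \<inter> homog s t u = J \<inter> homog s t u"
    if JI: "I \<inter> homog s t u \<subseteq> J" and I: "poly_ideal I" and J: "poly_ideal J"
      and dim: "poly.dim (I \<inter> homog s t u) = poly.dim (J \<inter> homog s t u)"
    for I J :: "'q cwpoly set" and s t u
  proof -
    obtain S :: "'q cwpoly set" where S: "finite S" "homog s t u \<subseteq> poly.span S" by (rule homog_finitely_spanned)
    show ?thesis
      by (rule poly.subspace_eq_if_dim_ge[OF S(1)])
        (use S JI dim poly.subspace_inter[OF poly_ideal.subspace[OF I] subspace_homog] in auto)
  qed
  have high: "I \<inter> homog a (Suc b) (Suc c) = jet_ideal \<inter> homog a (Suc b) (Suc c)" for a b c
    using jet_ideal_subset_if_relations[OF I q XY XZ YZ, of a b c]
    by (intro sub[symmetric] I J.poly_ideal_axioms dim_eq[symmetric])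
  show "I \<inter> homog s t u = jet_ideal \<inter> homog s t u" for s t u
  proof (rule sub[OF _ I J.poly_ideal_axioms dim_eq], rule subsetI)
    \<comment> \<open>Multiplication by \<open>y\<^sub>0 z\<^sub>0\<close> preserves jets and leads to a degree covered by \<open>high\<close>.\<close>
    fix f assume f: "f \<in> I \<inter> homog s t u"
    have "Y None * (Z None * f) \<in> I \<inter> homog s (Suc t) (Suc u)"
      using f by (auto intro!: mult homog_Y_mult homog_Z_mult)
    then have "\<forall>i. jet i (Y None * (Z None * f)) = 0"
      unfolding high using jet_ideal_homog_iff by blast
    then show "f \<in> jet_ideal" using f jet_ideal_homog_iff[of f s t u] by simp
  qed
qed


section \<open>Convergence in the Grassmannian\<close>

lemma limitin_poly_topology:
  assumes "\<And>m. ((\<lambda>n. Poly_Mapping.lookup (f n) m) \<longlongrightarrow> Poly_Mapping.lookup l m) F"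
  shows "limitin poly_topology f l F"
proof -
  have "limitin (product_topology (\<lambda>_. euclidean) UNIV) (\<lambda>n. Poly_Mapping.lookup (f n)) (Poly_Mapping.lookup l) F"
    using assms by (simp add: limitin_componentwise limitin_canonical_iff)
  then have lim: "((\<lambda>n. Poly_Mapping.lookup (f n)) \<longlongrightarrow> Poly_Mapping.lookup l) F"
    by (simp add: euclidean_product_topology limitin_canonical_iff)
  show ?thesis
    unfolding limitin_def
  proof (intro conjI allI impI)
    show "l \<in> topspace poly_topology"
      by (simp add: poly_topology_def topspace_pullback_topology)
    fix U assume "openin poly_topology U \<and> l \<in> U"
    then obtain U' where U': "open U'" "U = Poly_Mapping.lookup -` U'" "Poly_Mapping.lookup l \<in> U'"
      unfolding poly_topology_def openin_pullback_topology by auto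
    with topological_tendstoD[OF lim] show "\<forall>\<^sub>F n in F. f n \<in> U" by simp
  qed
qed

lemma span_frame_in_grassmannian:
  assumes V: "poly.subspace V" and F: "F \<in> frames k V"
  shows "poly.span (F ` {..<k}) \<in> grassmannian k V"
proof -
  have "poly.span (F ` {..<k}) \<subseteq> V"
    using F by (intro poly.span_minimal V) (auto simp: frames_def)
  moreover have "poly.dim (poly.span (F ` {..<k})) = k"
    using F poly.dim_span_eq_card_independent[of "F ` {..<k}"] by (auto simp: frames_def card_image)
  ultimately show ?thesis by (simp add: grassmannian_def)
qed

lemma topspace_poly_topology [simp]: "topspace poly_topology = UNIV"
  by (simp add: poly_topology_def topspace_pullback_topology)

lemma topspace_grassmannian_topology:
  assumes "poly.subspace V"
  shows "topspace (grassmannian_topology k V) = grassmannian k V"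
proof
  show "topspace (grassmannian_topology k V) \<subseteq> grassmannian k V"
    using openin_topspace[of "grassmannian_topology k V"] by (simp only: openin_grassmannian_topology)
  let ?X = "subtopology (product_topology (\<lambda>_. poly_topology) {..<k}) (frames k V)"
  have "{F \<in> frames k V. poly.span (F ` {..<k}) \<in> grassmannian k V} = frames k V"
    using span_frame_in_grassmannian[OF assms] by blast
  moreover have "openin ?X (frames k V)"
  proof -
    have "frames k V \<subseteq> topspace (product_topology (\<lambda>_. poly_topology) {..<k})"
      by (auto simp: frames_def)
    then have "topspace ?X = frames k V" by (rule topspace_subtopology_subset)
    with openin_topspace[of ?X] show ?thesis by (simp only:)
  qed
  ultimately have "openin (grassmannian_topology k V) (grassmannian k V)"
    unfolding openin_grassmannian_topology by (simp only: order_refl simp_thms)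
  then show "grassmannian k V \<subseteq> topspace (grassmannian_topology k V)" by (rule openin_subset)
qed

lemma kernel_eq_jets_upto:
  fixes c :: "'q::finite jet \<Rightarrow> 'q cwmono \<Rightarrow> complex"
  assumes c: "dual_to_jets j0 c"
  shows "{f \<in> homog s t u. \<forall>i. lin (c i) f = 0} = {f \<in> homog s t u. \<forall>i\<in>jets_upto (s + t + u). lin (c i) f = 0}"
proof (cases "s + t + u \<le> 1")
  case True
  from dual_kernel_low_degree[OF c True] show ?thesis by auto
next
  case False
  then have "jets_upto (s + t + u) = (UNIV :: 'q jet set)"
    by (auto simp: jets_upto_def split: jet.splits)
  then show ?thesis by simp
qed

text \<open>
  Let \<open>v i\<close> be monomials dual to the jets. Then \<open>f - (\<Sum>i. c\<^sub>n i f \<cdot> v i)\<close> is in the kernel of the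
  \<open>n\<close>-th family, and for \<open>f\<close> in the limit kernel it tends to \<open>f\<close>. This map \<open>\<phi> n\<close> is injective on the limit
  kernel for every \<open>n\<close>, because the span of the \<open>v i\<close> meets that kernel only in zero. So it carries a frame
  of the limit to frames of the approximating kernels, which is convergence in the quotient topology.
\<close>

lemma limitin_dual_kernels:
  fixes c :: "nat \<Rightarrow> 'q::finite jet \<Rightarrow> 'q cwmono \<Rightarrow> complex"
  assumes c: "\<And>n. dual_to_jets j0 (c n)" and d: "dual_to_jets j0 d"
    and lim: "\<And>i m. (\<lambda>n. c n i m) \<longlonglongrightarrow> d i m"
  shows "limitin (grassmannian_topology (poly.dim (homog s t u :: 'q cwpoly set) - min CARD('q jet) (poly.dim (homog s t u :: 'q cwpoly set))) (homog s t u))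
    (\<lambda>n. {f \<in> homog s t u. \<forall>i. lin (c n i) f = 0}) {f \<in> homog s t u. \<forall>i. lin (d i) f = 0} sequentially"
proof -
  let ?V = "homog s t u :: 'q cwpoly set"
  let ?N = "jets_upto (s + t + u) :: 'q jet set"
  define k where "k = poly.dim ?V - min CARD('q jet) (poly.dim ?V)"
  define ker where "ker b = {f \<in> ?V. \<forall>i. lin (b i) f = 0}" for b :: "'q jet \<Rightarrow> 'q cwmono \<Rightarrow> complex"
  obtain S :: "'q cwpoly set" where S: "finite S" "?V \<subseteq> poly.span S" by (rule homog_finitely_spanned)
  have sub: "poly.subspace (ker b)" for b
    by (auto simp: ker_def poly.subspace_def homog_add homog_pscale lin_add lin_pscale)
  have dim: "poly.dim (ker b) = k" if "dual_to_jets j0 b" for b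
    using dim_dual_kernel[OF that refl, of s t u] unfolding ker_def k_def by linarith
  have "\<forall>i\<in>?N. \<exists>m. mdeg m = (s, t, u) \<and> texp m = jexp j0 i"
    using exists_monomial jets_upto_iff by blast
  then obtain v where v: "\<And>i. i \<in> ?N \<Longrightarrow> mdeg (v i) = (s, t, u) \<and> texp (v i) = jexp j0 i"
    by metis
  define \<phi> where "\<phi> n f = f - (\<Sum>i\<in>?N. pscale (lin (c n i) f) (Poly_Mapping.single (v i) 1))" for n and f :: "'q cwpoly"
  have \<phi>_ker: "\<phi> n f \<in> ker (c n)" if f: "f \<in> ?V" for n f
  proof -
    have "\<phi> n f \<in> ?V" unfolding \<phi>_def using v
      by (intro poly.subspace_diff[OF subspace_homog] poly.subspace_sum[OF subspace_homog] homog_pscale homog_single f) blast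
    moreover have "lin (c n i) (\<phi> n f) = 0" if "i \<in> ?N" for i
    proof -
      have "lin (c n i) (\<Sum>k\<in>?N. pscale (lin (c n k) f) (Poly_Mapping.single (v k) 1)) = (\<Sum>k\<in>?N. if k = i then lin (c n i) f else 0)"
        unfolding lin_sum lin_pscale lin_single
        using v dual_to_jetsD[OF c, of "v _" _ n] by (intro sum.cong) auto
      then show ?thesis using that by (simp add: \<phi>_def lin_diff)
    qed
    ultimately show ?thesis unfolding ker_def kernel_eq_jets_upto[OF c] by blast
  qed
  interpret vp: vector_space_pair pscale pscale by unfold_locales
  have \<phi>_linear: "Vector_Spaces.linear pscale pscale (\<phi> n)" for n
    unfolding Vector_Spaces.linear_iff by (simp add: poly.vector_space_axioms \<phi>_def lin_add lin_pscale poly.scale_left_distrib sum.distrib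
        poly.scale_right_diff_distrib poly.scale_sum_right algebra_simps)
  have \<phi>_inj: "inj_on (\<phi> n) (ker d)" for n
  proof (rule inj_onI)
    fix f g assume fg: "f \<in> ker d" "g \<in> ker d" "\<phi> n f = \<phi> n g"
    define h where "h = f - g"
    have h: "h \<in> ker d" unfolding h_def by (rule poly.subspace_diff[OF sub fg(1,2)])
    have "\<phi> n h = 0" unfolding h_def using vp.linear_diff[OF \<phi>_linear] fg(3) by simp
    then have eq: "h = (\<Sum>k\<in>?N. pscale (lin (c n k) h) (Poly_Mapping.single (v k) 1))" by (simp add: \<phi>_def)
    have "lin (c n i) h = 0" if i: "i \<in> ?N" for i
    proof -
      have "lin (d i) (\<Sum>k\<in>?N. pscale (lin (c n k) h) (Poly_Mapping.single (v k) 1)) = (\<Sum>k\<in>?N. if k = i then lin (c n i) h else 0)"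
        unfolding lin_sum lin_pscale lin_single
        using v dual_to_jetsD[OF d, of "v _"] by (intro sum.cong) auto
      also have "\<dots> = lin (c n i) h" using i by simp
      finally have "lin (d i) h = lin (c n i) h" using eq by simp
      then show ?thesis using h by (simp add: ker_def)
    qed
    then have "h = 0" using eq by simp
    then show "f = g" by (simp add: h_def)
  qed
  have \<phi>_lim: "limitin poly_topology (\<lambda>n. \<phi> n f) f sequentially" if "f \<in> ker d" for f
  proof (rule limitin_poly_topology)
    fix m
    have "(\<lambda>n. Poly_Mapping.lookup f m - (\<Sum>i\<in>?N. lin (c n i) f * Poly_Mapping.lookup (Poly_Mapping.single (v i) 1) m))
      \<longlonglongrightarrow> Poly_Mapping.lookup f m - (\<Sum>i\<in>?N. lin (d i) f * Poly_Mapping.lookup (Poly_Mapping.single (v i) 1) m)"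
      by (intro tendsto_intros tendsto_lin lim)
    then show "(\<lambda>n. Poly_Mapping.lookup (\<phi> n f) m) \<longlonglongrightarrow> Poly_Mapping.lookup f m"
      using that by (simp add: \<phi>_def lookup_minus lookup_sum lookup_pscale ker_def)
  qed
  obtain B where B: "finite B" "B \<subseteq> ker d" "poly.independent B" "ker d \<subseteq> poly.span B" "card B = poly.dim (ker d)"
  proof (rule poly.finite_basis_of_subset[OF S(1)])
    show "ker d \<subseteq> poly.span S" using S(2) by (auto simp: ker_def)
  qed
  have cardB: "card B = k" using B(5) dim[OF d] by simp
  obtain F0 where F0: "bij_betw F0 {..<k} B"
    using ex_bij_betw_nat_finite[OF B(1)] cardB by (metis atLeast0LessThan)
  define F where "F = restrict F0 {..<k}"
  have FB: "F ` {..<k} = B" "inj_on F {..<k}"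
    using F0 by (auto simp: F_def bij_betw_def inj_on_def)
  have spanB: "poly.span B = ker d" using B poly.span_minimal[OF B(2) sub] by blast
  have Fframe: "F \<in> frames k ?V"
    using FB B F0 by (auto simp: frames_def F_def ker_def bij_betw_def)
  define G where "G n = restrict (\<lambda>i. \<phi> n (F i)) {..<k}" for n
  have GB: "G n ` {..<k} = \<phi> n ` B" for n
    using FB by (auto simp: G_def)
  have Gframe: "G n \<in> frames k ?V" for n
  proof -
    have FV: "F i \<in> ?V" "F i \<in> ker d" if "i < k" for i
      using FB(1) B(2) that by (auto simp: ker_def)
    have "\<phi> n (F i) \<in> ?V" if "i < k" for i
      using \<phi>_ker[OF FV(1)[OF that]] by (simp add: ker_def)
    then have "G n \<in> {..<k} \<rightarrow>\<^sub>E ?V" by (simp add: G_def)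
    moreover have "inj_on (G n) {..<k}"
    proof (rule inj_onI)
      fix i j assume ij: "i \<in> {..<k}" "j \<in> {..<k}" "G n i = G n j"
      then have "\<phi> n (F i) = \<phi> n (F j)" by (simp add: G_def)
      then have "F i = F j" using inj_onD[OF \<phi>_inj] FV(2) ij by blast
      then show "i = j" using inj_onD[OF FB(2)] ij by blast
    qed
    moreover have "poly.independent (G n ` {..<k})"
      unfolding GB using \<phi>_linear B(3) \<phi>_inj spanB
      by (intro vp.linear_independent_injective_image) auto
    ultimately show ?thesis by (simp add: frames_def)
  qed
  have Gspan: "poly.span (G n ` {..<k}) = ker (c n)" for n
  proof (rule poly.subspace_eq_if_dim_ge[OF S(1)])
    show "ker (c n) \<subseteq> poly.span S" using S by (auto simp: ker_def)
    show "poly.span (G n ` {..<k}) \<subseteq> ker (c n)"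
      unfolding GB using B(2) \<phi>_ker by (intro poly.span_minimal sub) (auto simp: ker_def)
    have "poly.dim (poly.span (G n ` {..<k})) = k"
      using span_frame_in_grassmannian[OF subspace_homog Gframe] by (simp add: grassmannian_def)
    then show "poly.dim (ker (c n)) \<le> poly.dim (poly.span (G n ` {..<k}))" by (simp only: dim[OF c])
  qed (rule poly.subspace_span)
  have Glim: "limitin (subtopology (product_topology (\<lambda>_. poly_topology) {..<k}) (frames k ?V)) G F sequentially"
    unfolding limitin_subtopology limitin_componentwise
  proof (intro conjI ballI)
    show "F \<in> extensional {..<k}" by (simp add: F_def)
    fix i assume i: "i \<in> {..<k}"
    then have "F i \<in> ker d" using FB B(2) by blast
    from \<phi>_lim[OF this] i show "limitin poly_topology (\<lambda>n. G n i) (F i) sequentially" by (simp add: G_def)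
  qed (use Fframe Gframe in \<open>auto simp: G_def\<close>)
  have "limitin (grassmannian_topology k ?V) (\<lambda>n. ker (c n)) (ker d) sequentially"
    unfolding limitin_def topspace_grassmannian_topology[OF subspace_homog]
  proof (intro conjI allI impI)
    show "ker d \<in> grassmannian k ?V"
      using sub dim[OF d] by (auto simp: grassmannian_def ker_def)
    fix U assume U: "openin (grassmannian_topology k ?V) U \<and> ker d \<in> U"
    let ?P = "{F \<in> frames k ?V. poly.span (F ` {..<k}) \<in> U}"
    have "openin (subtopology (product_topology (\<lambda>_. poly_topology) {..<k}) (frames k ?V)) ?P"
      using U unfolding openin_grassmannian_topology by blast
    moreover have "F \<in> ?P" using U Fframe FB spanB by simp
    ultimately have "\<forall>\<^sub>F n in sequentially. G n \<in> ?P"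
      using Glim unfolding limitin_def by blast
    then show "\<forall>\<^sub>F n in sequentially. ker (c n) \<in> U"
      by (rule eventually_mono) (simp add: Gspan)
  qed
  then show ?thesis unfolding ker_def k_def .
qed

section \<open>Points converging to the jets\<close>

text \<open>
  The \<open>q + 2\<close> points \<open>t = 0\<close>, \<open>t = \<epsilon> e\<^sub>l\<close>, \<open>t = \<epsilon>\<^sup>2 (1, \<dots>, 1)\<close>.
\<close>

primrec pcoord :: "complex \<Rightarrow> 'q jet \<Rightarrow> 'q \<Rightarrow> complex" where
  "pcoord \<epsilon> Value = (\<lambda>j. 0)"
| "pcoord \<epsilon> (Slope l) = (\<lambda>j. if j = l then \<epsilon> else 0)"
| "pcoord \<epsilon> Trace = (\<lambda>j. \<epsilon>\<^sup>2)"

definition jet_point :: "complex \<Rightarrow> 'q::finite jet \<Rightarrow> complex ^ 'q option" where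
  "jet_point \<epsilon> i = (\<chi> a. case a of None \<Rightarrow> 1 | Some j \<Rightarrow> pcoord \<epsilon> i j)"

text \<open>
  The value of \<open>t\<^sup>\<mu>\<close> at a point.
\<close>

definition point_eval :: "complex \<Rightarrow> 'q::finite jet \<Rightarrow> ('q \<Rightarrow>\<^sub>0 nat) \<Rightarrow> complex" where
  "point_eval \<epsilon> i \<mu> = (\<Prod>j\<in>UNIV. pcoord \<epsilon> i j ^ Poly_Mapping.lookup \<mu> j)"

lemma jet_point_nth [simp]: "jet_point \<epsilon> i $ None = 1" "jet_point \<epsilon> i $ Some j = pcoord \<epsilon> i j"
  by (simp_all add: jet_point_def)

lemma peval_scaled:
  assumes f: "f \<in> homog s t u"
  shows "peval f (a *s p) (b *s p') (c *s p'') = a ^ s * b ^ t * c ^ u * peval f p p' p''"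
proof -
  have scale: "(\<Prod>i\<in>UNIV. (a *s p) $ i ^ Poly_Mapping.lookup m i) = a ^ deg m * (\<Prod>i\<in>UNIV. p $ i ^ Poly_Mapping.lookup m i)"
    for a and p :: "complex ^ 'x::finite" and m
    by (simp add: power_mult_distrib prod.distrib deg_def power_sum)
  show ?thesis
    unfolding peval_def sum_distrib_left
  proof (intro sum.cong refl)
    fix m assume m: "m \<in> Poly_Mapping.keys f"
    obtain m1 m2 m3 where mm: "m = (m1, m2, m3)" by (cases m)
    have "deg m1 = s" "deg m2 = t" "deg m3 = u" using homogD[OF f m] by (auto simp: mm mdeg_Pair)
    then show "(case m of (m1, m2, m3) \<Rightarrow> Poly_Mapping.lookup f (m1, m2, m3)
        * (\<Prod>i\<in>UNIV. (a *s p) $ i ^ Poly_Mapping.lookup m1 i)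
        * (\<Prod>j\<in>UNIV. (b *s p') $ j ^ Poly_Mapping.lookup m2 j)
        * (\<Prod>k\<in>UNIV. (c *s p'') $ k ^ Poly_Mapping.lookup m3 k))
      = a ^ s * b ^ t * c ^ u * (case m of (m1, m2, m3) \<Rightarrow> Poly_Mapping.lookup f (m1, m2, m3)
        * (\<Prod>i\<in>UNIV. p $ i ^ Poly_Mapping.lookup m1 i)
        * (\<Prod>j\<in>UNIV. p' $ j ^ Poly_Mapping.lookup m2 j)
        * (\<Prod>k\<in>UNIV. p'' $ k ^ Poly_Mapping.lookup m3 k))"
      unfolding mm prod.case scale by (simp add: algebra_simps)
  qed
qed

lemma peval_jet_point: "peval f (jet_point \<epsilon> i) (jet_point \<epsilon> i) (jet_point \<epsilon> i) = lin (\<lambda>m. point_eval \<epsilon> i (texp m)) f" for f :: "'q::finite cwpoly"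
  unfolding peval_def lin_def
  by (intro sum.cong refl)
    (auto simp: prod_UNIV_option point_eval_def lookup_texp power_add prod.distrib algebra_simps)

lemma pcoord_inj:
  assumes "CARD('q::finite) > 1" "\<epsilon> \<noteq> 0" "pcoord \<epsilon> i = pcoord \<epsilon> (k :: 'q jet)"
  shows "i = k"
proof -
  have other: "\<exists>l. l \<noteq> j" for j :: 'q
  proof (rule ccontr)
    assume "\<not> ?thesis"
    then have "UNIV \<subseteq> {j}" by auto
    then have "CARD('q) \<le> card {j}" by (intro card_mono) auto
    then show False using assms(1) by simp
  qed
  have eq: "pcoord \<epsilon> i j = pcoord \<epsilon> k j" for j using assms(3) by simp
  have ne: "\<exists>l. pcoord \<epsilon> (Slope j) l \<noteq> pcoord \<epsilon> Trace l" for j :: 'q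
    using other[of j] assms(2) by auto
  show ?thesis
  proof (cases i)
    case Value
    show ?thesis
    proof (cases k)
      case (Slope j)
      then show ?thesis using eq[of j] Value assms(2) by simp
    qed (use Value eq assms(2) in auto)
  next
    case (Slope j)
    then show ?thesis using eq[of j] eq ne[of j] assms(2) by (cases k) (auto split: if_splits)
  next
    case Trace
    show ?thesis
    proof (cases k)
      case (Slope j)
      then show ?thesis using ne[of j] eq Trace by metis
    qed (use Trace eq assms(2) in auto)
  qed
qed

definition point_lines :: "complex \<Rightarrow> ((complex ^ 'q::finite option) set \<times> (complex ^ 'q option) set \<times> (complex ^ 'q option) set) set" where
  "point_lines \<epsilon> = (\<lambda>i. (vec.span {jet_point \<epsilon> i}, vec.span {jet_point \<epsilon> i}, vec.span {jet_point \<epsilon> i})) ` UNIV"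

lemma jet_point_nonzero: "jet_point \<epsilon> i \<noteq> 0"
  by (metis jet_point_nth(1) zero_index zero_neq_one)

lemma vanishing_ideal_point_lines:
  "vanishing_ideal (point_lines \<epsilon>) \<inter> homog s t u = {f \<in> homog s t u. \<forall>i :: 'q::finite jet. lin (\<lambda>m. point_eval \<epsilon> i (texp m)) f = 0}"
proof (intro set_eqI iffI)
  fix f :: "'q cwpoly" assume f: "f \<in> vanishing_ideal (point_lines \<epsilon>) \<inter> homog s t u"
  have "peval f (jet_point \<epsilon> i) (jet_point \<epsilon> i) (jet_point \<epsilon> i) = 0" for i :: "'q jet"
    using f jet_point_nonzero[of \<epsilon> i] vec.span_base[of "jet_point \<epsilon> i" "{jet_point \<epsilon> i}"]
    unfolding vanishing_ideal_def point_lines_def by auto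
  then show "f \<in> {f \<in> homog s t u. \<forall>i. lin (\<lambda>m. point_eval \<epsilon> i (texp m)) f = 0}"
    using f by (simp add: peval_jet_point)
next
  fix f :: "'q cwpoly" assume f: "f \<in> {f \<in> homog s t u. \<forall>i. lin (\<lambda>m. point_eval \<epsilon> i (texp m)) f = 0}"
  then have hom: "f \<in> homog s t u" by simp
  show "f \<in> vanishing_ideal (point_lines \<epsilon>) \<inter> homog s t u"
    using f unfolding vanishing_ideal_def point_lines_def
    by (auto simp: vec.span_singleton peval_scaled[OF hom] peval_jet_point)
qed

text \<open>
  Combinations of the values \<open>E\<close> of a function at the points that approximate its jets. In
  \<open>Trace\<close>, the sum over \<open>l\<close> produces the coefficients of the \<open>t\<^sub>l\<^sup>2\<close> but also those of the \<open>t\<^sub>l\<close>, divided by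
  \<open>\<epsilon>\<close>; the point \<open>\<epsilon>\<^sup>2 (1, \<dots>, 1)\<close> cancels the latter. The factor \<open>1 / (1 - \<epsilon>)\<close> and the last term of
  \<open>Slope j\<close>, both without effect on the limit, correct the values on \<open>t\<^sub>j\<^sub>0\<^sup>2\<close>, so that the functionals
  are dual to the monomials \<open>jexp j0\<close> for each \<open>\<epsilon>\<close> and not only in the limit.
\<close>

primrec divdiff :: "'q::finite \<Rightarrow> complex \<Rightarrow> 'q jet \<Rightarrow> ('q jet \<Rightarrow> complex) \<Rightarrow> complex" where
  "divdiff j0 \<epsilon> Value = (\<lambda>E. E Value)"
| "divdiff j0 \<epsilon> Trace = (\<lambda>E. ((\<Sum>l\<in>UNIV. E (Slope l) - E Value) / \<epsilon>\<^sup>2 - (E Trace - E Value) / \<epsilon> ^ 3) / (1 - \<epsilon>))"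
| "divdiff j0 \<epsilon> (Slope j) = (\<lambda>E. (E (Slope j) - E Value) / \<epsilon>
    - of_bool (j = j0) * \<epsilon> * (((\<Sum>l\<in>UNIV. E (Slope l) - E Value) / \<epsilon>\<^sup>2 - (E Trace - E Value) / \<epsilon> ^ 3) / (1 - \<epsilon>)))"

lemma divdiff_Slope: "divdiff j0 \<epsilon> (Slope j) E = (E (Slope j) - E Value) / \<epsilon> - of_bool (j = j0) * \<epsilon> * divdiff j0 \<epsilon> Trace E"
  by simp

lemma lin_divdiff: "lin (\<lambda>m. divdiff j0 \<epsilon> i (\<lambda>k. e k m)) f = divdiff j0 \<epsilon> i (\<lambda>k. lin (e k) f)"
proof -
  have div: "lin (\<lambda>m. g m / a) f = lin g f / a" for g a
    using lin_scale_fun[of "1 / a" g f] by simp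
  show ?thesis
    by (cases i) (simp_all only: divdiff.simps div lin_diff_fun lin_sum_fun lin_scale_fun mult.assoc)
qed

lemma divdiff_zero_iff:
  assumes "\<epsilon> \<noteq> 0" "\<epsilon> \<noteq> 1"
  shows "(\<forall>i. divdiff j0 \<epsilon> i E = 0) \<longleftrightarrow> (\<forall>i. E i = 0)"
proof
  assume *: "\<forall>i. divdiff j0 \<epsilon> i E = 0"
  have v: "E Value = 0" using spec[OF *, of Value] by simp
  have s: "E (Slope j) = 0" for j using spec[OF *, of "Slope j"] spec[OF *, of Trace] v assms
    unfolding divdiff_Slope by (simp del: divdiff.simps)
  have t: "E Trace = 0" using spec[OF *, of Trace] v s assms by simp
  show "\<forall>i. E i = 0"
  proof
    show "E i = 0" for i using v s t by (cases i) auto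
  qed
next
  assume "\<forall>i. E i = 0"
  then show "\<forall>i. divdiff j0 \<epsilon> i E = 0"
    by (intro allI, case_tac i) auto
qed

lemma point_eval_Value: "point_eval \<epsilon> Value \<mu> = of_bool (\<mu> = 0)"
proof (cases "\<mu> = 0")
  case False
  then obtain j where "Poly_Mapping.lookup \<mu> j \<noteq> 0" by (metis lookup_zero poly_mapping_eqI)
  then show ?thesis using False by (auto simp: point_eval_def power_0_left)
qed (simp add: point_eval_def)

lemma point_eval_Slope: "point_eval \<epsilon> (Slope l) \<mu> = of_bool (\<mu> = Poly_Mapping.single l (deg \<mu>)) * \<epsilon> ^ deg \<mu>"
proof (cases "\<mu> = Poly_Mapping.single l (deg \<mu>)")
  case True
  then have "point_eval \<epsilon> (Slope l) \<mu> = point_eval \<epsilon> (Slope l) (Poly_Mapping.single l (deg \<mu>))" by simp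
  also have "\<dots> = (\<Prod>j\<in>UNIV. if j = l then \<epsilon> ^ deg \<mu> else 1)"
    unfolding point_eval_def by (intro prod.cong) (auto simp: lookup_single)
  finally show ?thesis using True by simp
next
  case False
  have "\<exists>j. j \<noteq> l \<and> Poly_Mapping.lookup \<mu> j \<noteq> 0"
  proof (rule ccontr)
    assume "\<not> ?thesis"
    then have "\<mu> = Poly_Mapping.single l (Poly_Mapping.lookup \<mu> l)"
      by (intro poly_mapping_eqI) (auto simp: lookup_single when_def)
    then show False using False by (metis deg_single)
  qed
  then have "point_eval \<epsilon> (Slope l) \<mu> = 0" unfolding point_eval_def by (auto simp: power_0_left)
  then show ?thesis using False by simp
qed

lemma point_eval_Trace: "point_eval \<epsilon> Trace \<mu> = \<epsilon> ^ (2 * deg \<mu>)"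
  by (simp add: point_eval_def deg_def power_mult power_sum)

definition is_pure :: "('q::finite \<Rightarrow>\<^sub>0 nat) \<Rightarrow> complex" where
  "is_pure \<mu> = of_bool (\<exists>j. \<mu> = Poly_Mapping.single j (deg \<mu>))"

lemma sum_point_eval_Slope:
  assumes "\<mu> \<noteq> 0"
  shows "(\<Sum>l\<in>UNIV. point_eval \<epsilon> (Slope l) \<mu>) = is_pure \<mu> * \<epsilon> ^ deg \<mu>"
proof (cases "\<exists>j. \<mu> = Poly_Mapping.single j (deg \<mu>)")
  case True
  then obtain j where j: "\<mu> = Poly_Mapping.single j (deg \<mu>)" by blast
  have "\<mu> = Poly_Mapping.single l (deg \<mu>) \<longleftrightarrow> l = j" for l
    using j assms by (metis deg_eq_0_iff lookup_single_eq lookup_single_not_eq)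
  then have "(\<Sum>l\<in>UNIV. point_eval \<epsilon> (Slope l) \<mu>) = (\<Sum>l\<in>UNIV. if l = j then \<epsilon> ^ deg \<mu> else 0)"
    unfolding point_eval_Slope by (intro sum.cong) auto
  then show ?thesis using True by (simp add: is_pure_def)
qed (simp add: point_eval_Slope is_pure_def)

lemma divdiff_Trace_point_eval:
  assumes "\<epsilon> \<noteq> 0"
  shows "divdiff j0 \<epsilon> Trace (\<lambda>k. point_eval \<epsilon> k \<mu>) =
    (if deg \<mu> \<le> 1 then 0 else (is_pure \<mu> * \<epsilon> ^ (deg \<mu> - 2) - \<epsilon> ^ (2 * (deg \<mu> - 2) + 1)) / (1 - \<epsilon>))"
proof (cases "\<mu> = 0")
  case True
  then show ?thesis by (simp add: point_eval_Value point_eval_Slope point_eval_Trace)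
next
  case False
  then have T: "divdiff j0 \<epsilon> Trace (\<lambda>k. point_eval \<epsilon> k \<mu>)
      = (is_pure \<mu> * \<epsilon> ^ deg \<mu> / \<epsilon>\<^sup>2 - \<epsilon> ^ (2 * deg \<mu>) / \<epsilon> ^ 3) / (1 - \<epsilon>)"
    by (simp add: sum_point_eval_Slope point_eval_Value point_eval_Trace)
  show ?thesis
  proof (cases "deg \<mu> \<le> 1")
    case True
    with False have "deg \<mu> = 1" by (metis deg_eq_0_iff le_neq_implies_less less_one)
    moreover from this obtain j where "\<mu> = Poly_Mapping.single j 1" using deg_eq_1E by (metis One_nat_def)
    then have "is_pure \<mu> = 1" by (auto simp: is_pure_def)
    ultimately show ?thesis unfolding T using assms by (simp add: power2_eq_square power3_eq_cube)
  next
    case False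
    then obtain n where "deg \<mu> = n + 2" by (metis add.commute le_Suc_ex not_less_eq_eq numeral_2_eq_2 One_nat_def)
    then show ?thesis unfolding T using assms
      by (simp add: power_add power_mult power2_eq_square power3_eq_cube field_simps)
  qed
qed

lemma dual_to_jets_divdiff:
  assumes "\<epsilon> \<noteq> 0" "\<epsilon> \<noteq> 1"
  shows "dual_to_jets j0 (\<lambda>i m. divdiff j0 \<epsilon> i (\<lambda>k. point_eval \<epsilon> k (texp m)))"
  unfolding dual_to_jets_def
proof (intro allI impI)
  fix i k m assume m: "texp m = jexp j0 k"
  have ne: "Poly_Mapping.single a (n::nat) = Poly_Mapping.single b m \<longleftrightarrow> a = b \<and> n = m \<or> n = 0 \<and> m = 0" for a b :: 'a and n m
    by (metis lookup_single_eq lookup_single_not_eq single_zero)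
  have z: "Poly_Mapping.single a (n::nat) = 0 \<longleftrightarrow> n = 0" for a :: 'a and n
    by (metis lookup_single_eq lookup_zero single_zero)
  have T: "divdiff j0 \<epsilon> Trace (\<lambda>l. point_eval \<epsilon> l (jexp j0 k)) = of_bool (k = Trace)"
    unfolding divdiff_Trace_point_eval[OF assms(1)] using assms by (cases k) (auto simp: is_pure_def)
  show "divdiff j0 \<epsilon> i (\<lambda>k. point_eval \<epsilon> k (texp m)) = of_bool (i = k)"
  proof (cases i)
    case Value
    then show ?thesis unfolding m by (cases k) (auto simp: point_eval_Value z)
  next
    case (Slope j)
    then show ?thesis unfolding m Slope divdiff_Slope T using assms
      by (cases k) (auto simp: point_eval_Value point_eval_Slope ne z power2_eq_square)
  next
    case Trace
    then show ?thesis unfolding m Trace T by auto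
  qed
qed

text \<open>
  All quotients are polynomial in \<open>\<epsilon>\<close> up to the factor \<open>1 / (1 - \<epsilon>)\<close>, with nonzero constant term only on
  the monomials that the jet sees.
\<close>

lemma tendsto_divdiff_point_eval:
  "((\<lambda>\<epsilon>. divdiff j0 \<epsilon> i (\<lambda>k. point_eval \<epsilon> k \<mu>)) \<longlongrightarrow> chi i \<mu>) (at 0)"
proof -
  have ev: "\<forall>\<^sub>F \<epsilon> in at (0::complex). \<epsilon> \<noteq> 0" by (simp add: eventually_at_filter)
  have val: "chi Trace \<mu> = (if deg \<mu> \<le> 1 then 0 else (is_pure \<mu> * 0 ^ (deg \<mu> - 2) - 0 ^ (2 * (deg \<mu> - 2) + 1)) / (1 - 0))"
  proof (cases "deg \<mu> = 2")
    case True
    then show ?thesis by (simp add: is_pure_def)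
  next
    case False
    then show ?thesis using deg_chi_Trace[of \<mu>] by (auto simp: power_0_left)
  qed
  have lim0: "((\<lambda>\<epsilon>. if deg \<mu> \<le> 1 then 0 else (is_pure \<mu> * \<epsilon> ^ (deg \<mu> - 2) - \<epsilon> ^ (2 * (deg \<mu> - 2) + 1)) / (1 - \<epsilon>))
     \<longlongrightarrow> (if deg \<mu> \<le> 1 then 0 else (is_pure \<mu> * 0 ^ (deg \<mu> - 2) - 0 ^ (2 * (deg \<mu> - 2) + 1)) / (1 - 0))) (at 0)"
  proof (cases "deg \<mu> \<le> 1")
    case False
    have "((\<lambda>\<epsilon>. (is_pure \<mu> * \<epsilon> ^ (deg \<mu> - 2) - \<epsilon> ^ (2 * (deg \<mu> - 2) + 1)) / (1 - \<epsilon>))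
     \<longlongrightarrow> (is_pure \<mu> * 0 ^ (deg \<mu> - 2) - 0 ^ (2 * (deg \<mu> - 2) + 1)) / (1 - 0)) (at (0::complex))"
      by (intro tendsto_intros) simp
    then show ?thesis using False by (simp only: if_False)
  qed simp
  have T: "((\<lambda>\<epsilon>. divdiff j0 \<epsilon> Trace (\<lambda>k. point_eval \<epsilon> k \<mu>)) \<longlongrightarrow> chi Trace \<mu>) (at 0)"
  proof (subst val, rule Lim_transform_eventually[OF lim0])
    show "\<forall>\<^sub>F \<epsilon> in at 0. (if deg \<mu> \<le> 1 then 0 else (is_pure \<mu> * \<epsilon> ^ (deg \<mu> - 2) - \<epsilon> ^ (2 * (deg \<mu> - 2) + 1)) / (1 - \<epsilon>))
        = divdiff j0 \<epsilon> Trace (\<lambda>k. point_eval \<epsilon> k \<mu>)"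
      by (rule eventually_mono[OF ev], rule sym, rule divdiff_Trace_point_eval)
  qed
  show ?thesis
  proof (cases i)
    case Value
    then show ?thesis by (simp add: point_eval_Value)
  next
    case Trace
    then show ?thesis using T by simp
  next
    case (Slope j)
    have "((\<lambda>\<epsilon>. (point_eval \<epsilon> (Slope j) \<mu> - point_eval \<epsilon> Value \<mu>) / \<epsilon>) \<longlongrightarrow> chi (Slope j) \<mu>) (at 0)"
    proof (cases "deg \<mu>")
      case 0
      then show ?thesis using deg_eq_0_iff[of \<mu>] by (simp add: point_eval_Value point_eval_Slope) (metis deg_single deg_zero n_not_Suc_n)
    next
      case (Suc n)
      then have "\<mu> \<noteq> 0" by auto
      have lim: "((\<lambda>\<epsilon>. of_bool (\<mu> = Poly_Mapping.single j (deg \<mu>)) * \<epsilon> ^ n)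
          \<longlongrightarrow> of_bool (\<mu> = Poly_Mapping.single j (deg \<mu>)) * 0 ^ n) (at (0::complex))"
        by (intro tendsto_intros)
      have "of_bool (\<mu> = Poly_Mapping.single j (deg \<mu>)) * 0 ^ n = chi (Slope j) \<mu>"
        using Suc by (cases n) auto
      with lim have lim': "((\<lambda>\<epsilon>. of_bool (\<mu> = Poly_Mapping.single j (deg \<mu>)) * \<epsilon> ^ n) \<longlongrightarrow> chi (Slope j) \<mu>) (at 0)"
        by (simp only:)
      show ?thesis
        by (rule Lim_transform_eventually[OF lim'], rule eventually_mono[OF ev])
          (use \<open>\<mu> \<noteq> 0\<close> Suc in \<open>auto simp: point_eval_Slope point_eval_Value\<close>)
    qed
    then have "((\<lambda>\<epsilon>. (point_eval \<epsilon> (Slope j) \<mu> - point_eval \<epsilon> Value \<mu>) / \<epsilon> - of_bool (j = j0) * \<epsilon> * divdiff j0 \<epsilon> Trace (\<lambda>k. point_eval \<epsilon> k \<mu>))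
      \<longlongrightarrow> chi (Slope j) \<mu> - of_bool (j = j0) * 0 * chi Trace \<mu>) (at 0)"
      by (intro tendsto_intros T)
    then show ?thesis unfolding Slope divdiff_Slope by simp
  qed
qed


section \<open>The jet ideal is a limit of ideals of points\<close>

lemma inj_point_line:
  assumes q: "CARD('q::finite) > 1" and \<epsilon>: "\<epsilon> \<noteq> 0"
  shows "inj (\<lambda>i :: 'q jet. vec.span {jet_point \<epsilon> i})"
proof (rule injI)
  fix i k :: "'q jet" assume "vec.span {jet_point \<epsilon> i} = vec.span {jet_point \<epsilon> k}"
  then have "jet_point \<epsilon> i \<in> vec.span {jet_point \<epsilon> k}" using vec.span_base[of "jet_point \<epsilon> i" "{jet_point \<epsilon> i}"] by simp
  then obtain a where a: "jet_point \<epsilon> i = a *s jet_point \<epsilon> k" by (auto simp: vec.span_singleton)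
  have "a = 1" using arg_cong[OF a, of "\<lambda>v. v $ None"] by simp
  then have "pcoord \<epsilon> i j = pcoord \<epsilon> k j" for j using arg_cong[OF a, of "\<lambda>v. v $ Some j"] by simp
  then show "i = k" using pcoord_inj[OF q \<epsilon>] by blast
qed

lemma point_line_in_proj_space: "vec.span {jet_point \<epsilon> i} \<in> proj_space"
  by (simp add: proj_space_def jet_point_nonzero)

lemma vanishing_ideal_point_lines_eq_dual_kernel:
  assumes "\<epsilon> \<noteq> 0" "\<epsilon> \<noteq> 1"
  shows "vanishing_ideal (point_lines \<epsilon>) \<inter> homog s t u
    = {f \<in> homog s t u. \<forall>i :: 'q::finite jet. lin (\<lambda>m. divdiff j0 \<epsilon> i (\<lambda>k. point_eval \<epsilon> k (texp m))) f = 0}"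
  unfolding vanishing_ideal_point_lines lin_divdiff divdiff_zero_iff[OF assms] ..

lemma vanishing_ideal_point_lines_generic:
  assumes q: "CARD('q::finite) > 1" and \<epsilon>: "\<epsilon> \<noteq> 0" "\<epsilon> \<noteq> 1"
  shows "vanishing_ideal (point_lines \<epsilon>) \<in> (generic_point_ideals CARD('q jet) :: 'q cwpoly set set)"
  unfolding generic_point_ideals_def
proof (intro CollectI exI conjI allI)
  show "vanishing_ideal (point_lines \<epsilon>) = (vanishing_ideal (point_lines \<epsilon>) :: 'q cwpoly set)" ..
  show "point_lines \<epsilon> \<subseteq> proj_space \<times> proj_space \<times> (proj_space :: (complex ^ 'q option) set set)"
    by (auto simp: point_lines_def point_line_in_proj_space)
  show "finite (point_lines \<epsilon> :: ((complex ^ 'q option) set \<times> _ \<times> _) set)"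
    by (simp add: point_lines_def)
  show "card (point_lines \<epsilon> :: ((complex ^ 'q option) set \<times> _ \<times> _) set) = CARD('q jet)"
    unfolding point_lines_def using inj_point_line[OF q \<epsilon>(1)] by (intro card_image) (auto simp: inj_def)
  fix s t u
  show "let V = homog s t u :: 'q cwpoly set in
    poly.dim V - poly.dim (vanishing_ideal (point_lines \<epsilon>) \<inter> V) = min CARD('q jet) (poly.dim V)"
    unfolding Let_def vanishing_ideal_point_lines_eq_dual_kernel[OF \<epsilon>, of s t u undefined]
    using dim_dual_kernel[OF dual_to_jets_divdiff[OF \<epsilon>, of "undefined :: 'q"] refl, of s t u] by linarith
qed

text \<open>
  The shift keeps \<open>\<epsilon>\<close> away from \<open>1\<close> and from \<open>1 / q\<close>; at the latter value a coefficient of the border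
  rank decomposition would vanish.
\<close>

definition eps :: "nat \<Rightarrow> nat \<Rightarrow> complex" where
  "eps q n = 1 / of_nat (n + q + 2)"

lemma eps_props: "eps q n \<noteq> 0" "eps q n \<noteq> 1" "1 / eps q n \<noteq> of_nat q"
proof -
  have "(of_nat (n + q + 2) :: complex) \<noteq> of_nat 1" "(of_nat (n + q + 2) :: complex) \<noteq> of_nat 0"
    "(of_nat (n + q + 2) :: complex) \<noteq> of_nat q"
    unfolding of_nat_eq_iff by simp_all
  then show "eps q n \<noteq> 0" "eps q n \<noteq> 1" "1 / eps q n \<noteq> of_nat q"
    unfolding eps_def by (simp_all del: of_nat_add)
qed

lemma filterlim_eps: "filterlim (eps q) (at 0) sequentially"
proof -
  have "(\<lambda>n. 1 / of_nat n :: complex) \<longlonglongrightarrow> 0" by (rule lim_1_over_n)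
  then have "(\<lambda>n. 1 / of_nat (n + (q + 2)) :: complex) \<longlonglongrightarrow> 0" by (rule LIMSEQ_ignore_initial_segment)
  then have "eps q \<longlonglongrightarrow> 0" unfolding eps_def[abs_def] by (simp only: add.assoc)
  then show ?thesis using eps_props by (simp add: filterlim_at)
qed

lemma limit_of_point_ideals_jet_ideal:
  assumes q: "CARD('q::finite) > 1"
  shows "limit_of_point_ideals CARD('q jet) (jet_ideal :: 'q cwpoly set)"
  unfolding limit_of_point_ideals_def Let_def
proof (intro exI[of _ "\<lambda>n. vanishing_ideal (point_lines (eps 0 n))"] conjI allI)
  show "vanishing_ideal (point_lines (eps 0 n)) \<in> (generic_point_ideals CARD('q jet) :: 'q cwpoly set set)" for n
    by (rule vanishing_ideal_point_lines_generic[OF q eps_props(1,2)])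
  fix s t u
  define j0 :: 'q where "j0 = undefined"
  let ?c = "\<lambda>n i m. divdiff j0 (eps 0 n) i (\<lambda>k. point_eval (eps 0 n) k (texp m))"
  have lim: "(\<lambda>n. ?c n i m) \<longlonglongrightarrow> chi i (texp m)" for i m
    by (rule filterlim_compose[OF tendsto_divdiff_point_eval filterlim_eps])
  have eq: "vanishing_ideal (point_lines (eps 0 n)) \<inter> homog s t u
      = {f \<in> homog s t u. \<forall>i :: 'q jet. lin (?c n i) f = 0}" for n
    by (rule vanishing_ideal_point_lines_eq_dual_kernel[OF eps_props(1,2)])
  from limitin_dual_kernels[OF dual_to_jets_divdiff[OF eps_props(1,2)] dual_to_jets_chi lim, of s t u]
  show "limitin (grassmannian_topology (poly.dim (homog s t u :: 'q cwpoly set)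
      - min CARD('q jet) (poly.dim (homog s t u :: 'q cwpoly set))) (homog s t u))
    (\<lambda>n. vanishing_ideal (point_lines (eps 0 n)) \<inter> homog s t u) ((jet_ideal :: 'q cwpoly set) \<inter> homog s t u) sequentially"
    unfolding jet_ideal_Int_homog eq .
qed

lemma has_point_dims_if_limit:
  assumes "limit_of_point_ideals CARD('q jet) (I :: 'q::finite cwpoly set)"
  shows "has_point_dims I"
  unfolding has_point_dims_def
proof (intro allI)
  fix s t u
  let ?V = "homog s t u :: 'q cwpoly set"
  obtain J where "limitin (grassmannian_topology (poly.dim ?V - min CARD('q jet) (poly.dim ?V)) ?V)
     (\<lambda>n. J n \<inter> ?V) (I \<inter> ?V) sequentially"
    using assms unfolding limit_of_point_ideals_def Let_def by blast
  then have "I \<inter> ?V \<in> topspace (grassmannian_topology (poly.dim ?V - min CARD('q jet) (poly.dim ?V)) ?V)"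
    by (rule limitin_topspace)
  then have "poly.dim (I \<inter> ?V) = poly.dim ?V - min CARD('q jet) (poly.dim ?V)"
    unfolding topspace_grassmannian_topology[OF subspace_homog] by (simp add: grassmannian_def)
  then show "poly.dim ?V = poly.dim (I \<inter> ?V) + min CARD('q jet) (poly.dim ?V)" by simp
qed

section \<open>Border rank\<close>

lemma sum_in_sums_of_rank_one:
  assumes "finite N" "\<And>i. i \<in> N \<Longrightarrow> rank_one (T i)"
  shows "(\<Sum>i\<in>N. T i) \<in> sums_of_rank_one (card N)"
proof -
  obtain h where h: "bij_betw h {0..<card N} N" using ex_bij_betw_nat_finite[OF assms(1)] by blast
  then have h: "bij_betw h {..<card N} N" by (simp add: atLeast0LessThan)
  have "(\<Sum>i\<in>N. T i) = (\<Sum>l<card N. T (h l))" by (rule sum.reindex_bij_betw[OF h, symmetric])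
  moreover have "\<forall>l<card N. rank_one (T (h l))" using assms(2) h by (auto dest: bij_betwE)
  ultimately show ?thesis unfolding sums_of_rank_one_def by blast
qed

lemma point_eval_vexp: "point_eval \<epsilon> l (vexp i) = jet_point \<epsilon> l $ i"
proof (cases i)
  case (Some j)
  have "point_eval \<epsilon> l (vexp i) = (\<Prod>j'\<in>UNIV. if j' = j then pcoord \<epsilon> l j else 1)"
    unfolding point_eval_def Some by (intro prod.cong) (auto simp: lookup_single)
  then show ?thesis using Some by simp
qed (simp add: point_eval_def)

lemma point_eval_add: "point_eval \<epsilon> l (\<mu> + \<nu>) = point_eval \<epsilon> l \<mu> * point_eval \<epsilon> l \<nu>"
  by (simp add: point_eval_def lookup_add power_add prod.distrib)

text \<open>
  The entries of the tensor are values of the jet \<open>Trace\<close>, and \<open>Trace\<close> is the limit of a combination of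
  evaluations at points of the diagonal. Its coefficients \<open>c\<close> are the weights of rank one tensors.
\<close>

lemma T_cw_in_closure: "(T_cw :: ('q::finite option, 'q option, 'q option) tensor) \<in> closure (sums_of_rank_one CARD('q jet))"
  unfolding closure_sequential
proof (intro exI conjI allI)
  define c where "c \<epsilon> l = (case l of Value \<Rightarrow> (1 / \<epsilon> ^ 3 - of_nat CARD('q) / \<epsilon>\<^sup>2) / (1 - \<epsilon>)
    | Slope j \<Rightarrow> 1 / \<epsilon>\<^sup>2 / (1 - \<epsilon>) | Trace \<Rightarrow> - 1 / \<epsilon> ^ 3 / (1 - \<epsilon>))" for \<epsilon> :: complex and l :: "'q jet"
  define T where "T \<epsilon> = (\<Sum>l\<in>UNIV. tensor_prod (c \<epsilon> l *s jet_point \<epsilon> l) (jet_point \<epsilon> l) (jet_point \<epsilon> l) :: ('q option, 'q option, 'q option) tensor)" for \<epsilon>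
  let ?e = "eps CARD('q)"
  show "T (?e n) \<in> sums_of_rank_one CARD('q jet)" for n
    unfolding T_def
  proof (rule sum_in_sums_of_rank_one)
    fix l :: "'q jet"
    have "c (?e n) l \<noteq> 0"
    proof (cases l)
      case Value
      have "(1 / ?e n ^ 3 - of_nat CARD('q) / (?e n)\<^sup>2) = (1 / ?e n - of_nat CARD('q)) / (?e n)\<^sup>2"
        using eps_props(1)[of "CARD('q)" n] by (simp add: field_simps power2_eq_square power3_eq_cube)
      then show ?thesis using eps_props[of "CARD('q)" n] Value by (simp add: c_def)
    qed (use eps_props[of "CARD('q)" n] in \<open>simp_all add: c_def\<close>)
    then have "tensor_prod (c (?e n) l *s jet_point (?e n) l) (jet_point (?e n) l) (jet_point (?e n) l) $ None $ None $ None \<noteq> 0"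
      by (simp add: tensor_prod_def)
    then have "tensor_prod (c (?e n) l *s jet_point (?e n) l) (jet_point (?e n) l) (jet_point (?e n) l) \<noteq> 0" by (metis zero_index)
    then show "rank_one (tensor_prod (c (?e n) l *s jet_point (?e n) l) (jet_point (?e n) l) (jet_point (?e n) l))"
      unfolding rank_one_def by blast
  qed simp
  have entry: "T \<epsilon> $ i $ j $ k = divdiff undefined \<epsilon> Trace (\<lambda>l. point_eval \<epsilon> l (vexp i + vexp j + vexp k))" for \<epsilon> i j k
  proof -
    have "T \<epsilon> $ i $ j $ k = (\<Sum>l\<in>UNIV. c \<epsilon> l * point_eval \<epsilon> l (vexp i + vexp j + vexp k))"
      unfolding T_def by (simp add: tensor_prod_def point_eval_add point_eval_vexp mult.assoc)
    also have "\<dots> = divdiff undefined \<epsilon> Trace (\<lambda>l. point_eval \<epsilon> l (vexp i + vexp j + vexp k))" (is "_ = divdiff _ _ _ ?E")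
    proof -
      have S1: "(\<Sum>l\<in>UNIV. ?E (Slope l) - ?E Value) = (\<Sum>l\<in>UNIV. ?E (Slope l)) - of_nat CARD('q) * ?E Value"
        by (simp add: sum_subtractf)
      have S2: "(\<Sum>l\<in>UNIV. c \<epsilon> (Slope l) * ?E (Slope l)) = 1 / \<epsilon>\<^sup>2 / (1 - \<epsilon>) * (\<Sum>l\<in>UNIV. ?E (Slope l))"
        by (simp add: c_def sum_distrib_left)
      show ?thesis
        unfolding sum_UNIV_jet divdiff.simps S1 S2
        by (simp add: c_def divide_inverse algebra_simps)
    qed
    finally show ?thesis .
  qed
  show "(\<lambda>n. T (?e n)) \<longlonglongrightarrow> T_cw"
    by (intro vec_tendstoI) (simp only: entry T_cw_nth, rule filterlim_compose[OF tendsto_divdiff_point_eval filterlim_eps])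
qed

text \<open>
  Strassen's condition, with linear systems in place of inverse matrices. If a tensor is a sum of as many
  rank one terms as its dimension, its slices are \<open>A D B\<close> with fixed square matrices \<open>A, B\<close> and diagonal
  \<open>D\<close>. If one slice \<open>S g\<close> is invertible, \<open>S h' (S g)\<^sup>-\<^sup>1 S h\<close> is symmetric in \<open>h\<close> and \<open>h'\<close>, as diagonal
  matrices commute.
\<close>

lemma strassen_commutation:
  fixes a b :: "'n::finite \<Rightarrow> complex ^ 'n"
  defines "S \<equiv> \<lambda>g. (\<chi> i j. \<Sum>p\<in>UNIV. g p * (a p $ i * b p $ j)) :: complex ^ 'n ^ 'n"
  assumes det: "det (S g) \<noteq> 0" and v: "S g *v v = S h *v e" and v': "S g *v v' = S h' *v e"
  shows "S h' *v v = S h *v v'"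
proof -
  let ?A = "\<chi> i p. a p $ i"
  have S: "S g *v v = ?A *v (\<chi> p. g p * (\<Sum>j\<in>UNIV. b p $ j * v $ j))" for g v
  proof (rule vec_eq_iff[THEN iffD2], rule allI)
    fix i
    have "(S g *v v) $ i = (\<Sum>j\<in>UNIV. \<Sum>p\<in>UNIV. g p * (a p $ i * b p $ j) * v $ j)"
      by (simp add: S_def matrix_vector_mult_def sum_distrib_right)
    also have "\<dots> = (\<Sum>p\<in>UNIV. \<Sum>j\<in>UNIV. g p * (a p $ i * b p $ j) * v $ j)" by (rule sum.swap)
    also have "\<dots> = (\<Sum>p\<in>UNIV. a p $ i * (g p * (\<Sum>j\<in>UNIV. b p $ j * v $ j)))"
      by (simp add: sum_distrib_left algebra_simps)
    finally show "(S g *v v) $ i = (?A *v (\<chi> p. g p * (\<Sum>j\<in>UNIV. b p $ j * v $ j))) $ i"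
      by (simp add: matrix_vector_mult_def)
  qed
  have "S g = ?A ** (\<chi> p j. g p * b p $ j)"
    by (simp add: S_def matrix_matrix_mult_def vec_eq_iff algebra_simps)
  then have "det ?A * det (\<chi> p j. g p * b p $ j) \<noteq> 0" using det by (simp add: det_mul)
  then have A: "det ?A \<noteq> 0" and G: "det (\<chi> p j. g p * b p $ j) \<noteq> 0" by auto
  have g: "g p \<noteq> 0" for p
  proof
    assume "g p = 0"
    then have "row p (\<chi> p j. g p * b p $ j) = 0" by (simp add: row_def vec_eq_iff)
    then show False using det_zero_row G by blast
  qed
  have inj: "inj ((*v) ?A)" using A invertible_det_nz[of ?A] inj_matrix_vector_mult by blast
  let ?\<beta> = "\<lambda>v p. \<Sum>j\<in>UNIV. b p $ j * v $ j"
  have "(\<chi> p. g p * ?\<beta> v p) = (\<chi> p. h p * ?\<beta> e p)" "(\<chi> p. g p * ?\<beta> v' p) = (\<chi> p. h' p * ?\<beta> e p)"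
    using v v' unfolding S by (auto dest!: injD[OF inj])
  then have e: "g p * ?\<beta> v p = h p * ?\<beta> e p" "g p * ?\<beta> v' p = h' p * ?\<beta> e p" for p
    by (simp_all add: vec_eq_iff)
  have "h' p * ?\<beta> v p = h p * ?\<beta> v' p" for p
  proof -
    have "g p * (h' p * ?\<beta> v p) = g p * (h p * ?\<beta> v' p)"
      unfolding mult.left_commute[of "g p"] e[of p] by (rule mult.left_commute)
    then show ?thesis using g by simp
  qed
  then show ?thesis unfolding S by simp
qed

lemma tendsto_det:
  fixes A :: "'t \<Rightarrow> complex ^ 'n ^ 'n::finite"
  assumes "\<And>i j. ((\<lambda>n. A n $ i $ j) \<longlongrightarrow> B $ i $ j) F"
  shows "((\<lambda>n. det (A n)) \<longlongrightarrow> det B) F"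
  unfolding det_def by (intro tendsto_intros assms)

text \<open>
  Cramer's formula makes the dependence of the solution on the matrix visibly continuous.
\<close>

definition cramer_solution :: "complex ^ 'n ^ 'n \<Rightarrow> complex ^ 'n \<Rightarrow> complex ^ 'n::finite" where
  "cramer_solution A b = (\<chi> k. det (\<chi> i j. if j = k then b $ i else A $ i $ j) / det A)"

lemma cramer_solution_iff: "det A \<noteq> 0 \<Longrightarrow> A *v x = b \<longleftrightarrow> x = cramer_solution A b"
  unfolding cramer_solution_def by (rule cramer)

lemma tendsto_cramer_solution:
  assumes "\<And>i j. ((\<lambda>n. A n $ i $ j) \<longlongrightarrow> A' $ i $ j) F" "\<And>i. ((\<lambda>n. b n $ i) \<longlongrightarrow> b' $ i) F" "det A' \<noteq> 0"
  shows "((\<lambda>n. cramer_solution (A n) (b n) $ k) \<longlongrightarrow> cramer_solution A' b' $ k) F"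
  unfolding cramer_solution_def vec_lambda_beta
  by (intro tendsto_divide tendsto_det assms) (simp add: assms)

lemma sums_of_rank_one_indexed:
  assumes T: "T \<in> sums_of_rank_one r" and r: "r \<le> CARD('n::finite)"
  obtains a b c where "T = (\<Sum>p\<in>(UNIV :: 'n set). tensor_prod (a p) (b p) (c p))"
proof -
  obtain X where X: "T = (\<Sum>l<r. X l)" "\<forall>l<r. rank_one (X l)" using T unfolding sums_of_rank_one_def by blast
  then have "\<forall>l<r. \<exists>a b c. X l = tensor_prod a b c" unfolding rank_one_def by blast
  then obtain a b c where abc: "\<And>l. l < r \<Longrightarrow> X l = tensor_prod (a l) (b l) (c l)" by metis
  obtain h :: "'n \<Rightarrow> nat" where h: "bij_betw h UNIV {..<CARD('n)}"
    using ex_bij_betw_finite_nat[of "UNIV :: 'n set"] by (auto simp: atLeast0LessThan)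
  have "(\<Sum>l<r. X l) = (\<Sum>l<CARD('n). tensor_prod (if l < r then a l else 0) (b l) (c l))"
    using r by (intro sum.mono_neutral_cong_left) (auto simp: abc tensor_prod_def vec_eq_iff)
  also have "\<dots> = (\<Sum>p\<in>(UNIV :: 'n set). tensor_prod (if h p < r then a (h p) else 0) (b (h p)) (c (h p)))"
    by (rule sum.reindex_bij_betw[OF h, symmetric])
  finally have "T = (\<Sum>p\<in>(UNIV :: 'n set). tensor_prod (if h p < r then a (h p) else 0) (b (h p)) (c (h p)))"
    using X(1) by simp
  then show ?thesis by (rule that)
qed

text \<open>
  Strassen's condition passes to limits as long as one slice stays invertible. For the tensor, the sum of
  the slices \<open>None\<close> and \<open>Some \<beta>\<close> is invertible, but the condition fails for the slices \<open>Some \<beta>\<close> and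
  \<open>Some \<gamma>\<close>: the two sides differ in the entry \<open>Some \<beta>\<close>, where they are \<open>- 1\<close> and \<open>0\<close>.
\<close>

lemma T_cw_not_in_closure:
  assumes q: "CARD('q::finite) > 1" and r: "r \<le> CARD('q option)"
  shows "(T_cw :: ('q option, 'q option, 'q option) tensor) \<notin> closure (sums_of_rank_one r)"
proof
  assume "(T_cw :: ('q option, 'q option, 'q option) tensor) \<in> closure (sums_of_rank_one r)"
  then obtain T :: "nat \<Rightarrow> ('q option, 'q option, 'q option) tensor"
    where T: "\<And>n. T n \<in> sums_of_rank_one r" and lim: "T \<longlonglongrightarrow> T_cw"
    unfolding closure_sequential by blast
  define \<beta> :: 'q where "\<beta> = undefined"
  obtain \<gamma> where \<gamma>: "\<gamma> \<noteq> \<beta>"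
  proof (rule ccontr)
    assume "\<not> thesis"
    then have "UNIV \<subseteq> {\<beta>}" using that by auto
    then have "CARD('q) \<le> card {\<beta>}" by (intro card_mono) auto
    then show False using q by simp
  qed
  let ?T = "T_cw :: ('q option, 'q option, 'q option) tensor"
  define N where "N T = (\<chi> i j. T $ i $ j $ None + T $ i $ j $ Some \<beta>)" for T :: "('q option, 'q option, 'q option) tensor"
  define M where "M k T = (\<chi> i j. T $ i $ j $ Some k)" for k and T :: "('q option, 'q option, 'q option) tensor"
  define e where "e = (axis (Some \<gamma>) 1 :: complex ^ 'q option)"
  define v where "v k T = cramer_solution (N T) (M k T *v e)" for k T
  have limT: "(\<lambda>n. T n $ i $ j $ k) \<longlonglongrightarrow> ?T $ i $ j $ k" for i j k
    by (intro tendsto_vec_nth lim)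
  have limN: "(\<lambda>n. N (T n) $ i $ j) \<longlonglongrightarrow> N ?T $ i $ j" for i j
    unfolding N_def vec_lambda_beta by (intro tendsto_intros limT)
  have limM: "(\<lambda>n. (M k (T n)) $ i $ j) \<longlonglongrightarrow> M k ?T $ i $ j" for i j k
    unfolding M_def vec_lambda_beta by (intro limT)
  have Tv: "?T $ i $ j $ k = of_bool (i = None \<and> j = k \<and> k \<noteq> None \<or> j = None \<and> i = k \<and> k \<noteq> None \<or> k = None \<and> i = j \<and> j \<noteq> None)" for i j k
  proof -
    have p: "chi Trace (Poly_Mapping.single a (Suc 0) + Poly_Mapping.single b (Suc 0)) = of_bool (a = b)" for a b :: 'q
      using chi_pair(2)[of Trace a b] chi_pair(3)[of Trace a] by (cases "a = b") auto
    have d: "chi Trace \<mu> = 0" if "deg \<mu> \<noteq> 2" for \<mu> :: "'q \<Rightarrow>\<^sub>0 nat"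
      using deg_chi_Trace that by blast
    show ?thesis unfolding T_cw_nth
      by (cases i; cases j; cases k) (auto simp add: p d deg_add simp del: chi.simps)
  qed
  have s: "(\<Sum>j\<in>UNIV. of_bool (l = j) * y j) = y l" for l :: 'q and y :: "'q \<Rightarrow> complex"
  proof -
    have "(\<Sum>j\<in>UNIV. of_bool (l = j) * y j) = (\<Sum>j\<in>UNIV. if j = l then y l else 0)" by (intro sum.cong) auto
    then show ?thesis by simp
  qed
  have Nv: "(N ?T *v x) $ None = x $ Some \<beta>"
    "(N ?T *v x) $ Some l = x $ Some l + of_bool (l = \<beta>) * x $ None" for x l
    by (simp_all add: N_def matrix_vector_mult_def sum_UNIV_option Tv s[unfolded eq_commute[of _ \<beta>]] s
        flip: of_bool_conj)
  have detN: "det (N ?T) \<noteq> 0"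
  proof -
    have "x = 0" if x: "N ?T *v x = 0" for x
    proof -
      have \<beta>: "x $ Some \<beta> = 0" using arg_cong[OF x, of "\<lambda>v. v $ None"] by (simp add: Nv)
      moreover have "x $ None = 0" using arg_cong[OF x, of "\<lambda>v. v $ Some \<beta>"] \<beta> by (simp add: Nv)
      moreover have "x $ Some l = 0" for l
        using arg_cong[OF x, of "\<lambda>v. v $ Some l"] \<beta> by (cases "l = \<beta>") (simp_all add: Nv)
      ultimately show "x = 0" by (simp add: vec_eq_iff) (metis not_None_eq)
    qed
    then have "invertible (N ?T)" by (simp add: invertible_left_inverse matrix_left_invertible_ker)
    then show ?thesis by (simp add: invertible_det_nz)
  qed
  have ev: "\<forall>\<^sub>F n in sequentially. det (N (T n)) \<noteq> 0"
    using tendsto_imp_eventually_ne[OF tendsto_det[OF limN] detN] .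
  have comm: "M \<beta> (T n) *v v \<gamma> (T n) = M \<gamma> (T n) *v v \<beta> (T n)" if det: "det (N (T n)) \<noteq> 0" for n
  proof -
    obtain a b c where abc: "T n = (\<Sum>p\<in>(UNIV :: 'q option set). tensor_prod (a p) (b p) (c p))"
      using sums_of_rank_one_indexed[OF T r] by blast
    let ?S = "\<lambda>g. (\<chi> i j. \<Sum>p\<in>UNIV. g p * (a p $ i * b p $ j)) :: complex ^ 'q option ^ 'q option"
    have N: "N (T n) = ?S (\<lambda>p. c p $ None + c p $ Some \<beta>)"
      by (simp add: N_def abc vec_eq_iff tensor_prod_def algebra_simps sum.distrib)
    have M: "M k (T n) = ?S (\<lambda>p. c p $ Some k)" for k
      by (simp add: M_def abc vec_eq_iff tensor_prod_def algebra_simps)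
    have sol: "N (T n) *v v k (T n) = M k (T n) *v e" for k
      unfolding v_def using cramer_solution_iff[OF det] by blast
    show ?thesis
      using strassen_commutation[of "\<lambda>p. c p $ None + c p $ Some \<beta>" a b "v \<gamma> (T n)" "\<lambda>p. c p $ Some \<gamma>" e
          "v \<beta> (T n)" "\<lambda>p. c p $ Some \<beta>"] det sol unfolding N M by blast
  qed
  have limv: "(\<lambda>n. v k (T n) $ i) \<longlonglongrightarrow> v k ?T $ i" for k i
    unfolding v_def
    by (intro tendsto_cramer_solution limN detN) (auto simp: matrix_vector_mult_def intro!: tendsto_intros limM)
  have limMv: "(\<lambda>n. (M k (T n) *v v l (T n)) $ i) \<longlonglongrightarrow> (M k ?T *v v l ?T) $ i" for k l i
    unfolding matrix_vector_mult_def vec_lambda_beta by (intro tendsto_intros limM limv)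
  have "(\<lambda>n. (M \<gamma> (T n) *v v \<beta> (T n)) $ i) \<longlonglongrightarrow> (M \<beta> ?T *v v \<gamma> ?T) $ i" for i
    by (rule Lim_transform_eventually[OF limMv]) (rule eventually_mono[OF ev], simp add: comm)
  then have eq: "(M \<beta> ?T *v v \<gamma> ?T) $ i = (M \<gamma> ?T *v v \<beta> ?T) $ i" for i
    using limMv LIMSEQ_unique by blast
  have Me: "M k ?T *v e = (if k = \<gamma> then axis None 1 else 0)" for k
  proof (rule vec_eq_iff[THEN iffD2], rule allI)
    fix i
    have "(M k ?T *v e) $ i = ?T $ i $ Some \<gamma> $ Some k"
      by (simp add: M_def e_def matrix_vector_mult_def axis_def if_distrib[of "(*) _"] cong: if_cong)
    then show "(M k ?T *v e) $ i = (if k = \<gamma> then axis None 1 else 0) $ i"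
      by (auto simp: Tv axis_def)
  qed
  have "N ?T *v (axis (Some \<beta>) 1 - axis None 1) = axis None 1"
  proof (rule vec_eq_iff[THEN iffD2], rule allI)
    fix i show "(N ?T *v (axis (Some \<beta>) 1 - axis None 1)) $ i = axis None 1 $ i"
      by (cases i) (auto simp: Nv axis_def)
  qed
  then have v\<gamma>: "v \<gamma> ?T = axis (Some \<beta>) 1 - axis None 1"
    unfolding v_def Me using cramer_solution_iff[OF detN] by simp
  have "0 = cramer_solution (N ?T) 0" using cramer_solution_iff[OF detN, of 0 0] by simp
  then have v\<beta>: "v \<beta> ?T = 0" unfolding v_def Me using \<gamma> by simp
  show False
    using eq[of "Some \<beta>"] unfolding v\<gamma> v\<beta> M_def matrix_vector_mult_def sum_UNIV_option
    by (simp add: Tv axis_def)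
qed

lemma border_rank_T_cw:
  assumes "CARD('q::finite) > 1"
  shows "border_rank (T_cw :: ('q option, 'q option, 'q option) tensor) = CARD('q jet)"
  unfolding border_rank_def
proof (rule Least_equality)
  show "(T_cw :: ('q option, 'q option, 'q option) tensor) \<in> closure (sums_of_rank_one CARD('q jet))"
    by (rule T_cw_in_closure)
  fix r assume "(T_cw :: ('q option, 'q option, 'q option) tensor) \<in> closure (sums_of_rank_one r)"
  then have "\<not> r \<le> CARD('q option)" using T_cw_not_in_closure[OF assms] by blast
  then show "CARD('q jet) \<le> r" by (simp add: card_jet)
qed

theorem theorem1p5:
  assumes "CARD('q::finite) > 2"
  shows "\<exists>I. border_VSP (T_cw :: ('q option, 'q option, 'q option) tensor) = {I}"
proof (intro exI[of _ jet_ideal] set_eqI iffI)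
  have q: "CARD('q) > 1" using assms by simp
  fix I :: "'q cwpoly set"
  show "I \<in> {jet_ideal}" if "I \<in> border_VSP T_cw"
    using that eq_jet_ideal[OF assms, of I] has_point_dims_if_limit[of I]
    by (simp add: border_VSP_def border_rank_T_cw[OF q])
  show "I \<in> border_VSP T_cw" if "I \<in> {jet_ideal}"
  proof -
    have "jet_ideal \<inter> homog 1 1 1 \<subseteq> perp (T_cw :: ('q option, 'q option, 'q option) tensor)"
      unfolding jet_ideal_Int_homog using perp_T_cw_iff by blast
    then show ?thesis
      using that multigraded_jet_ideal limit_of_point_ideals_jet_ideal[OF q]
      by (simp add: border_VSP_def border_rank_T_cw[OF q])
  qed
qed

end
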